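(* Let $n\ge 2$, $1\le d\le n-1$, $s\in\mathbb{R}$, and let $w:\mathbb{Z}^n\times\mathbf{Gr}(d,n)\to(0,\infty)$ be a weight. Suppose that there exists $C_w>0$ such that $$\sum_{A\in\Omega_k} w(k,A)^2\le C_w^2,\qquad \Omega_k:=\{A\in\mathbf{Gr}(d,n) : k\perp A\},$$ for every $k\in\mathbb{Z}^n$. Then the adjoint of $R_d: H^s(\mathbb{T}^n)\to L_s^{2,2}(X_{d,n};w)$ is given by $$\widehat{R_d^*g}(k)=\sum_{A\in\Omega_k} w(k,A)^2\,\hat g(k,A),\qquad k\in\mathbb{Z}^n,$$ and the normal operator $R_d^*R_d:H^s(\mathbb{T}^n)\to H^s(\mathbb{T}^n)$ is the Fourier multiplier associated with $W_k:=\sum_{A\in\Omega_k}w(k,A)^2$. In particular, the mapping $F_{W_k^{-1}}R_d^*:R_d(\mathcal{T}')\to\mathcal{T}'$ is the inverse of $R_d$.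
   Context: Let $\mathbb{T}^n=\mathbb{R}^n/\mathbb{Z}^n$, $\mathcal{T}=C^\infty(\mathbb{T}^n)$, and let $\mathcal{T}'$ be its dual, the space of periodic distributions, with duality pairing $(\cdot,\cdot)$ (so $(f,g)=\int_{\mathbb{T}^n}fg$ for functions). Fourier coefficients are $\hat f(k)=(f,e^{-2\pi i k\cdot x})$, $k\in\mathbb{Z}^n$. $\mathbf{Gr}(d,n)$ is the set of all $d$-dimensional linear subspaces of $\mathbb{Q}^n$; $k\perp A$ means $k\cdot v=0$ for all $v\in A$. Radon transform: for $f\in\mathcal{T}$ and linearly independent $v_1,\dots,v_d\in\mathbb{Z}^n$, with $A=\{v_1,\dots,v_d\}$, $R_df(x,A)=\int_{[0,1]^d}f(x+t_1v_1+\cdots+t_dv_d)\,dt_1\cdots dt_d$. For $f\in\mathcal{T}'$, $R_df(\cdot,A)\in\mathcal{T}'$ is defined by $(R_df(\cdot,A),g)=(f,R_dg(\cdot,A))$ for all $g\in\mathcal{T}$. This depends only on the subspace of $\mathbb{Q}^n$ spanned by $A$, so $R_df(\cdot,A)$ is regarded as defined for $A\in\mathbf{Gr}(d,n)$. Fourier multipliers: for $\omega:\mathbb{Z}^n\to\mathbb{R}$, $F_\omega$ acts by $\widehat{F_\omega f}(k)=\omega(k)\hat f(k)$; $F_{W_k^{-1}}$ is the multiplier $k\mapsto W_k^{-1}$. Write $\langle k\rangle=(1+|k|^2)^{1/2}$. $H^s(\mathbb{T}^n)$ is the set of $f\in\mathcal{T}'$ with $\|f\|_{H^s}^2=\sum_k\langle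 k\rangle^{2s}|\hat f(k)|^2<\infty$, with the corresponding inner product $(f,g)_{H^s}=\sum_k\langle k\rangle^{2s}\hat f(k)\overline{\hat g(k)}$. Weights: a weight is a function $w:\mathbb{Z}^n\times\mathbf{Gr}(d,n)\to(0,\infty)$ such that for each fixed $A$ there exist $C,N>0$ (possibly depending on $A$) with $w(k,A)\ge C\langle k\rangle^{-N}$ for all $k\in\mathbb{Z}^n$ (at most of polynomial decay). Data space: $X_{d,n}=\mathbb{T}^n\times\mathbf{Gr}(d,n)$, and $L_s^{2,2}(X_{d,n};w)$ is the Hilbert space of families $g=\{g(\cdot,A)\}_{A\in\mathbf{Gr}(d,n)}$ with $g(\cdot,A)\in\mathcal{T}'$ and $\|g\|^2=\sum_{A}\|F_{w(\cdot,A)}g(\cdot,A)\|_{H^s(\mathbb{T}^n)}^2<\infty$, with inner product $(h,g)=\sum_A(F_{w(\cdot,A)}h(\cdot,A),F_{w(\cdot,A)}g(\cdot,A))_{H^s(\mathbb{T}^n)}$. Here $\hat g(k,A)$ is the $k$-th Fourier coefficient of $g(\cdot,A)$. On $R_d(\mathcal{T}')$, $R_d^*$ is understood through the displayed Fourier-coefficient formula. *)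

theory Defs
  imports "HOL-Analysis.Analysis"
begin

text \<open>
  The dimension is \<open>n = CARD('n)\<close>.  Functions on the torus are represented by
  \<open>\<int>\<^sup>n\<close>-periodic functions on \<open>\<real>\<^sup>n\<close>, frequencies by vectors of type
  \<open>int ^ 'n\<close>.  All functions and distributions are complex-valued.
\<close>

definition of_int_vec :: "int ^ 'n \<Rightarrow> 'a::ring_1 ^ 'n" where
  "of_int_vec k = (\<chi> i. of_int (k $ i))"

definition japanese_bracket :: "int ^ 'n::finite \<Rightarrow> real" where
  "japanese_bracket k = sqrt (1 + (norm (of_int_vec k :: real ^ 'n))\<^sup>2)"

definition partial_deriv :: "'n \<Rightarrow> (real ^ 'n \<Rightarrow> complex) \<Rightarrow> real ^ 'n::finite \<Rightarrow> complex" where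
  "partial_deriv i \<phi> x = frechet_derivative \<phi> (at x) (axis i 1)"

text \<open>A multi-index is written as the list of the directions of differentiation.\<close>

definition iter_partial :: "'n list \<Rightarrow> (real ^ 'n \<Rightarrow> complex) \<Rightarrow> real ^ 'n::finite \<Rightarrow> complex" where
  "iter_partial \<alpha> \<phi> = foldr partial_deriv \<alpha> \<phi>"

definition test_functions :: "(real ^ 'n::finite \<Rightarrow> complex) set" where
  "test_functions = {\<phi>. (\<forall>\<alpha>. iter_partial \<alpha> \<phi> differentiable_on UNIV) \<and>
                        (\<forall>x k. \<phi> (x + of_int_vec k) = \<phi> x)}"

type_synonym 'n distr = "(real ^ 'n \<Rightarrow> complex) \<Rightarrow> complex"

text \<open>
  The dual of the Frechet space of test functions; continuity is expressed by the
  defining seminorms of its topology.  Functionals are extensional, so that equality of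
  distributions is equality of HOL functions.
\<close>

definition distributions :: "'n::finite distr set" where
  "distributions = {f \<in> extensional test_functions.
     (\<forall>\<phi>\<in>test_functions. \<forall>\<psi>\<in>test_functions. f (\<lambda>x. \<phi> x + \<psi> x) = f \<phi> + f \<psi>) \<and>
     (\<forall>c. \<forall>\<phi>\<in>test_functions. f (\<lambda>x. c * \<phi> x) = c * f \<phi>) \<and>
     (\<exists>C N. \<forall>\<phi>\<in>test_functions.
        cmod (f \<phi>) \<le> C * (\<Sum>\<alpha> | length \<alpha> \<le> N. SUP x. cmod (iter_partial \<alpha> \<phi> x)))}"

definition fourier_coeff :: "'n::finite distr \<Rightarrow> int ^ 'n \<Rightarrow> complex" where
  "fourier_coeff f k = f (\<lambda>x. exp (- 2 * pi * \<i> * of_real (of_int_vec k \<bullet> x)))"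

definition has_fourier_coeffs :: "'n::finite distr \<Rightarrow> (int ^ 'n \<Rightarrow> complex) \<Rightarrow> bool" where
  "has_fourier_coeffs f a \<longleftrightarrow> f \<in> distributions \<and> (\<forall>k. fourier_coeff f k = a k)"

text \<open>
  A distribution is determined by its Fourier coefficients, but not every sequence occurs;
  \<open>distr_of_coeffs a\<close> is meaningful only if some \<open>f\<close> satisfies \<open>has_fourier_coeffs f a\<close>.
\<close>

definition distr_of_coeffs :: "(int ^ 'n \<Rightarrow> complex) \<Rightarrow> 'n::finite distr" where
  "distr_of_coeffs a = (THE f. has_fourier_coeffs f a)"

text \<open>
  A general symbol \<open>\<omega>\<close> need not be of polynomial growth, so the multiplier is a partial
  operator on distributions with the following natural domain.
\<close>

definition multiplier_domain :: "(int ^ 'n \<Rightarrow> real) \<Rightarrow> 'n::finite distr set" where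
  "multiplier_domain \<omega> =
     {f \<in> distributions. \<exists>h. has_fourier_coeffs h (\<lambda>k. of_real (\<omega> k) * fourier_coeff f k)}"

definition multiplier :: "(int ^ 'n \<Rightarrow> real) \<Rightarrow> 'n::finite distr \<Rightarrow> 'n distr" where
  "multiplier \<omega> f = distr_of_coeffs (\<lambda>k. of_real (\<omega> k) * fourier_coeff f k)"

definition sobolev :: "real \<Rightarrow> 'n::finite distr set" where
  "sobolev s = {f \<in> distributions.
     (\<lambda>k. japanese_bracket k powr (2 * s) * (cmod (fourier_coeff f k))\<^sup>2) summable_on UNIV}"

definition sobolev_norm :: "real \<Rightarrow> 'n::finite distr \<Rightarrow> real" where
  "sobolev_norm s f =
     sqrt (\<Sum>\<^sub>\<infinity>k. japanese_bracket k powr (2 * s) * (cmod (fourier_coeff f k))\<^sup>2)"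

definition sobolev_inner :: "real \<Rightarrow> 'n::finite distr \<Rightarrow> 'n distr \<Rightarrow> complex" where
  "sobolev_inner s f g =
     (\<Sum>\<^sub>\<infinity>k. of_real (japanese_bracket k powr (2 * s)) * fourier_coeff f k * cnj (fourier_coeff g k))"

definition Gr :: "nat \<Rightarrow> (rat ^ 'n::finite) set set" where
  "Gr d = {A. vec.subspace A \<and> vec.dim A = d}"

definition perp :: "int ^ 'n \<Rightarrow> (rat ^ 'n::finite) set \<Rightarrow> bool" where
  "perp k A \<longleftrightarrow> (\<forall>v\<in>A. (\<Sum>i\<in>UNIV. of_int (k $ i) * v $ i) = 0)"

definition Omega :: "nat \<Rightarrow> int ^ 'n \<Rightarrow> (rat ^ 'n::finite) set set" where
  "Omega d k = {A \<in> Gr d. perp k A}"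

definition radon_frame ::
  "(real ^ 'n \<Rightarrow> complex) \<Rightarrow> (int ^ 'n) list \<Rightarrow> real ^ 'n::finite \<Rightarrow> complex" where
  "radon_frame \<phi> vs x =
     (LINT t:({..<length vs} \<rightarrow>\<^sub>E {0..1})|(\<Pi>\<^sub>M j\<in>{..<length vs}. (lborel :: real measure)).
        \<phi> (x + (\<Sum>j<length vs. t j *\<^sub>R of_int_vec (vs ! j))))"

definition integer_basis :: "(int ^ 'n::finite) list \<Rightarrow> (rat ^ 'n) set \<Rightarrow> bool" where
  "integer_basis vs A \<longleftrightarrow> distinct vs \<and>
     vec.independent ((of_int_vec :: int ^ 'n \<Rightarrow> rat ^ 'n) ` set vs) \<and>
     vec.span ((of_int_vec :: int ^ 'n \<Rightarrow> rat ^ 'n) ` set vs) = A"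

text \<open>
  For periodic \<open>\<phi>\<close> the integral depends only on the rational span of the frame, so the
  choice of the basis is immaterial.
\<close>

definition radon_test ::
  "(real ^ 'n \<Rightarrow> complex) \<Rightarrow> (rat ^ 'n) set \<Rightarrow> real ^ 'n::finite \<Rightarrow> complex" where
  "radon_test \<phi> A = radon_frame \<phi> (SOME vs. integer_basis vs A)"

text \<open>Families of distributions over \<open>Gr d\<close> are extensional functions.\<close>

definition radon :: "nat \<Rightarrow> 'n::finite distr \<Rightarrow> (rat ^ 'n) set \<Rightarrow> 'n distr" where
  "radon d f = (\<lambda>A\<in>Gr d. \<lambda>\<phi>\<in>test_functions. f (radon_test \<phi> A))"

definition weight :: "nat \<Rightarrow> (int ^ 'n \<Rightarrow> (rat ^ 'n::finite) set \<Rightarrow> real) \<Rightarrow> bool" where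
  "weight d w \<longleftrightarrow> (\<forall>A\<in>Gr d. (\<forall>k. w k A > 0) \<and>
     (\<exists>C>0. \<exists>N>0. \<forall>k. w k A \<ge> C * japanese_bracket k powr (- N)))"

definition data_space ::
  "nat \<Rightarrow> real \<Rightarrow> (int ^ 'n \<Rightarrow> (rat ^ 'n) set \<Rightarrow> real) \<Rightarrow> ((rat ^ 'n::finite) set \<Rightarrow> 'n distr) set" where
  "data_space d s w = {g \<in> Gr d \<rightarrow>\<^sub>E distributions.
     (\<forall>A\<in>Gr d. g A \<in> multiplier_domain (\<lambda>k. w k A) \<and>
                multiplier (\<lambda>k. w k A) (g A) \<in> sobolev s) \<and>
     (\<lambda>A. (sobolev_norm s (multiplier (\<lambda>k. w k A) (g A)))\<^sup>2) summable_on Gr d}"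

definition data_norm ::
  "nat \<Rightarrow> real \<Rightarrow> (int ^ 'n \<Rightarrow> (rat ^ 'n) set \<Rightarrow> real) \<Rightarrow> ((rat ^ 'n::finite) set \<Rightarrow> 'n distr) \<Rightarrow> real" where
  "data_norm d s w g =
     sqrt (\<Sum>\<^sub>\<infinity>A\<in>Gr d. (sobolev_norm s (multiplier (\<lambda>k. w k A) (g A)))\<^sup>2)"

definition data_inner ::
  "nat \<Rightarrow> real \<Rightarrow> (int ^ 'n \<Rightarrow> (rat ^ 'n) set \<Rightarrow> real) \<Rightarrow>
     ((rat ^ 'n::finite) set \<Rightarrow> 'n distr) \<Rightarrow> ((rat ^ 'n) set \<Rightarrow> 'n distr) \<Rightarrow> complex" where
  "data_inner d s w h g =
     (\<Sum>\<^sub>\<infinity>A\<in>Gr d. sobolev_inner s (multiplier (\<lambda>k. w k A) (h A)) (multiplier (\<lambda>k. w k A) (g A)))"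

text \<open>
  The library's \<open>adjoint\<close> is for real inner product spaces given as types; here the spaces
  are sets with an explicit sesquilinear form.
\<close>

definition is_hilbert_adjoint ::
  "'a set \<Rightarrow> ('a \<Rightarrow> 'a \<Rightarrow> complex) \<Rightarrow> 'b set \<Rightarrow> ('b \<Rightarrow> 'b \<Rightarrow> complex) \<Rightarrow>
     ('a \<Rightarrow> 'b) \<Rightarrow> ('b \<Rightarrow> 'a) \<Rightarrow> bool" where
  "is_hilbert_adjoint H ipH K ipK T S \<longleftrightarrow>
     S \<in> K \<rightarrow>\<^sub>E H \<and> (\<forall>f\<in>H. \<forall>g\<in>K. ipK (T f) g = ipH f (S g))"

definition is_radon_adjoint ::
  "nat \<Rightarrow> real \<Rightarrow> (int ^ 'n \<Rightarrow> (rat ^ 'n) set \<Rightarrow> real) \<Rightarrow>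
     (((rat ^ 'n::finite) set \<Rightarrow> 'n distr) \<Rightarrow> 'n distr) \<Rightarrow> bool" where
  "is_radon_adjoint d s w =
     is_hilbert_adjoint (sobolev s) (sobolev_inner s) (data_space d s w) (data_inner d s w) (radon d)"

definition radon_adjoint ::
  "nat \<Rightarrow> real \<Rightarrow> (int ^ 'n \<Rightarrow> (rat ^ 'n) set \<Rightarrow> real) \<Rightarrow>
     ((rat ^ 'n::finite) set \<Rightarrow> 'n distr) \<Rightarrow> 'n distr" where
  "radon_adjoint d s w = (THE S. is_radon_adjoint d s w S)"

text \<open>
  The formula for the adjoint, used outside the data space to extend it to the range of the
  Radon transform on all distributions.
\<close>

definition adjoint_coeff ::
  "nat \<Rightarrow> (int ^ 'n \<Rightarrow> (rat ^ 'n) set \<Rightarrow> real) \<Rightarrow>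
     ((rat ^ 'n::finite) set \<Rightarrow> 'n distr) \<Rightarrow> int ^ 'n \<Rightarrow> complex" where
  "adjoint_coeff d w g k = (\<Sum>\<^sub>\<infinity>A\<in>Omega d k. of_real ((w k A)\<^sup>2) * fourier_coeff (g A) k)"

definition radon_star ::
  "nat \<Rightarrow> (int ^ 'n \<Rightarrow> (rat ^ 'n) set \<Rightarrow> real) \<Rightarrow>
     ((rat ^ 'n::finite) set \<Rightarrow> 'n distr) \<Rightarrow> 'n distr" where
  "radon_star d w g = distr_of_coeffs (adjoint_coeff d w g)"

definition normal_symbol :: "nat \<Rightarrow> (int ^ 'n \<Rightarrow> (rat ^ 'n::finite) set \<Rightarrow> real) \<Rightarrow> int ^ 'n \<Rightarrow> real" where
  "normal_symbol d w k = (\<Sum>\<^sub>\<infinity>A\<in>Omega d k. (w k A)\<^sup>2)"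

end

theory Submission
  imports Defs "HOL-Probability.Characteristic_Functions"
begin

text \<open>
  On the Fourier side the Radon transform is a cut-off: the coefficient of \<open>R f\<close> at \<open>(k, A)\<close> is
  that of \<open>f\<close> at \<open>k\<close> if \<open>k \<bottom> A\<close>, and \<open>0\<close> otherwise. All the assertions then reduce to Tonelli
  and Cauchy-Schwarz for double sums over \<open>k\<close> and \<open>A\<close>, together with \<open>W\<^sub>k > 0\<close>, which holds
  since \<open>d < n\<close> makes \<open>\<Omega>\<^sub>k\<close> nonempty. The analytic input is that distributions correspond
  exactly to coefficient sequences of at most polynomial growth. It rests on Fourier inversion for
  test functions, for which integrals can be avoided: on the grid \<open>(1/M) \<int>\<^sup>n\<close> inversion is
  a finite geometric sum, iterated difference quotients bound the discrete coefficients by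
  derivatives uniformly in \<open>M\<close>, and dominated convergence along \<open>M = 2\<^sup>m\<close> gives inversion at
  dyadic points, hence everywhere by continuity.
\<close>

subsection \<open>Characters and lattice sums\<close>

text \<open>Two obstacles shape the proof. Distributions are bounded by derivatives, the grid sees
  only samples, so the decay of discrete coefficients must not degrade with \<open>M\<close>. For
  |k_i| \<le> M/2 the symbol M (e^(2 pi i k_i/M) - 1) of a difference quotient has modulus at least
  4 |k_i|, so differencing is as good as differentiating. This is why inversion uses 2h points per
  direction and the symmetric frequency window -h..<h. Powers of two make the grids nested: a mean
  on a finer grid refines one on a coarser grid, and a dyadic point stays on all later grids. The
  other obstacle is the weight. Its lower bounds have constants depending on A, so 1/W_k may outgrow
  every polynomial; and it has no upper bound off Omega_k, where fortunately the coefficients of R f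
  vanish. Multipliers are therefore partial operators, and each use needs a proof that the argument
  lies in the domain. On the range of R the factor W_k cancels before the size of 1/W_k
  matters.\<close>

definition character :: "int ^ 'n \<Rightarrow> real ^ 'n::finite \<Rightarrow> complex" where
  "character k x = cis (2 * pi * (of_int_vec k \<bullet> x))"

lemma of_int_vec_nth [simp]: "of_int_vec k $ i = of_int (k $ i)"
  by (simp add: of_int_vec_def)

lemma of_int_vec_add: "of_int_vec (k + l) = of_int_vec k + of_int_vec l"
  by (simp add: vec_eq_iff)

lemma of_int_vec_uminus: "of_int_vec (- k) = - of_int_vec k"
  by (simp add: vec_eq_iff)

lemma of_int_vec_0 [simp]: "of_int_vec 0 = 0"
  by (simp add: vec_eq_iff)

lemma inner_of_int_vec: "of_int_vec k \<bullet> (x :: real ^ 'n::finite) = (\<Sum>i\<in>UNIV. of_int (k $ i) * x $ i)"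
  by (simp add: inner_vec_def)

lemma norm_character [simp]: "cmod (character k x) = 1"
  by (simp add: character_def)

lemma character_add: "character k (x + y) = character k x * character k y"
  by (simp add: character_def cis_mult inner_add_right algebra_simps)

lemma character_0 [simp]: "character k 0 = 1" "character 0 x = 1"
  by (simp_all add: character_def)

lemma character_freq_add: "character (k + l) x = character k x * character l x"
  by (simp add: character_def cis_mult of_int_vec_add inner_add_left algebra_simps)

lemma character_mult_uminus [simp]: "character k x * character (- k) x = 1" "character (- k) x * character k x = 1"
  by (simp_all flip: character_freq_add)

lemma character_prod: "character k x = (\<Prod>i\<in>UNIV. cis (2 * pi * (of_int (k $ i) * x $ i)))"
proof -
  have "cis (\<Sum>i\<in>A. f i) = (\<Prod>i\<in>A. cis (f i))" if "finite A" for A and f :: "'a \<Rightarrow> real"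
    using that by induction (auto simp: cis_mult[symmetric])
  then show ?thesis
    by (simp add: character_def inner_of_int_vec sum_distrib_left)
qed

lemma character_of_int_vec [simp]: "character k (of_int_vec l) = 1"
proof -
  have "of_int_vec k \<bullet> (of_int_vec l :: real ^ 'a) = of_int (\<Sum>i\<in>UNIV. k $ i * l $ i)"
    by (simp add: inner_of_int_vec)
  then show ?thesis
    by (simp only: character_def cis_multiple_2pi[OF Ints_of_int])
qed

lemma continuous_on_character [continuous_intros]:
  "continuous_on S f \<Longrightarrow> continuous_on S (\<lambda>x. character k (f x))"
  unfolding character_def cis_conv_exp by (intro continuous_intros)

lemma fourier_coeff_eq: "fourier_coeff f k = f (character (- k))"
proof -
  have "(\<lambda>x. exp (- 2 * pi * \<i> * of_real (of_int_vec k \<bullet> x))) = character (- k)"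
    by (simp add: fun_eq_iff character_def cis_conv_exp of_int_vec_uminus mult_ac)
  then show ?thesis by (simp add: fourier_coeff_def)
qed

section \<open>Size of the Japanese bracket\<close>

lemma japanese_bracket_ge_1: "1 \<le> japanese_bracket k"
  by (simp add: japanese_bracket_def)

lemma japanese_bracket_pos [simp]: "0 < japanese_bracket k"
  using japanese_bracket_ge_1[of k] by linarith

lemma japanese_bracket_nonneg [simp]: "0 \<le> japanese_bracket k"
  using japanese_bracket_pos[of k] by linarith

lemma japanese_bracket_uminus [simp]: "japanese_bracket (- k) = japanese_bracket k"
  by (simp add: japanese_bracket_def of_int_vec_uminus)

lemma japanese_bracket_sq: "(japanese_bracket k)\<^sup>2 = 1 + (norm (of_int_vec k :: real ^ 'n::finite))\<^sup>2"
  for k :: "int ^ 'n"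
  by (simp add: japanese_bracket_def)

lemma norm_le_japanese_bracket: "norm (of_int_vec k :: real ^ 'n::finite) \<le> japanese_bracket k"
  by (rule power2_le_imp_le) (simp_all add: japanese_bracket_sq)

lemma component_le_japanese_bracket: "\<bar>real_of_int (k $ i)\<bar> \<le> japanese_bracket k"
  using component_le_norm_cart[of "of_int_vec k" i] norm_le_japanese_bracket[of k] by simp

lemma japanese_bracket_le_sum: "japanese_bracket (k :: int ^ 'n::finite) \<le> 1 + (\<Sum>i\<in>UNIV. \<bar>real_of_int (k $ i)\<bar>)"
proof -
  have "japanese_bracket k \<le> 1 + norm (of_int_vec k :: real ^ 'n)"
    unfolding japanese_bracket_def by (rule real_le_lsqrt) (simp_all add: power2_eq_square algebra_simps)
  with norm_le_l1_cart[of "of_int_vec k :: real ^ 'n"] show ?thesis by simp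
qed

text \<open>With \<open>M\<close> the maximum of 1 and the |k_i|, the bracket is at most (n+1) M,
  and M^m is 1 or one of the |k_i|^m. Only powers of single components occur, so later only
  derivatives repeated in one direction are needed.\<close>

lemma japanese_bracket_power_le:
  "japanese_bracket (k :: int ^ 'n::finite) ^ m
    \<le> real (CARD('n) + 1) ^ m * (1 + (\<Sum>i\<in>UNIV. \<bar>real_of_int (k $ i)\<bar> ^ m))"
proof -
  define M where "M = Max (insert 1 ((\<lambda>i. \<bar>real_of_int (k $ i)\<bar>) ` UNIV))"
  have M: "M \<in> insert 1 ((\<lambda>i. \<bar>real_of_int (k $ i)\<bar>) ` UNIV)"
    unfolding M_def by (rule Max_in) auto
  have le: "\<bar>real_of_int (k $ i)\<bar> \<le> M" "1 \<le> M" for i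
    unfolding M_def by (rule Max_ge; simp)+
  have "japanese_bracket k \<le> 1 + (\<Sum>i\<in>(UNIV :: 'n set). \<bar>real_of_int (k $ i)\<bar>)"
    by (rule japanese_bracket_le_sum)
  also have "\<dots> \<le> M + (\<Sum>i\<in>(UNIV :: 'n set). M)"
    by (intro add_mono sum_mono le)
  also have "\<dots> = real (CARD('n) + 1) * M" by (simp add: algebra_simps)
  finally have "japanese_bracket k ^ m \<le> (real (CARD('n) + 1) * M) ^ m"
    by (intro power_mono) auto
  also have "\<dots> = real (CARD('n) + 1) ^ m * M ^ m" by (rule power_mult_distrib)
  also have "M ^ m \<le> 1 + (\<Sum>i\<in>UNIV. \<bar>real_of_int (k $ i)\<bar> ^ m)"
    using M
  proof
    assume "M = 1" then show ?thesis by (simp add: sum_nonneg)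
  next
    assume "M \<in> range (\<lambda>i. \<bar>real_of_int (k $ i)\<bar>)"
    then obtain i where "M = \<bar>real_of_int (k $ i)\<bar>" by auto
    then have "M ^ m \<le> (\<Sum>i\<in>UNIV. \<bar>real_of_int (k $ i)\<bar> ^ m)"
      using member_le_sum[of i UNIV "\<lambda>i. \<bar>real_of_int (k $ i)\<bar> ^ m"] by simp
    then show ?thesis by simp
  qed
  finally show ?thesis by (simp add: mult_left_mono)
qed

section \<open>Sums over lattice boxes and summability of bracket powers\<close>

lemma sum_lattice_box_prod:
  fixes f :: "'n::finite \<Rightarrow> int \<Rightarrow> 'a::comm_semiring_1"
  assumes "finite S"
  shows "(\<Sum>k | \<forall>i. k $ i \<in> S. \<Prod>i\<in>UNIV. f i (k $ i)) = (\<Prod>i\<in>UNIV. \<Sum>a\<in>S. f i a)"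
proof -
  have "(\<Prod>i\<in>UNIV. \<Sum>a\<in>S. f i a) = (\<Sum>g\<in>PiE UNIV (\<lambda>_. S). \<Prod>i\<in>UNIV. f i (g i))"
    using assms by (intro prod_sum_PiE) auto
  also have "\<dots> = (\<Sum>k | \<forall>i. k $ i \<in> S. \<Prod>i\<in>UNIV. f i (k $ i))"
    by (rule sum.reindex_bij_witness[of _ "\<lambda>k i. k $ i" "\<lambda>g. \<chi> i. g i"]) auto
  finally show ?thesis by simp
qed

lemma finite_lattice_box: "finite S \<Longrightarrow> finite {k :: int ^ 'n::finite. \<forall>i. k $ i \<in> S}"
proof -
  assume "finite S"
  then have "finite (PiE (UNIV :: 'n set) (\<lambda>_. S))" by (intro finite_PiE) auto
  then have "finite ((\<lambda>g. \<chi> i. g i) ` PiE (UNIV :: 'n set) (\<lambda>_. S))" by (rule finite_imageI)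
  moreover have "{k :: int ^ 'n. \<forall>i. k $ i \<in> S} \<subseteq> (\<lambda>g. \<chi> i. g i) ` PiE UNIV (\<lambda>_. S)"
  proof
    fix k :: "int ^ 'n" assume "k \<in> {k. \<forall>i. k $ i \<in> S}"
    then show "k \<in> (\<lambda>g. \<chi> i. g i) ` PiE UNIV (\<lambda>_. S)"
      by (intro image_eqI[of _ _ "\<lambda>i. k $ i"]) (auto simp: vec_eq_iff)
  qed
  ultimately show ?thesis by (rule finite_subset[rotated])
qed

lemma finite_subset_lattice_box:
  fixes F :: "(int ^ 'n::finite) set"
  assumes "finite F"
  obtains N :: nat where "F \<subseteq> {k. \<forall>i. k $ i \<in> {- int N..<int N}}"
proof -
  define S where "S = (\<lambda>(k, i). nat \<bar>k $ i\<bar>) ` (F \<times> (UNIV :: 'n set))"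
  have S: "finite S" using assms by (auto simp: S_def)
  have "k $ i \<in> {- int (Suc (Max (insert 0 S)))..<int (Suc (Max (insert 0 S)))}" if "k \<in> F" for k i
  proof -
    have "nat \<bar>k $ i\<bar> \<in> S" using that by (force simp: S_def)
    then have "nat \<bar>k $ i\<bar> \<le> Max (insert 0 S)" using S by (intro Max_ge) auto
    then show ?thesis by auto
  qed
  then show ?thesis using that by blast
qed

text \<open>The bound telescopes: passing from N to N+1 adds the indices N and -N-1, and each
  contributes at most 3/(N+1) - 3/(N+2).\<close>

lemma sum_inverse_sq_le: "(\<Sum>a\<in>{- int N..<int N}. 1 / (1 + (real_of_int a)\<^sup>2)) \<le> 6 - 6 / (real N + 1)"
proof (induction N)
  case (Suc N)
  \<comment> \<open>The product is 3 (1 + N^2) - (N+1)(N+2). It is negative only strictly between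
    1/2 and 1, hence at no integer.\<close>
  have "0 \<le> (2 * int N - 1) * (int N - 1)"
    by (cases "N = 0") auto
  then have "0 \<le> real_of_int ((2 * int N - 1) * (int N - 1))"
    by (simp only: of_int_0_le_iff)
  then have *: "(real N + 1) * (real N + 2) \<le> 3 * (1 + (real N)\<^sup>2)"
    by (simp add: algebra_simps power2_eq_square)
  have "1 / (1 + (real N)\<^sup>2) \<le> 3 / ((real N + 1) * (real N + 2))"
    using * by (simp add: field_simps add_pos_nonneg)
  also have "\<dots> = 3 / (real N + 1) - 3 / (real N + 2)"
    by (simp add: field_simps)
  finally have le: "1 / (1 + (real N)\<^sup>2) \<le> 3 / (real N + 1) - 3 / (real N + 2)" .
  have le': "1 / (1 + (real_of_int (- int N - 1))\<^sup>2) \<le> 1 / (1 + (real N)\<^sup>2)"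
    by (intro divide_left_mono) (auto simp: add_pos_nonneg power2_eq_square algebra_simps)
  have "{- int (Suc N)..<int (Suc N)} = insert (int N) (insert (- int N - 1) {- int N..<int N})" by auto
  then have "(\<Sum>a\<in>{- int (Suc N)..<int (Suc N)}. 1 / (1 + (real_of_int a)\<^sup>2))
      = 1 / (1 + (real N)\<^sup>2) + (1 / (1 + (real_of_int (- int N - 1))\<^sup>2) + (\<Sum>a\<in>{- int N..<int N}. 1 / (1 + (real_of_int a)\<^sup>2)))"
    by simp
  with Suc.IH le le' show ?case by (simp add: algebra_simps)
qed simp

text \<open>Since <k>^2 dominates each 1 + k_i^2, the power 2n dominates their product. Box sums of
  the product factor into one-dimensional sums, each at most 6.\<close>

lemma summable_japanese_bracket:
  "(\<lambda>k :: int ^ 'n::finite. 1 / japanese_bracket k ^ (2 * CARD('n))) summable_on UNIV"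
proof (rule nonneg_bounded_partial_sums_imp_summable_on)
  have *: "sum (\<lambda>k :: int ^ 'n. 1 / japanese_bracket k ^ (2 * CARD('n))) F \<le> 6 ^ CARD('n)" if "finite F" for F
  proof -
    obtain N where N: "F \<subseteq> {k :: int ^ 'n. \<forall>i. k $ i \<in> {- int N..<int N}}"
      using finite_subset_lattice_box[OF \<open>finite F\<close>] .
    have "sum (\<lambda>k :: int ^ 'n. 1 / japanese_bracket k ^ (2 * CARD('n))) F
        \<le> (\<Sum>k :: int ^ 'n | \<forall>i. k $ i \<in> {- int N..<int N}. 1 / japanese_bracket k ^ (2 * CARD('n)))"
      by (rule sum_mono2[OF finite_lattice_box N]) simp_all
    also have "\<dots> \<le> (\<Sum>k :: int ^ 'n | \<forall>i. k $ i \<in> {- int N..<int N}. \<Prod>i\<in>UNIV. 1 / (1 + (real_of_int (k $ i))\<^sup>2))"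
    proof (rule sum_mono)
      fix k :: "int ^ 'n"
      have "(\<Prod>i\<in>(UNIV :: 'n set). 1 + (real_of_int (k $ i))\<^sup>2) \<le> (\<Prod>i\<in>(UNIV :: 'n set). (japanese_bracket k)\<^sup>2)"
      proof (rule prod_mono)
        fix i
        have "\<bar>real_of_int (k $ i)\<bar> \<le> norm (of_int_vec k :: real ^ 'n)"
          using component_le_norm_cart[of "of_int_vec k :: real ^ 'n" i] by simp
        then have "(real_of_int (k $ i))\<^sup>2 \<le> (norm (of_int_vec k :: real ^ 'n))\<^sup>2"
          by (metis abs_ge_zero power2_abs power_mono)
        then show "0 \<le> 1 + (real_of_int (k $ i))\<^sup>2 \<and> 1 + (real_of_int (k $ i))\<^sup>2 \<le> (japanese_bracket k)\<^sup>2"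
          by (simp add: japanese_bracket_sq)
      qed
      also have "\<dots> = japanese_bracket k ^ (2 * CARD('n))"
        by (simp add: power_mult)
      finally show "1 / japanese_bracket k ^ (2 * CARD('n)) \<le> (\<Prod>i\<in>UNIV. 1 / (1 + (real_of_int (k $ i))\<^sup>2))"
        by (auto simp: prod_dividef intro!: divide_left_mono mult_pos_pos prod_pos add_pos_nonneg)
    qed
    also have "\<dots> = (\<Prod>i\<in>(UNIV :: 'n set). \<Sum>a\<in>{- int N..<int N}. 1 / (1 + (real_of_int a)\<^sup>2))"
      by (rule sum_lattice_box_prod) simp
    also have "\<dots> \<le> (\<Prod>i\<in>(UNIV :: 'n set). 6)"
    proof (rule prod_mono)
      fix i
      have "6 - 6 / (real N + 1) \<le> 6" by simp
      with sum_inverse_sq_le[of N] have "(\<Sum>a\<in>{- int N..<int N}. 1 / (1 + (real_of_int a)\<^sup>2)) \<le> 6" by linarith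
      then show "0 \<le> (\<Sum>a\<in>{- int N..<int N}. 1 / (1 + (real_of_int a)\<^sup>2)) \<and> (\<Sum>a\<in>{- int N..<int N}. 1 / (1 + (real_of_int a)\<^sup>2)) \<le> 6"
        by (auto intro!: sum_nonneg)
    qed
    finally show ?thesis by simp
  qed
  show "\<forall>\<^sub>F F in finite_subsets_at_top UNIV. sum (\<lambda>k :: int ^ 'n. 1 / japanese_bracket k ^ (2 * CARD('n))) F \<le> 6 ^ CARD('n)"
    by (rule eventually_finite_subsets_at_top_weakI) (use * in auto)
qed simp

subsection \<open>Discrete Fourier inversion on a grid\<close>

definition lattice_periodic :: "(real ^ 'n::finite \<Rightarrow> 'a) \<Rightarrow> bool" where
  "lattice_periodic \<phi> \<longleftrightarrow> (\<forall>x k. \<phi> (x + of_int_vec k) = \<phi> x)"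

lemma lattice_periodicD: "lattice_periodic \<phi> \<Longrightarrow> \<phi> (x + of_int_vec k) = \<phi> x"
  by (simp add: lattice_periodic_def)

lemma lattice_periodic_character [simp]: "lattice_periodic (character k)"
  by (simp add: lattice_periodic_def character_add)

lemma lattice_periodic_mult:
  "lattice_periodic \<phi> \<Longrightarrow> lattice_periodic \<psi> \<Longrightarrow> lattice_periodic (\<lambda>x. \<phi> x * \<psi> x)"
  by (simp add: lattice_periodic_def)

lemma lattice_periodic_translate:
  "lattice_periodic \<phi> \<Longrightarrow> lattice_periodic (\<lambda>x. \<phi> (x + v))"
  unfolding lattice_periodic_def by (metis add.assoc add.commute)

definition grid :: "nat \<Rightarrow> (int ^ 'n::finite) set" where
  "grid M = {l. \<forall>i. l $ i \<in> {0..<int M}}"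

text \<open>A Riemann sum for the integral over the torus; applied to \<phi> times a character, as
  in \<open>grid_coeff\<close>, it is the discrete Fourier transform of \<phi> on the grid.\<close>

definition grid_mean :: "nat \<Rightarrow> (real ^ 'n::finite \<Rightarrow> complex) \<Rightarrow> complex" where
  "grid_mean M \<phi> = (\<Sum>l\<in>grid M. \<phi> ((1 / real M) *\<^sub>R of_int_vec l)) / of_nat (M ^ CARD('n))"

definition grid_coeff :: "nat \<Rightarrow> (real ^ 'n::finite \<Rightarrow> complex) \<Rightarrow> int ^ 'n \<Rightarrow> complex" where
  "grid_coeff M \<phi> k = grid_mean M (\<lambda>x. \<phi> x * character (- k) x)"

lemma finite_grid [simp]: "finite (grid M)"
  unfolding grid_def by (rule finite_lattice_box) simp

lemma card_grid: "card (grid M :: (int ^ 'n::finite) set) = M ^ CARD('n)"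
proof -
  have "card (grid M :: (int ^ 'n) set) = (\<Sum>k\<in>(grid M :: (int ^ 'n) set). \<Prod>i\<in>(UNIV :: 'n set). 1)"
    by simp
  also have "\<dots> = (\<Prod>i\<in>(UNIV :: 'n set). \<Sum>a\<in>{0..<int M}. 1)"
    unfolding grid_def by (rule sum_lattice_box_prod) simp
  finally show ?thesis by simp
qed

lemma grid_mean_bound:
  fixes \<phi> :: "real ^ 'n::finite \<Rightarrow> complex"
  assumes "M > 0" "\<And>x. cmod (\<phi> x) \<le> B"
  shows "cmod (grid_mean M \<phi>) \<le> B"
proof -
  have "cmod (\<Sum>l\<in>grid M. \<phi> ((1 / real M) *\<^sub>R of_int_vec l)) \<le> of_nat (card (grid M :: (int ^ 'n) set)) * B"
    by (rule sum_norm_bound) (rule assms)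
  with assms(1) show ?thesis
    by (simp add: grid_mean_def card_grid norm_divide norm_power divide_le_eq mult.commute)
qed

lemma grid_mean_diff: "grid_mean M (\<lambda>x. \<phi> x - \<psi> x) = grid_mean M \<phi> - grid_mean M \<psi>"
  by (simp add: grid_mean_def sum_subtractf diff_divide_distrib)

lemma grid_mean_cmult: "grid_mean M (\<lambda>x. c * \<phi> x) = c * grid_mean M \<phi>"
  by (simp add: grid_mean_def sum_distrib_left)

lemma real_of_int_div_mod:
  "real_of_int a = real q * real_of_int (a div int q) + real_of_int (a mod int q)"
proof -
  have "real_of_int a = real_of_int (int q * (a div int q) + a mod int q)" by simp
  then show ?thesis by (simp only: of_int_add of_int_mult of_int_of_nat_eq)
qed

text \<open>Reducing grid indices mod \<open>M\<close> changes the argument by a lattice vector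
  only, so a shift by grid steps permutes the sample values.\<close>

lemma grid_mean_translate:
  fixes \<phi> :: "real ^ 'n::finite \<Rightarrow> complex"
  assumes "lattice_periodic \<phi>" "M > 0"
  shows "grid_mean M (\<lambda>x. \<phi> (x + (1 / real M) *\<^sub>R of_int_vec j)) = grid_mean M \<phi>"
proof -
  have eq: "\<phi> ((1 / real M) *\<^sub>R of_int_vec l + (1 / real M) *\<^sub>R of_int_vec j)
      = \<phi> ((1 / real M) *\<^sub>R of_int_vec (\<chi> i. (l $ i + j $ i) mod int M))" for l
  proof -
    have "real_of_int a / real M = real_of_int (a mod int M) / real M + real_of_int (a div int M)" for a
      using assms(2) real_of_int_div_mod[of a M] by (simp add: field_simps)
    from this[of "l $ i + j $ i" for i] have "(1 / real M) *\<^sub>R of_int_vec l + (1 / real M) *\<^sub>R (of_int_vec j :: real ^ 'n)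
        = (1 / real M) *\<^sub>R of_int_vec (\<chi> i. (l $ i + j $ i) mod int M)
          + of_int_vec (\<chi> i. (l $ i + j $ i) div int M)"
      by (simp add: vec_eq_iff add_divide_distrib)
    then show ?thesis by (simp add: lattice_periodicD[OF assms(1)])
  qed
  have "(\<Sum>l\<in>grid M. \<phi> ((1 / real M) *\<^sub>R of_int_vec (\<chi> i. (l $ i + j $ i) mod int M)))
      = (\<Sum>l\<in>grid M. \<phi> ((1 / real M) *\<^sub>R of_int_vec l))"
    by (rule sum.reindex_bij_witness[of _ "\<lambda>l. \<chi> i. (l $ i - j $ i) mod int M"])
      (use assms(2) in \<open>auto simp: grid_def vec_eq_iff mod_simps\<close>)
  then show ?thesis by (simp add: grid_mean_def eq)
qed

text \<open>Division with remainder by \<open>q\<close> writes an index of the finer grid as q l +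
  e. The finer mean becomes a mean over coarse cells of means inside one cell, the form in which
  uniform continuity applies cell by cell.\<close>

lemma grid_mean_refine:
  fixes \<phi> :: "real ^ 'n::finite \<Rightarrow> complex"
  assumes "M > 0" "q > 0"
  shows "grid_mean (q * M) \<phi>
    = grid_mean M (\<lambda>x. grid_mean q (\<lambda>y. \<phi> (x + (1 / real M) *\<^sub>R y)))"
proof -
  have "(\<Sum>l\<in>grid (q * M). \<phi> ((1 / real (q * M)) *\<^sub>R of_int_vec l))
      = (\<Sum>(l, e)\<in>grid M \<times> grid q. \<phi> ((1 / real M) *\<^sub>R of_int_vec l
          + (1 / real M) *\<^sub>R ((1 / real q) *\<^sub>R of_int_vec e)))"
  proof (rule sum.reindex_bij_witness[of _ "\<lambda>(l, e). \<chi> i. int q * l $ i + e $ i"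
        "\<lambda>l. (\<chi> i. l $ i div int q, \<chi> i. l $ i mod int q)"])
    fix l :: "int ^ 'n" assume "l \<in> grid (q * M)"
    then have l: "0 \<le> l $ i" "l $ i < int M * int q" for i
      by (auto simp: grid_def mult.commute)
    have "l $ i div int q < int M" for i
    proof (rule ccontr)
      assume "\<not> ?thesis"
      then have "int M * int q \<le> (l $ i div int q) * int q" by (intro mult_right_mono) auto
      also have "\<dots> \<le> l $ i"
        using assms pos_mod_sign[of "int q" "l $ i"] div_mult_mod_eq[of "l $ i" "int q"] by linarith
      finally show False using l[of i] by simp
    qed
    with l show "(\<chi> i. l $ i div int q, \<chi> i. l $ i mod int q) \<in> grid M \<times> grid q"
      using assms by (auto simp: grid_def pos_imp_zdiv_nonneg_iff)
    have "real_of_int a / real (q * M) = real_of_int (a div int q) / real M + real_of_int (a mod int q) / (real M * real q)" for a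
      using assms real_of_int_div_mod[of a q] by (simp add: field_simps)
    then have "(1 / real (q * M)) *\<^sub>R (of_int_vec l :: real ^ 'n) = (1 / real M) *\<^sub>R of_int_vec (\<chi> i. l $ i div int q)
        + (1 / real M) *\<^sub>R ((1 / real q) *\<^sub>R of_int_vec (\<chi> i. l $ i mod int q))"
      by (simp add: vec_eq_iff)
    then show "(case (\<chi> i. l $ i div int q, \<chi> i. l $ i mod int q) of (l, e) \<Rightarrow>
        \<phi> ((1 / real M) *\<^sub>R of_int_vec l + (1 / real M) *\<^sub>R ((1 / real q) *\<^sub>R of_int_vec e)))
      = \<phi> ((1 / real (q * M)) *\<^sub>R of_int_vec l)" by simp
  next
    fix p :: "(int ^ 'n) \<times> (int ^ 'n)" assume "p \<in> grid M \<times> grid q"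
    moreover obtain l e where p: "p = (l, e)" by (cases p)
    ultimately have le: "0 \<le> l $ i" "l $ i < int M" "0 \<le> e $ i" "e $ i < int q" for i
      by (auto simp: grid_def)
    have "int q * l $ i + e $ i < int q * int M" for i
    proof -
      have "int q * l $ i + e $ i < int q * (l $ i + 1)" using le by (simp add: algebra_simps)
      also have "\<dots> \<le> int q * int M" using le[of i] assms by (intro mult_left_mono) auto
      finally show ?thesis .
    qed
    with le show "(case p of (l, e) \<Rightarrow> \<chi> i. int q * l $ i + e $ i) \<in> grid (q * M)"
      by (auto simp: p grid_def)
    show "((\<chi> i. (case p of (l, e) \<Rightarrow> \<chi> i. int q * l $ i + e $ i) $ i div int q),
          (\<chi> i. (case p of (l, e) \<Rightarrow> \<chi> i. int q * l $ i + e $ i) $ i mod int q)) = p"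
      using le assms by (auto simp: p vec_eq_iff)
  qed auto
  also have "\<dots> = (\<Sum>l\<in>grid M. \<Sum>e\<in>grid q. \<phi> ((1 / real M) *\<^sub>R of_int_vec l
          + (1 / real M) *\<^sub>R ((1 / real q) *\<^sub>R of_int_vec e)))"
    by (rule sum.cartesian_product[symmetric])
  finally show ?thesis
    unfolding grid_mean_def sum_divide_distrib[symmetric]
    by (simp add: power_mult_distrib)
qed

lemma grid_mean_convergent:
  fixes \<phi> :: "real ^ 'n::finite \<Rightarrow> complex"
  assumes "uniformly_continuous_on UNIV \<phi>"
  shows "convergent (\<lambda>m. grid_mean (2 ^ m) \<phi>)"
proof -
  have "Cauchy (\<lambda>m. grid_mean (2 ^ m) \<phi>)"
  proof (rule metric_CauchyI)
    fix e :: real assume "e > 0"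
    then obtain r where r: "r > 0" "\<And>x y. dist y x < r \<Longrightarrow> dist (\<phi> y) (\<phi> x) < e / 4"
      using assms unfolding uniformly_continuous_on_def by (metis UNIV_I divide_pos_pos zero_less_numeral)
    \<comment> \<open>Every grid point in a cell of side 2^-N is within n 2^-N of the corner of the
      cell, by comparison with the l1 norm; \<open>N\<close> is chosen to make this less than
      \<open>r\<close>.\<close>
    obtain N where N: "real CARD('n) / r < 2 ^ N"
      using real_arch_pow[of 2] by auto
    have *: "cmod (grid_mean (2 ^ m) \<phi> - grid_mean (2 ^ N) \<phi>) \<le> e / 4" if "m \<ge> N" for m
    proof -
      have "(2::nat) ^ m = 2 ^ (m - N) * 2 ^ N" using that by (simp flip: power_add)
      then have "grid_mean (2 ^ m) \<phi> - grid_mean (2 ^ N) \<phi>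
          = grid_mean (2 ^ N) (\<lambda>x. grid_mean (2 ^ (m - N)) (\<lambda>y. \<phi> (x + (1 / real (2 ^ N)) *\<^sub>R y)) - \<phi> x)"
        by (simp only: grid_mean_refine grid_mean_diff zero_less_power zero_less_numeral)
      moreover have "cmod (grid_mean (2 ^ (m - N)) (\<lambda>y. \<phi> (x + (1 / real (2 ^ N)) *\<^sub>R y)) - \<phi> x) \<le> e / 4" for x
      proof -
        define q :: nat where "q = 2 ^ (m - N)"
        have q: "q > 0" by (simp add: q_def)
        have "cmod ((\<Sum>l\<in>grid q. \<phi> (x + (1 / real (2 ^ N)) *\<^sub>R ((1 / real q) *\<^sub>R of_int_vec l)) - \<phi> x))
            \<le> of_nat (card (grid q :: (int ^ 'n) set)) * (e / 4)"
        proof (rule sum_norm_bound)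
          fix l :: "int ^ 'n" assume l: "l \<in> grid q"
          have "norm ((1 / real q) *\<^sub>R of_int_vec l :: real ^ 'n) \<le> (\<Sum>i\<in>(UNIV :: 'n set). \<bar>((1 / real q) *\<^sub>R of_int_vec l :: real ^ 'n) $ i\<bar>)"
            by (rule norm_le_l1_cart)
          also have "\<dots> \<le> (\<Sum>i\<in>(UNIV :: 'n set). 1)"
          proof (rule sum_mono)
            fix i
            have "0 \<le> l $ i" "real_of_int (l $ i) \<le> real q"
              using l of_int_le_iff[of "l $ i" "int q", where ?'a = real] by (auto simp: grid_def less_imp_le)
            then show "\<bar>((1 / real q) *\<^sub>R of_int_vec l :: real ^ 'n) $ i\<bar> \<le> 1"
              using q by simp
          qed
          finally have "norm ((1 / real q) *\<^sub>R of_int_vec l :: real ^ 'n) \<le> CARD('n)" by simp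
          then have "norm ((1 / real (2 ^ N)) *\<^sub>R ((1 / real q) *\<^sub>R of_int_vec l) :: real ^ 'n) \<le> 1 / 2 ^ N * CARD('n)"
            by (subst norm_scaleR) (intro mult_mono; simp)
          also have "\<dots> < r" using N r(1) by (simp add: field_simps)
          finally show "cmod (\<phi> (x + (1 / real (2 ^ N)) *\<^sub>R ((1 / real q) *\<^sub>R of_int_vec l)) - \<phi> x) \<le> e / 4"
            using r(2)[of "x + (1 / real (2 ^ N)) *\<^sub>R ((1 / real q) *\<^sub>R of_int_vec l)" x]
            by (simp add: dist_norm)
        qed
        moreover have "grid_mean q (\<lambda>y. \<phi> (x + (1 / real (2 ^ N)) *\<^sub>R y)) - \<phi> x
          = (\<Sum>l\<in>grid q. \<phi> (x + (1 / real (2 ^ N)) *\<^sub>R ((1 / real q) *\<^sub>R of_int_vec l)) - \<phi> x) / of_nat (q ^ CARD('n))"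
          using q by (simp add: grid_mean_def sum_subtractf card_grid diff_divide_distrib)
        ultimately show ?thesis using q
          by (simp add: q_def[symmetric] norm_divide norm_power card_grid divide_le_eq mult.commute)
      qed
      ultimately show ?thesis
        using grid_mean_bound[of "2 ^ N" "\<lambda>x. grid_mean (2 ^ (m - N)) (\<lambda>y. \<phi> (x + (1 / real (2 ^ N)) *\<^sub>R y)) - \<phi> x" "e / 4"]
        by simp
    qed
    have "dist (grid_mean (2 ^ m) \<phi>) (grid_mean (2 ^ m') \<phi>) < e" if "m \<ge> N" "m' \<ge> N" for m m'
      using *[OF that(1)] *[OF that(2)] \<open>e > 0\<close> norm_triangle_ineq4[of "grid_mean (2 ^ m) \<phi> - grid_mean (2 ^ N) \<phi>" "grid_mean (2 ^ m') \<phi> - grid_mean (2 ^ N) \<phi>"]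
      by (simp add: dist_norm)
    then show "\<exists>M. \<forall>m\<ge>M. \<forall>n\<ge>M. dist (grid_mean (2 ^ m) \<phi>) (grid_mean (2 ^ n) \<phi>) < e" by blast
  qed
  then show ?thesis by (rule Cauchy_convergent)
qed

section \<open>Orthogonality of roots of unity and exact inversion on a grid\<close>

text \<open>For nonzero \<open>a\<close> the terms are a fixed phase times the powers of z = e^(-2
  pi i a/(2h)), which satisfies z^(2h) = 1 but is not 1, so the geometric sum vanishes.\<close>

lemma sum_cis_period:
  assumes "h > 0" "0 \<le> a" "a < 2 * int h"
  shows "(\<Sum>k\<in>{- int h..<int h}. cis (2 * pi * (real_of_int (- k) * (real_of_int a / real (2 * h)))))
    = (if a = 0 then of_nat (2 * h) else 0)"
proof (cases "a = 0")
  case False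
  define z where "z = cis (- 2 * pi * real_of_int a / real (2 * h))"
  have z1: "z \<noteq> 1"
  proof
    assume "z = 1"
    then have "cos (- 2 * pi * real_of_int a / real (2 * h)) = 1"
      by (simp add: z_def complex_eq_iff)
    then obtain n :: int where "pi * real_of_int a / real h = real_of_int n * 2 * pi"
      by (auto simp: cos_one_2pi_int)
    then have "real_of_int a = real_of_int (n * (2 * int h))"
      using assms(1) by (simp add: field_simps)
    then have "a = n * (2 * int h)" by (simp only: of_int_eq_iff)
    then have "2 * int h dvd a" by simp
    with assms False show False by (auto dest: zdvd_imp_le)
  qed
  have z_pow: "z ^ (2 * h) = 1"
  proof -
    have "z ^ (2 * h) = cis (real (2 * h) * (- 2 * pi * real_of_int a / real (2 * h)))"
      by (simp only: z_def Complex.DeMoivre)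
    also have "real (2 * h) * (- 2 * pi * real_of_int a / real (2 * h)) = 2 * pi * real_of_int (- a)"
      using assms(1) by simp
    finally have "z ^ (2 * h) = cis (2 * pi * real_of_int (- a))" .
    then show ?thesis by (simp only: cis_multiple_2pi[OF Ints_of_int])
  qed
  have "(\<Sum>k\<in>{- int h..<int h}. cis (2 * pi * (real_of_int (- k) * (real_of_int a / real (2 * h)))))
      = (\<Sum>j<2 * h. cis (2 * pi * real h * real_of_int a / real (2 * h)) * z ^ j)"
  proof (rule sum.reindex_bij_witness[of _ "\<lambda>j. int j - int h" "\<lambda>k. nat (k + int h)"])
    fix k assume k: "k \<in> {- int h..<int h}"
    then have "real (nat (k + int h)) = real_of_int k + real h" by simp
    then have "2 * pi * real h * real_of_int a / real (2 * h) + real (nat (k + int h)) * (- 2 * pi * real_of_int a / real (2 * h))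
        = 2 * pi * (real_of_int (- k) * (real_of_int a / real (2 * h)))"
      using assms(1) by (simp add: field_simps)
    then show "cis (2 * pi * real h * real_of_int a / real (2 * h)) * z ^ nat (k + int h)
        = cis (2 * pi * (real_of_int (- k) * (real_of_int a / real (2 * h))))"
      by (simp only: z_def Complex.DeMoivre cis_mult)
  qed auto
  also have "\<dots> = cis (2 * pi * real h * real_of_int a / real (2 * h)) * (\<Sum>j<2 * h. z ^ j)"
    by (rule sum_distrib_left[symmetric])
  also have "(\<Sum>j<2 * h. z ^ j) = 0"
    by (simp only: geometric_sum[OF z1] z_pow diff_self div_0)
  finally show ?thesis using False by simp
qed simp

text \<open>Interchanging the sums over frequencies and grid points leaves a product of
  one-dimensional character sums, which vanishes unless the grid point is 0. Translation then gives
  the other points in \<open>grid_inversion\<close>.\<close>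

lemma grid_inversion_0:
  fixes \<phi> :: "real ^ 'n::finite \<Rightarrow> complex"
  assumes "h > 0"
  shows "(\<Sum>k | \<forall>i. k $ i \<in> {- int h..<int h}. grid_coeff (2 * h) \<phi> k) = \<phi> 0"
proof -
  let ?K = "{k :: int ^ 'n. \<forall>i. k $ i \<in> {- int h..<int h}}"
  have "(\<Sum>k\<in>?K. \<Sum>l\<in>grid (2 * h). \<phi> ((1 / real (2 * h)) *\<^sub>R of_int_vec l) * character (- k) ((1 / real (2 * h)) *\<^sub>R of_int_vec l))
      = (\<Sum>l\<in>grid (2 * h). \<phi> ((1 / real (2 * h)) *\<^sub>R of_int_vec l) * (\<Sum>k\<in>?K. character (- k) ((1 / real (2 * h)) *\<^sub>R of_int_vec l)))"
    by (subst sum.swap) (simp add: sum_distrib_left)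
  also have "\<dots> = (\<Sum>l\<in>(grid (2 * h) :: (int ^ 'n) set). if l = 0 then \<phi> 0 * of_nat ((2 * h) ^ CARD('n)) else 0)"
  proof (rule sum.cong[OF refl])
    fix l :: "int ^ 'n" assume l: "l \<in> grid (2 * h)"
    have "(\<Sum>k\<in>?K. character (- k) ((1 / real (2 * h)) *\<^sub>R of_int_vec l))
        = (\<Sum>k\<in>?K. \<Prod>i\<in>UNIV. cis (2 * pi * (real_of_int (- (k $ i)) * (real_of_int (l $ i) / real (2 * h)))))"
      by (simp add: character_prod)
    also have "\<dots> = (\<Prod>i\<in>UNIV. \<Sum>a\<in>{- int h..<int h}. cis (2 * pi * (real_of_int (- a) * (real_of_int (l $ i) / real (2 * h)))))"
      by (rule sum_lattice_box_prod) simp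
    also have "\<dots> = (\<Prod>i\<in>UNIV. if l $ i = 0 then of_nat (2 * h) else 0)"
      using l assms by (intro prod.cong refl sum_cis_period) (auto simp: grid_def)
    also have "\<dots> = (if l = 0 then of_nat ((2 * h) ^ CARD('n)) else 0)"
      by (auto simp: vec_eq_iff)
    finally show "\<phi> ((1 / real (2 * h)) *\<^sub>R of_int_vec l) * (\<Sum>k\<in>?K. character (- k) ((1 / real (2 * h)) *\<^sub>R of_int_vec l))
        = (if l = 0 then \<phi> 0 * of_nat ((2 * h) ^ CARD('n)) else 0)" by simp
  qed
  also have "\<dots> = \<phi> 0 * of_nat ((2 * h) ^ CARD('n))"
  proof -
    have "(0 :: int ^ 'n) \<in> grid (2 * h)" using assms by (simp add: grid_def)
    then show ?thesis by simp
  qed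
  finally show ?thesis
    using assms by (simp add: grid_coeff_def grid_mean_def flip: sum_divide_distrib)
qed

lemma grid_coeff_translate:
  assumes "lattice_periodic \<phi>" "M > 0"
  shows "grid_coeff M (\<lambda>x. \<phi> (x + (1 / real M) *\<^sub>R of_int_vec j)) k
    = character k ((1 / real M) *\<^sub>R of_int_vec j) * grid_coeff M \<phi> k"
proof -
  have "grid_coeff M (\<lambda>x. \<phi> (x + (1 / real M) *\<^sub>R of_int_vec j)) k
      = grid_mean M (\<lambda>x. character k ((1 / real M) *\<^sub>R of_int_vec j) *
          (\<phi> (x + (1 / real M) *\<^sub>R of_int_vec j) * character (- k) (x + (1 / real M) *\<^sub>R of_int_vec j)))"
    unfolding grid_coeff_def
    by (rule arg_cong[where f = "grid_mean M"]) (simp add: fun_eq_iff character_add)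
  also have "\<dots> = character k ((1 / real M) *\<^sub>R of_int_vec j) * grid_coeff M \<phi> k"
    unfolding grid_mean_cmult grid_coeff_def
    using grid_mean_translate[OF lattice_periodic_mult[OF assms(1) lattice_periodic_character] assms(2)] by simp
  finally show ?thesis .
qed

lemma grid_inversion:
  fixes \<phi> :: "real ^ 'n::finite \<Rightarrow> complex"
  assumes "lattice_periodic \<phi>" "h > 0"
  shows "(\<Sum>k | \<forall>i. k $ i \<in> {- int h..<int h}.
      grid_coeff (2 * h) \<phi> k * character k ((1 / real (2 * h)) *\<^sub>R of_int_vec j))
    = \<phi> ((1 / real (2 * h)) *\<^sub>R of_int_vec j)"
proof -
  have "2 * h > 0" using assms by simp
  from grid_coeff_translate[OF assms(1) this] grid_inversion_0[OF assms(2), of "\<lambda>x. \<phi> (x + (1 / real (2 * h)) *\<^sub>R of_int_vec j)"]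
  show ?thesis by (simp add: mult.commute)
qed

text \<open>Concavity of the sine on [0, pi]: the graph lies above its chord from 0 to pi/2.\<close>

lemma sin_ge_Jordan:
  assumes "0 \<le> x" "x \<le> pi / 2"
  shows "sin x \<ge> 2 / pi * x"
proof -
  have "convex_on {0..pi} (\<lambda>x. - sin x)"
  proof (rule f''_ge0_imp_convex)
    show "((\<lambda>x. - sin x) has_real_derivative - cos x) (at x)" for x :: real
      by (auto intro!: derivative_eq_intros)
    show "((\<lambda>x. - cos x) has_real_derivative sin x) (at x)" for x :: real
      by (auto intro!: derivative_eq_intros)
  qed (auto intro: sin_ge_zero)
  from convex_onD[OF this, of "2 / pi * x" 0 "pi / 2"] assms show ?thesis
    by (auto simp: field_simps)
qed

text \<open>The modulus is 2 |sin (pi a)|, and Jordan's inequality applies because |a| \<le> 1/2.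
  With a = k_i/M this is the bound on the symbol of the difference quotient, uniform in
  \<open>M\<close>.\<close>

lemma norm_cis_minus_1_ge:
  assumes "\<bar>a\<bar> \<le> 1 / 2"
  shows "cmod (cis (2 * pi * a) - 1) \<ge> 4 * \<bar>a\<bar>"
proof -
  have "cmod (cis (2 * pi * a) - 1) ^ 2 = (2 * sin (pi * a)) ^ 2"
  proof -
    have "cos (2 * pi * a) = 1 - 2 * (sin (pi * a))\<^sup>2"
      using cos_double_sin[of "pi * a"] by (simp add: mult_ac)
    moreover have "(cmod (cis (2 * pi * a) - 1))\<^sup>2 = (cos (2 * pi * a) - 1)\<^sup>2 + (sin (2 * pi * a))\<^sup>2"
      by (simp add: cmod_power2)
    moreover have "\<dots> = 2 - 2 * cos (2 * pi * a)"
      using sin_cos_squared_add[of "2 * pi * a"] by (simp add: power2_eq_square algebra_simps)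
    ultimately show ?thesis by (simp add: power_mult_distrib)
  qed
  then have "cmod (cis (2 * pi * a) - 1) = \<bar>2 * sin (pi * a)\<bar>"
    by (metis norm_ge_zero abs_of_nonneg power2_eq_iff_nonneg abs_ge_zero power2_abs)
  also have "\<dots> = 2 * sin (pi * \<bar>a\<bar>)"
  proof -
    have "sin (pi * \<bar>a\<bar>) \<ge> 0"
      using assms by (intro sin_ge_zero) (auto simp: mult_le_cancel_left1)
    then show ?thesis by (cases "a \<ge> 0") auto
  qed
  also have "\<dots> \<ge> 2 * (2 / pi * (pi * \<bar>a\<bar>))"
    using assms by (intro mult_left_mono sin_ge_Jordan) (auto simp: field_simps)
  finally show ?thesis by simp
qed

subsection \<open>Test functions and finite differences\<close>

lemma exists_lattice_translate_unit_cube: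
  fixes x :: "real ^ 'n::finite"
  obtains l where "x + of_int_vec l \<in> cbox 0 1"
proof
  show "x + of_int_vec (\<chi> i. - \<lfloor>x $ i\<rfloor>) \<in> cbox 0 1"
    by (auto simp: mem_box_cart) linarith
qed

lemma lattice_periodic_bounded:
  fixes \<phi> :: "real ^ 'n::finite \<Rightarrow> complex"
  assumes "lattice_periodic \<phi>" "continuous_on UNIV \<phi>"
  obtains B where "\<And>x. cmod (\<phi> x) \<le> B"
proof -
  have "compact (\<phi> ` cbox 0 1)"
    by (intro compact_continuous_image compact_cbox continuous_on_subset[OF assms(2)]) auto
  then obtain B where B: "\<And>x. x \<in> cbox 0 1 \<Longrightarrow> cmod (\<phi> x) \<le> B"
    by (meson bounded_iff compact_imp_bounded imageI)
  have "cmod (\<phi> x) \<le> B" for x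
  proof -
    obtain l where "x + of_int_vec l \<in> cbox 0 1" by (rule exists_lattice_translate_unit_cube)
    from B[OF this] show ?thesis by (simp add: lattice_periodicD[OF assms(1)])
  qed
  then show ?thesis by (rule that)
qed

lemma lattice_periodic_uniformly_continuous:
  fixes \<phi> :: "real ^ 'n::finite \<Rightarrow> complex"
  assumes "lattice_periodic \<phi>" "continuous_on UNIV \<phi>"
  shows "uniformly_continuous_on UNIV \<phi>"
proof -
  \<comment> \<open>The cube [-1,2]^n leaves a margin of 1 around the unit cube: the lattice shift
    that moves x into the unit cube puts every y closer than 1 into \<open>?Q\<close>.\<close>
  let ?Q = "cbox (\<chi> i. - 1) (\<chi> i. 2) :: (real ^ 'n) set"
  have uc: "uniformly_continuous_on ?Q \<phi>"
    by (intro compact_uniformly_continuous compact_cbox continuous_on_subset[OF assms(2)]) auto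
  show ?thesis
    unfolding uniformly_continuous_on_def
  proof (intro allI impI)
    fix e :: real assume "e > 0"
    with uc obtain r where r: "r > 0" "\<And>x y. x \<in> ?Q \<Longrightarrow> y \<in> ?Q \<Longrightarrow> dist y x < r \<Longrightarrow> dist (\<phi> y) (\<phi> x) < e"
      unfolding uniformly_continuous_on_def by metis
    have "dist (\<phi> y) (\<phi> x) < e" if xy: "dist y x < min r 1" for x y
    proof -
      obtain l where l: "x + of_int_vec l \<in> cbox 0 1" by (rule exists_lattice_translate_unit_cube)
      have "\<bar>y $ i - x $ i\<bar> < 1" for i
        using component_le_norm_cart[of "y - x" i] xy by (simp add: dist_norm)
      with l have y: "y + of_int_vec l \<in> ?Q"
        by (auto simp: mem_box_cart) (smt (verit))+
      from l have x: "x + of_int_vec l \<in> ?Q"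
        by (auto simp: mem_box_cart) (smt (verit))+
      from r(2)[OF x y] xy show ?thesis
        by (simp add: lattice_periodicD[OF assms(1)])
    qed
    with r(1) show "\<exists>d>0. \<forall>x\<in>UNIV. \<forall>x'\<in>UNIV. dist x' x < d \<longrightarrow> dist (\<phi> x') (\<phi> x) < e"
      by (intro exI[of _ "min r 1"]) auto
  qed
qed

section \<open>Seminorms and closure properties of test functions\<close>

definition test_seminorm :: "nat \<Rightarrow> (real ^ 'n::finite \<Rightarrow> complex) \<Rightarrow> real" where
  "test_seminorm N \<phi> = (\<Sum>\<alpha> | length \<alpha> \<le> N. SUP x. cmod (iter_partial \<alpha> \<phi> x))"

lemma iter_partial_Nil [simp]: "iter_partial [] \<phi> = \<phi>"
  by (simp add: iter_partial_def)

lemma iter_partial_Cons [simp]: "iter_partial (i # \<alpha>) \<phi> = partial_deriv i (iter_partial \<alpha> \<phi>)"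
  by (simp add: iter_partial_def)

lemma iter_partial_append: "iter_partial (\<alpha> @ \<beta>) \<phi> = iter_partial \<alpha> (iter_partial \<beta> \<phi>)"
  by (simp add: iter_partial_def)

lemma partial_deriv_eq: "(\<phi> has_derivative D) (at x) \<Longrightarrow> partial_deriv i \<phi> x = D (axis i 1)"
  by (simp add: partial_deriv_def frechet_derivative_at[symmetric])

lemma finite_lists_le: "finite {\<alpha> :: 'n::finite list. length \<alpha> \<le> N}"
  using finite_lists_length_le[of "UNIV :: 'n set" N] by simp

lemma test_functionsD:
  assumes "\<phi> \<in> test_functions"
  shows "lattice_periodic \<phi>" "iter_partial \<alpha> \<phi> differentiable (at x)" "\<phi> differentiable (at x)"
    "continuous_on S \<phi>"
proof -
  show "lattice_periodic \<phi>"
    using assms by (simp add: test_functions_def lattice_periodic_def)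
  have *: "iter_partial \<alpha> \<phi> differentiable (at x)" for \<alpha> x
    using assms by (auto simp: test_functions_def differentiable_on_def)
  then show "iter_partial \<alpha> \<phi> differentiable (at x)" .
  from *[of "[]"] show d: "\<phi> differentiable (at x)" for x by simp
  show "continuous_on S \<phi>"
    by (intro continuous_at_imp_continuous_on ballI differentiable_imp_continuous_within d)
qed

lemma test_function_has_derivative:
  "\<phi> \<in> test_functions \<Longrightarrow> (\<phi> has_derivative frechet_derivative \<phi> (at x)) (at x)"
  using test_functionsD(3) frechet_derivative_works by blast

lemma partial_deriv_translate:
  assumes "\<And>x. \<phi> differentiable (at x)"
  shows "partial_deriv i (\<lambda>x. \<phi> (x + v)) = (\<lambda>x. partial_deriv i \<phi> (x + v))"
proof
  fix x
  have "(\<phi> has_derivative frechet_derivative \<phi> (at (x + v))) (at (x + v))"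
    using assms frechet_derivative_works by blast
  then have "((\<lambda>x. \<phi> (x + v)) has_derivative frechet_derivative \<phi> (at (x + v))) (at x)"
    using has_derivative_compose[of "\<lambda>x. x + v" "\<lambda>h. h" x UNIV \<phi> "frechet_derivative \<phi> (at (x + v))"]
    by (simp add: has_derivative_add_const)
  then show "partial_deriv i (\<lambda>x. \<phi> (x + v)) x = partial_deriv i \<phi> (x + v)"
    by (simp add: partial_deriv_eq) (simp add: partial_deriv_def)
qed

lemma iter_partial_translate:
  assumes "\<And>\<alpha> x. iter_partial \<alpha> \<phi> differentiable (at x)"
  shows "iter_partial \<alpha> (\<lambda>x. \<phi> (x + v)) = (\<lambda>x. iter_partial \<alpha> \<phi> (x + v))"
  by (induction \<alpha>) (simp_all add: partial_deriv_translate assms)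

lemma differentiable_translate:
  assumes "\<phi> differentiable (at (x + v))"
  shows "(\<lambda>x. \<phi> (x + v)) differentiable (at x)"
  using differentiable_chain_at[of "\<lambda>x. x + v" x \<phi>] assms by (simp add: o_def)

lemma test_functions_translate:
  assumes "\<phi> \<in> test_functions"
  shows "(\<lambda>x. \<phi> (x + v)) \<in> test_functions"
  using assms lattice_periodic_translate[OF test_functionsD(1)[OF assms]]
  by (auto simp: test_functions_def differentiable_on_def lattice_periodic_def
      iter_partial_translate intro: differentiable_translate)

text \<open>Derivatives stay periodic because differentiation commutes with translation by lattice
  vectors.\<close>

lemma iter_partial_test_functions:
  assumes "\<phi> \<in> test_functions"
  shows "iter_partial \<alpha> \<phi> \<in> test_functions"
proof -
  have "iter_partial \<alpha> \<phi> (x + of_int_vec k) = iter_partial \<alpha> \<phi> x" for x k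
  proof -
    have "(\<lambda>x. \<phi> (x + of_int_vec k)) = \<phi>"
      using lattice_periodicD[OF test_functionsD(1)[OF assms]] by blast
    with iter_partial_translate[OF test_functionsD(2)[OF assms], of \<alpha> "of_int_vec k"]
    show ?thesis by metis
  qed
  moreover have "iter_partial \<beta> (iter_partial \<alpha> \<phi>) differentiable (at x)" for \<beta> x
    using test_functionsD(2)[OF assms] by (simp flip: iter_partial_append)
  ultimately show ?thesis
    by (simp add: test_functions_def differentiable_on_def differentiable_at_withinI)
qed

lemma partial_deriv_lincomb:
  assumes "\<And>x. \<phi> differentiable (at x)" "\<And>x. \<psi> differentiable (at x)"
  shows "partial_deriv i (\<lambda>x. a * \<phi> x + b * \<psi> x) = (\<lambda>x. a * partial_deriv i \<phi> x + b * partial_deriv i \<psi> x)"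
proof
  fix x
  have "((\<lambda>x. a * \<phi> x + b * \<psi> x) has_derivative
      (\<lambda>h. a * frechet_derivative \<phi> (at x) h + b * frechet_derivative \<psi> (at x) h)) (at x)"
    using assms by (auto intro!: derivative_intros simp: frechet_derivative_works[symmetric])
  then show "partial_deriv i (\<lambda>x. a * \<phi> x + b * \<psi> x) x = a * partial_deriv i \<phi> x + b * partial_deriv i \<psi> x"
    by (simp add: partial_deriv_eq) (simp add: partial_deriv_def)
qed

lemma iter_partial_lincomb:
  assumes "\<phi> \<in> test_functions" "\<psi> \<in> test_functions"
  shows "iter_partial \<alpha> (\<lambda>x. a * \<phi> x + b * \<psi> x) = (\<lambda>x. a * iter_partial \<alpha> \<phi> x + b * iter_partial \<alpha> \<psi> x)"
  by (induction \<alpha>) (simp_all add: partial_deriv_lincomb test_functionsD assms)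

lemma test_functions_lincomb:
  assumes "\<phi> \<in> test_functions" "\<psi> \<in> test_functions"
  shows "(\<lambda>x. a * \<phi> x + b * \<psi> x) \<in> test_functions"
  using assms test_functionsD(2)[OF assms(1)] test_functionsD(2)[OF assms(2)]
    test_functionsD(1)[OF assms(1)] test_functionsD(1)[OF assms(2)]
  by (auto simp: test_functions_def differentiable_on_def iter_partial_lincomb[OF assms] lattice_periodic_def
      intro!: differentiable_at_withinI)

lemma test_function_bounded:
  assumes "\<phi> \<in> test_functions"
  shows "bdd_above (range (\<lambda>x. cmod (\<phi> x)))"
proof -
  obtain B where "\<And>x. cmod (\<phi> x) \<le> B"
    by (rule lattice_periodic_bounded[of \<phi>]) (use test_functionsD[OF assms] in auto)
  then show ?thesis by (intro bdd_aboveI[of _ B]) auto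
qed

lemma cmod_le_test_seminorm:
  assumes "\<phi> \<in> test_functions" "length \<alpha> \<le> N"
  shows "cmod (iter_partial \<alpha> \<phi> x) \<le> test_seminorm N \<phi>"
proof -
  have bdd: "bdd_above (range (\<lambda>x. cmod (iter_partial \<beta> \<phi> x)))" for \<beta>
    by (rule test_function_bounded[OF iter_partial_test_functions[OF assms(1)]])
  have "cmod (iter_partial \<alpha> \<phi> x) \<le> (SUP x. cmod (iter_partial \<alpha> \<phi> x))"
    by (rule cSUP_upper[OF _ bdd]) simp
  also have "\<dots> \<le> test_seminorm N \<phi>"
    unfolding test_seminorm_def
  proof (rule member_le_sum)
    show "0 \<le> (SUP x. cmod (iter_partial \<beta> \<phi> x))" for \<beta>
      by (rule order_trans[OF norm_ge_zero cSUP_upper[OF _ bdd]]) simp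
  qed (use assms(2) finite_lists_le in auto)
  finally show ?thesis .
qed

lemma test_seminorm_nonneg: "\<phi> \<in> test_functions \<Longrightarrow> 0 \<le> test_seminorm N \<phi>"
  using order_trans[OF norm_ge_zero cmod_le_test_seminorm[of \<phi> "[]" N 0]] by simp

section \<open>Difference quotients and decay of discrete coefficients\<close>

text \<open>A forward difference quotient with step 1/M, written as a linear combination so that the
  closure and derivative lemmas for linear combinations apply directly.\<close>

definition grid_difference :: "nat \<Rightarrow> 'n \<Rightarrow> (real ^ 'n::finite \<Rightarrow> complex) \<Rightarrow> real ^ 'n \<Rightarrow> complex" where
  "grid_difference M i \<phi> x = of_nat M * \<phi> (x + (1 / real M) *\<^sub>R of_int_vec (axis i 1)) + (- of_nat M) * \<phi> x"

lemma grid_difference_test_functions: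
  "\<phi> \<in> test_functions \<Longrightarrow> grid_difference M i \<phi> \<in> test_functions"
  unfolding grid_difference_def by (intro test_functions_lincomb test_functions_translate)

lemma iter_partial_grid_difference:
  assumes "\<phi> \<in> test_functions"
  shows "iter_partial \<alpha> (grid_difference M i \<phi>) = grid_difference M i (iter_partial \<alpha> \<phi>)"
  unfolding grid_difference_def fun_eq_iff
  by (simp only: iter_partial_lincomb[OF test_functions_translate[OF assms] assms]
      iter_partial_translate[OF test_functionsD(2)[OF assms]]) simp

text \<open>Mean value inequality on a segment of length 1/M. The constant is the same as for the
  derivative, so iteration accumulates no factor.\<close>

lemma grid_difference_bound:
  assumes "\<phi> \<in> test_functions" "M > 0" "\<And>x. cmod (partial_deriv i \<phi> x) \<le> B"
  shows "cmod (grid_difference M i \<phi> x) \<le> B"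
proof -
  have axis: "(of_int_vec (axis i 1) :: real ^ 'a) = axis i 1"
    by (simp add: vec_eq_iff axis_def)
  have "((\<lambda>t. \<phi> (x + t *\<^sub>R axis i 1)) has_derivative (\<lambda>h. h *\<^sub>R partial_deriv i \<phi> (x + t *\<^sub>R axis i 1))) (at t)" for t
  proof -
    have D: "(\<phi> has_derivative frechet_derivative \<phi> (at (x + t *\<^sub>R axis i 1))) (at (x + t *\<^sub>R axis i 1))"
      by (rule test_function_has_derivative[OF assms(1)])
    have "((\<lambda>t. x + t *\<^sub>R axis i 1) has_derivative (\<lambda>h. h *\<^sub>R axis i 1)) (at t)"
      by (auto intro!: derivative_eq_intros)
    from has_derivative_compose[OF this D]
    show ?thesis
      by (simp add: partial_deriv_def linear_cmul[OF has_derivative_linear[OF D]])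
  qed
  then have le: "cmod (\<phi> (x + (1 / real M) *\<^sub>R axis i 1) - \<phi> (x + 0 *\<^sub>R axis i 1)) \<le> B * norm (1 / real M - 0)"
  proof (rule differentiable_bound[OF convex_UNIV])
    fix t
    show "onorm (\<lambda>h. h *\<^sub>R partial_deriv i \<phi> (x + t *\<^sub>R axis i 1)) \<le> B"
      using assms(3)[of "x + t *\<^sub>R axis i 1"]
      by (intro onorm_bound) (auto simp: mult.commute[of B] intro: order_trans[OF norm_ge_zero] mult_left_mono)
  qed auto
  have eq: "grid_difference M i \<phi> x = of_nat M * (\<phi> (x + (1 / real M) *\<^sub>R axis i 1) - \<phi> (x + 0 *\<^sub>R axis i 1))"
    by (simp add: grid_difference_def axis right_diff_distrib)
  show ?thesis
    unfolding eq norm_mult norm_of_nat using le assms(2) by (simp add: pos_le_divide_eq mult.commute)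
qed

text \<open>Differences commute with derivatives, so the induction trades one derivative in
  direction \<open>i\<close> for one difference at a time.\<close>

lemma grid_difference_funpow_bound:
  assumes "\<phi> \<in> test_functions" "M > 0" "\<And>x. cmod (iter_partial (replicate m i) \<phi> x) \<le> B"
  shows "cmod ((grid_difference M i ^^ m) \<phi> x) \<le> B"
  using assms(1,3)
proof (induction m arbitrary: \<phi> x)
  case (Suc m)
  have "cmod (iter_partial (replicate m i) (grid_difference M i \<phi>) x) \<le> B" for x
    unfolding iter_partial_grid_difference[OF Suc.prems(1)]
    by (rule grid_difference_bound[OF iter_partial_test_functions[OF Suc.prems(1)] assms(2)])
      (use Suc.prems(2) in simp)
  from Suc.IH[OF grid_difference_test_functions[OF Suc.prems(1)] this] show ?case
    by (simp add: funpow_swap1)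
qed simp

text \<open>Translation by a grid step multiplies a discrete coefficient by a character value, so
  the difference quotient acts diagonally, with no error term in \<open>M\<close>.\<close>

lemma grid_coeff_difference:
  assumes "\<phi> \<in> test_functions" "M > 0"
  shows "grid_coeff M (grid_difference M i \<phi>) k
    = of_nat M * (cis (2 * pi * (real_of_int (k $ i) / real M)) - 1) * grid_coeff M \<phi> k"
proof -
  have "grid_coeff M (grid_difference M i \<phi>) k
      = grid_mean M (\<lambda>x. of_nat M * (\<phi> (x + (1 / real M) *\<^sub>R of_int_vec (axis i 1)) * character (- k) x)
          - of_nat M * (\<phi> x * character (- k) x))"
    unfolding grid_coeff_def by (rule arg_cong[where f = "grid_mean M"]) (simp add: grid_difference_def fun_eq_iff algebra_simps)
  also have "\<dots> = of_nat M * grid_coeff M (\<lambda>x. \<phi> (x + (1 / real M) *\<^sub>R of_int_vec (axis i 1))) k - of_nat M * grid_coeff M \<phi> k"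
    by (simp only: grid_mean_diff grid_mean_cmult grid_coeff_def)
  also have "grid_coeff M (\<lambda>x. \<phi> (x + (1 / real M) *\<^sub>R of_int_vec (axis i 1))) k
      = character k ((1 / real M) *\<^sub>R of_int_vec (axis i 1)) * grid_coeff M \<phi> k"
    by (rule grid_coeff_translate[OF test_functionsD(1)[OF assms(1)] assms(2)])
  also have "character k ((1 / real M) *\<^sub>R of_int_vec (axis i 1)) = cis (2 * pi * (real_of_int (k $ i) / real M))"
  proof -
    have "(of_int_vec (axis i 1) :: real ^ 'a) = axis i 1"
      by (simp add: vec_eq_iff axis_def)
    then show ?thesis by (simp add: character_def inner_axis)
  qed
  finally show ?thesis by (simp add: algebra_simps)
qed

lemma grid_coeff_difference_funpow:
  assumes "\<phi> \<in> test_functions" "M > 0"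
  shows "grid_coeff M ((grid_difference M i ^^ m) \<phi>) k
    = (of_nat M * (cis (2 * pi * (real_of_int (k $ i) / real M)) - 1)) ^ m * grid_coeff M \<phi> k"
  using assms(1)
  by (induction m arbitrary: \<phi>)
    (simp_all add: funpow_swap1 grid_difference_test_functions grid_coeff_difference assms(2) mult_ac del: funpow.simps(2) add: funpow_Suc_right)

lemma grid_coeff_bound:
  assumes "M > 0" "\<And>x. cmod (\<phi> x) \<le> B"
  shows "cmod (grid_coeff M \<phi> k) \<le> B"
  unfolding grid_coeff_def by (rule grid_mean_bound) (use assms in \<open>simp_all add: norm_mult\<close>)

lemma grid_coeff_component_bound:
  assumes "\<phi> \<in> test_functions" "M > 0" "\<bar>real_of_int (k $ i)\<bar> \<le> real M / 2"
    "\<And>x. cmod (iter_partial (replicate m i) \<phi> x) \<le> B"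
  shows "\<bar>real_of_int (k $ i)\<bar> ^ m * cmod (grid_coeff M \<phi> k) \<le> B"
proof -
  have "\<bar>real_of_int (k $ i)\<bar> \<le> real M * (4 * \<bar>real_of_int (k $ i) / real M\<bar>)"
    using assms(2) by simp
  also have "\<dots> \<le> real M * cmod (cis (2 * pi * (real_of_int (k $ i) / real M)) - 1)"
    using assms(2,3) by (intro mult_left_mono norm_cis_minus_1_ge) (auto simp: field_simps)
  also have "\<dots> = cmod (of_nat M * (cis (2 * pi * (real_of_int (k $ i) / real M)) - 1))"
    by (simp add: norm_mult)
  finally have "\<bar>real_of_int (k $ i)\<bar> ^ m * cmod (grid_coeff M \<phi> k)
      \<le> cmod (of_nat M * (cis (2 * pi * (real_of_int (k $ i) / real M)) - 1)) ^ m * cmod (grid_coeff M \<phi> k)"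
    by (intro mult_right_mono power_mono) auto
  also have "\<dots> = cmod (grid_coeff M ((grid_difference M i ^^ m) \<phi>) k)"
    by (simp add: grid_coeff_difference_funpow assms(1,2) norm_mult norm_power)
  also have "\<dots> \<le> B"
    by (intro grid_coeff_bound grid_difference_funpow_bound assms)
  finally show ?thesis .
qed

text \<open>The factor (n+1)^m comes from \<open>japanese_bracket_power_le\<close>; one more n+1
  counts the undifferentiated term and the n pure derivatives of order m, all bounded by the same
  seminorm. Nothing on the right depends on \<open>M\<close>, so the bound survives the
  limit.\<close>

lemma grid_coeff_decay:
  fixes \<phi> :: "real ^ 'n::finite \<Rightarrow> complex"
  assumes "\<phi> \<in> test_functions" "M > 0" "\<And>i. \<bar>real_of_int (k $ i)\<bar> \<le> real M / 2"
  shows "japanese_bracket k ^ m * cmod (grid_coeff M \<phi> k) \<le> real (CARD('n) + 1) ^ (m + 1) * test_seminorm m \<phi>"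
proof -
  have "japanese_bracket k ^ m * cmod (grid_coeff M \<phi> k)
      \<le> real (CARD('n) + 1) ^ m * (1 + (\<Sum>i\<in>(UNIV :: 'n set). \<bar>real_of_int (k $ i)\<bar> ^ m)) * cmod (grid_coeff M \<phi> k)"
    by (intro mult_right_mono japanese_bracket_power_le) auto
  also have "\<dots> = real (CARD('n) + 1) ^ m * (cmod (grid_coeff M \<phi> k)
      + (\<Sum>i\<in>(UNIV :: 'n set). \<bar>real_of_int (k $ i)\<bar> ^ m * cmod (grid_coeff M \<phi> k)))"
    by (simp add: algebra_simps sum_distrib_left sum_distrib_right)
  also have "\<dots> \<le> real (CARD('n) + 1) ^ m * (test_seminorm m \<phi> + (\<Sum>i\<in>(UNIV :: 'n set). test_seminorm m \<phi>))"
  proof (intro mult_left_mono add_mono sum_mono)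
    show "cmod (grid_coeff M \<phi> k) \<le> test_seminorm m \<phi>"
      using cmod_le_test_seminorm[OF assms(1), of "[]" m] by (intro grid_coeff_bound assms) simp
    show "\<bar>real_of_int (k $ i)\<bar> ^ m * cmod (grid_coeff M \<phi> k) \<le> test_seminorm m \<phi>" for i
      by (intro grid_coeff_component_bound assms cmod_le_test_seminorm) simp
  qed simp
  also have "\<dots> = real (CARD('n) + 1) ^ (m + 1) * test_seminorm m \<phi>"
    by (simp add: algebra_simps)
  finally show ?thesis .
qed

subsection \<open>Fourier inversion for test functions\<close>

text \<open>
  For test functions the limit exists and is the integral of \<open>\<phi> e\<^sub>-\<^sub>k\<close> over the torus.
\<close>

definition test_coeff :: "(real ^ 'n::finite \<Rightarrow> complex) \<Rightarrow> int ^ 'n \<Rightarrow> complex" where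
  "test_coeff \<phi> k = lim (\<lambda>m. grid_coeff (2 ^ m) \<phi> k)"

lemma grid_coeff_tendsto:
  assumes "\<phi> \<in> test_functions"
  shows "(\<lambda>m. grid_coeff (2 ^ m) \<phi> k) \<longlonglongrightarrow> test_coeff \<phi> k"
proof -
  have "uniformly_continuous_on UNIV (\<lambda>x. \<phi> x * character (- k) x)"
    by (intro lattice_periodic_uniformly_continuous lattice_periodic_mult lattice_periodic_character
        continuous_intros test_functionsD assms)
  from grid_mean_convergent[OF this] show ?thesis
    unfolding test_coeff_def grid_coeff_def convergent_LIMSEQ_iff .
qed

lemma eventually_lattice_box:
  assumes "finite F"
  shows "\<forall>\<^sub>F m in sequentially. F \<subseteq> {k :: int ^ 'n::finite. \<forall>i. k $ i \<in> {- int (2 ^ m)..<int (2 ^ m)}}"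
proof -
  obtain N where N: "F \<subseteq> {k :: int ^ 'n. \<forall>i. k $ i \<in> {- int N..<int N}}"
    using finite_subset_lattice_box[OF assms] .
  have "F \<subseteq> {k :: int ^ 'n. \<forall>i. k $ i \<in> {- int (2 ^ m)..<int (2 ^ m)}}" if "m \<ge> N" for m
  proof -
    have "N < 2 ^ m" using that less_exp[of m] by (meson le_less_trans)
    then have "int N \<le> int (2 ^ m)" by (simp only: of_nat_le_iff less_imp_le)
    then have "k $ i \<in> {- int (2 ^ m)..<int (2 ^ m)}" if "k \<in> F" for k i
    proof -
      have "k \<in> {k. \<forall>i. k $ i \<in> {- int N..<int N}}" using N that by (rule subsetD)
      then have "- int N \<le> k $ i" "k $ i < int N" by simp_all
      with \<open>int N \<le> int (2 ^ m)\<close> show ?thesis unfolding atLeastLessThan_iff by linarith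
    qed
    then show ?thesis by blast
  qed
  then show ?thesis by (auto simp: eventually_sequentially)
qed

lemma lattice_box_bound:
  assumes "\<forall>i. k $ i \<in> {- int h..<int h}"
  shows "\<bar>real_of_int (k $ i)\<bar> \<le> real (2 * h) / 2"
proof -
  have "- int h \<le> k $ i" "k $ i \<le> int h" using assms by (auto simp: less_imp_le)
  then have "real_of_int (- int h) \<le> real_of_int (k $ i)" "real_of_int (k $ i) \<le> real_of_int (int h)"
    by (simp_all only: of_int_le_iff)
  then show ?thesis by simp
qed

lemma test_coeff_decay:
  fixes \<phi> :: "real ^ 'n::finite \<Rightarrow> complex"
  assumes "\<phi> \<in> test_functions"
  shows "japanese_bracket k ^ m * cmod (test_coeff \<phi> k) \<le> real (CARD('n) + 1) ^ (m + 1) * test_seminorm m \<phi>"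
proof -
  have "\<forall>\<^sub>F p in sequentially. \<forall>i. k $ i \<in> {- int (2 ^ p)..<int (2 ^ p)}"
    using eventually_lattice_box[of "{k}"] by simp
  \<comment> \<open>The shift to 2^(p+1) appears because the frequency box -2^p..<2^p belongs to the
    grid with 2^(p+1) points per direction.\<close>
  then have *: "\<forall>\<^sub>F p in sequentially. japanese_bracket k ^ m * cmod (grid_coeff (2 ^ Suc p) \<phi> k)
      \<le> real (CARD('n) + 1) ^ (m + 1) * test_seminorm m \<phi>"
  proof eventually_elim
    case (elim p)
    show ?case
      using lattice_box_bound[OF elim] by (intro grid_coeff_decay assms) simp_all
  qed
  have "(\<lambda>p. japanese_bracket k ^ m * cmod (grid_coeff (2 ^ Suc p) \<phi> k))
      \<longlonglongrightarrow> japanese_bracket k ^ m * cmod (test_coeff \<phi> k)"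
    by (intro tendsto_intros LIMSEQ_Suc grid_coeff_tendsto assms)
  then show ?thesis by (rule tendsto_upperbound[OF _ *]) simp
qed

text \<open>A point with denominator 2^p lies on every later dyadic grid, where inversion is an
  exact finite sum over a box. Removing a fixed finite set \<open>F\<close> from the box leaves
  coefficients dominated by \<open>g\<close>, so the error is at most a tail of \<open>g\<close>;
  the grid is then refined with \<open>F\<close> fixed.\<close>

lemma dyadic_inversion_bound:
  fixes \<phi> :: "real ^ 'n::finite \<Rightarrow> complex"
  assumes "\<phi> \<in> test_functions" "finite F"
    "\<And>k p. (\<And>i. \<bar>real_of_int (k $ i)\<bar> \<le> real (2 ^ p) / 2) \<Longrightarrow> cmod (grid_coeff (2 ^ p) \<phi> k) \<le> g k"
    "(g has_sum G) UNIV" "\<And>k. 0 \<le> g k"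
  shows "cmod (\<phi> ((1 / 2 ^ p) *\<^sub>R of_int_vec l) - (\<Sum>k\<in>F. test_coeff \<phi> k * character k ((1 / 2 ^ p) *\<^sub>R of_int_vec l)))
    \<le> G - sum g F"
proof -
  define x where "x = ((1 / 2 ^ p) *\<^sub>R of_int_vec l :: real ^ 'n)"
  define K where "K = (\<lambda>m. {k :: int ^ 'n. \<forall>i. k $ i \<in> {- int (2 ^ m)..<int (2 ^ m)}})"
  have finK: "finite (K m)" for m
    unfolding K_def by (rule finite_lattice_box) simp
  have "\<forall>\<^sub>F m in sequentially. F \<subseteq> K m"
    unfolding K_def by (rule eventually_lattice_box[OF assms(2)])
  then have *: "\<forall>\<^sub>F m in sequentially.
      cmod (\<phi> x - (\<Sum>k\<in>F. grid_coeff (2 ^ Suc m) \<phi> k * character k x)) \<le> G - sum g F"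
    using eventually_ge_at_top[of p]
  proof eventually_elim
    case (elim m)
    have x: "x = (1 / real (2 * 2 ^ m)) *\<^sub>R of_int_vec (\<chi> i. 2 ^ (Suc m - p) * l $ i)"
    proof -
      have "(2::real) * 2 ^ m = 2 ^ (Suc m - p) * 2 ^ p"
        using elim(2) by (simp flip: power_add)
      then show ?thesis by (simp add: x_def vec_eq_iff)
    qed
    have "\<phi> x = (\<Sum>k\<in>K m. grid_coeff (2 ^ Suc m) \<phi> k * character k x)"
      unfolding x K_def power_Suc
      by (rule grid_inversion[OF test_functionsD(1)[OF assms(1)], symmetric]) simp
    also have "\<dots> - (\<Sum>k\<in>F. grid_coeff (2 ^ Suc m) \<phi> k * character k x)
        = (\<Sum>k\<in>K m - F. grid_coeff (2 ^ Suc m) \<phi> k * character k x)"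
      by (rule sum_diff[symmetric, OF finK elim(1)])
    also have "cmod \<dots> \<le> sum g (K m - F)"
    proof (rule sum_norm_le)
      fix k assume "k \<in> K m - F"
      then have "cmod (grid_coeff (2 ^ Suc m) \<phi> k) \<le> g k"
        using lattice_box_bound[of k "2 ^ m"] by (intro assms(3)) (simp add: K_def)
      then show "cmod (grid_coeff (2 ^ Suc m) \<phi> k * character k x) \<le> g k"
        by (simp add: norm_mult)
    qed
    also have "\<dots> = sum g (K m) - sum g F"
      by (rule sum_diff[OF finK elim(1)])
    also have "sum g (K m) \<le> G"
      using finite_sum_le_has_sum[OF assms(4) finK] assms(5) by simp
    finally show ?case by simp
  qed
  have "(\<lambda>m. cmod (\<phi> x - (\<Sum>k\<in>F. grid_coeff (2 ^ Suc m) \<phi> k * character k x)))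
      \<longlonglongrightarrow> cmod (\<phi> x - (\<Sum>k\<in>F. test_coeff \<phi> k * character k x))"
    by (intro tendsto_intros LIMSEQ_Suc grid_coeff_tendsto assms)
  then show ?thesis
    unfolding x_def[symmetric] by (rule tendsto_upperbound[OF _ *]) simp
qed

lemma dyadic_approximation:
  fixes x :: "real ^ 'n::finite"
  shows "(\<lambda>p. (1 / 2 ^ p) *\<^sub>R of_int_vec (\<chi> i. \<lfloor>2 ^ p * x $ i\<rfloor>)) \<longlonglongrightarrow> x"
proof (rule vec_tendstoI)
  fix i
  have "(\<lambda>p. x $ i - 1 / 2 ^ p) \<longlonglongrightarrow> x $ i - 0"
    by (intro tendsto_intros) (simp add: LIMSEQ_inverse_realpow_zero[of 2, unfolded inverse_eq_divide])
  then have lim: "(\<lambda>p. x $ i - 1 / 2 ^ p) \<longlonglongrightarrow> x $ i" by simp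
  have "(\<lambda>p. real_of_int \<lfloor>2 ^ p * x $ i\<rfloor> / 2 ^ p) \<longlonglongrightarrow> x $ i"
  proof (rule tendsto_sandwich[OF _ _ lim tendsto_const])
    show "\<forall>\<^sub>F p in sequentially. x $ i - 1 / 2 ^ p \<le> real_of_int \<lfloor>2 ^ p * x $ i\<rfloor> / 2 ^ p"
    proof (intro always_eventually allI)
      fix p :: nat
      have "2 ^ p * x $ i - 1 \<le> real_of_int \<lfloor>2 ^ p * x $ i\<rfloor>" by linarith
      then have "(2 ^ p * x $ i - 1) / 2 ^ p \<le> real_of_int \<lfloor>2 ^ p * x $ i\<rfloor> / 2 ^ p"
        by (rule divide_right_mono) simp
      then show "x $ i - 1 / 2 ^ p \<le> real_of_int \<lfloor>2 ^ p * x $ i\<rfloor> / 2 ^ p"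
        by (simp add: diff_divide_distrib)
    qed
    show "\<forall>\<^sub>F p in sequentially. real_of_int \<lfloor>2 ^ p * x $ i\<rfloor> / 2 ^ p \<le> x $ i"
      by (intro always_eventually allI) (simp add: divide_le_eq mult.commute)
  qed
  then show "(\<lambda>p. ((1 / 2 ^ p) *\<^sub>R of_int_vec (\<chi> i. \<lfloor>2 ^ p * x $ i\<rfloor>) :: real ^ 'n) $ i) \<longlonglongrightarrow> x $ i"
    by simp
qed

lemma has_sum_diff:
  fixes f g :: "'a \<Rightarrow> 'b::real_normed_vector"
  assumes "(f has_sum a) A" "(g has_sum b) A"
  shows "((\<lambda>x. f x - g x) has_sum (a - b)) A"
  using has_sum_add[OF assms(1), of "\<lambda>x. - g x" "- b"] assms(2) by (simp add: has_sum_uminus)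

text \<open>The tails of a convergent majorant tend to 0 along the finite sets, so a tail estimate
  yields unconditional summability together with the value. It serves as dominated convergence for
  inversion, for distributions applied to series and for averages of series.\<close>

lemma has_sum_from_tail_bound:
  fixes f :: "'a \<Rightarrow> complex"
  assumes "(g has_sum G) UNIV" "\<And>F. finite F \<Longrightarrow> cmod (s - sum f F) \<le> C * (G - sum g F)"
  shows "(f has_sum s) UNIV"
proof -
  have "((\<lambda>F. C * (G - sum g F)) \<longlongrightarrow> C * (G - G)) (finite_subsets_at_top UNIV)"
    using assms(1) unfolding has_sum_def by (intro tendsto_intros)
  then have lim: "((\<lambda>F. C * (G - sum g F)) \<longlongrightarrow> 0) (finite_subsets_at_top UNIV)" by simp
  have "((\<lambda>F. s - sum f F) \<longlongrightarrow> 0) (finite_subsets_at_top UNIV)"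
    by (rule Lim_null_comparison[OF _ lim]) (auto intro!: eventually_finite_subsets_at_top_weakI assms(2))
  from tendsto_diff[OF tendsto_const[of s] this] show ?thesis
    by (simp add: has_sum_def)
qed

lemma fourier_inversion:
  fixes \<phi> :: "real ^ 'n::finite \<Rightarrow> complex"
  assumes "\<phi> \<in> test_functions"
  shows "((\<lambda>k. test_coeff \<phi> k * character k x) has_sum \<phi> x) UNIV"
proof -
  \<comment> \<open>Decay of order 2n is chosen to make the majorant \<open>g\<close>
    summable.\<close>
  define C where "C = real (CARD('n) + 1) ^ (2 * CARD('n) + 1) * test_seminorm (2 * CARD('n)) \<phi>"
  define g where "g = (\<lambda>k :: int ^ 'n. C * (1 / japanese_bracket k ^ (2 * CARD('n))))"
  have C: "C \<ge> 0" unfolding C_def by (simp add: test_seminorm_nonneg assms)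
  have "g summable_on UNIV"
    unfolding g_def by (rule summable_on_cmult_right summable_japanese_bracket)+
  then have G: "(g has_sum infsum g UNIV) UNIV" by simp
  have g: "cmod (grid_coeff (2 ^ p) \<phi> k) \<le> g k" if "\<And>i. \<bar>real_of_int (k $ i)\<bar> \<le> real (2 ^ p) / 2" for k p
    using grid_coeff_decay[OF assms _ that, where m = "2 * CARD('n)"]
    by (simp add: g_def pos_le_divide_eq mult.commute C_def)
  \<comment> \<open>For fixed \<open>F\<close> the error is continuous in x and its bound does not
    depend on x, so the estimate passes from the dyadic approximants to x itself.\<close>
  have "cmod (\<phi> x - (\<Sum>k\<in>F. test_coeff \<phi> k * character k x)) \<le> infsum g UNIV - sum g F" if F: "finite F" for F
  proof (rule tendsto_upperbound)
    let ?y = "\<lambda>p. (1 / 2 ^ p) *\<^sub>R of_int_vec (\<chi> i. \<lfloor>2 ^ p * x $ i\<rfloor>) :: real ^ 'n"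
    have "isCont (\<lambda>x. cmod (\<phi> x - (\<Sum>k\<in>F. test_coeff \<phi> k * character k x))) x"
      by (rule continuous_on_interior[of UNIV]) (intro continuous_intros test_functionsD assms, simp)
    from isCont_tendsto_compose[OF this dyadic_approximation]
    show "(\<lambda>p. cmod (\<phi> (?y p) - (\<Sum>k\<in>F. test_coeff \<phi> k * character k (?y p))))
      \<longlonglongrightarrow> cmod (\<phi> x - (\<Sum>k\<in>F. test_coeff \<phi> k * character k x))" .
    show "\<forall>\<^sub>F p in sequentially. cmod (\<phi> (?y p) - (\<Sum>k\<in>F. test_coeff \<phi> k * character k (?y p)))
        \<le> infsum g UNIV - sum g F"
      by (intro always_eventually allI dyadic_inversion_bound[OF assms F _ G] g) (use C in \<open>simp_all add: g_def\<close>)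
  qed simp
  then show ?thesis
    by (intro has_sum_from_tail_bound[OF G, where C = 1]) simp
qed

section \<open>Fourier series with rapidly decreasing coefficients\<close>

definition rapidly_decreasing :: "(int ^ 'n::finite \<Rightarrow> complex) \<Rightarrow> bool" where
  "rapidly_decreasing a \<longleftrightarrow> (\<forall>m. \<exists>C. \<forall>k. japanese_bracket k ^ m * cmod (a k) \<le> C)"

definition slowly_growing :: "(int ^ 'n::finite \<Rightarrow> complex) \<Rightarrow> bool" where
  "slowly_growing a \<longleftrightarrow> (\<exists>C N. \<forall>k. cmod (a k) \<le> C * japanese_bracket k ^ N)"

definition fourier_series :: "(int ^ 'n::finite \<Rightarrow> complex) \<Rightarrow> real ^ 'n \<Rightarrow> complex" where
  "fourier_series a x = (\<Sum>\<^sub>\<infinity>k. a k * character k x)"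

lemma rapidly_decreasing_test_coeff: "\<phi> \<in> test_functions \<Longrightarrow> rapidly_decreasing (test_coeff \<phi>)"
  unfolding rapidly_decreasing_def using test_coeff_decay by blast

lemma fourier_series_test_coeff: "\<phi> \<in> test_functions \<Longrightarrow> fourier_series (test_coeff \<phi>) = \<phi>"
  using fourier_inversion unfolding fourier_series_def by (intro ext infsumI)

lemma rapidly_decreasing_mono:
  assumes "rapidly_decreasing a" "\<And>k. cmod (b k) \<le> C * japanese_bracket k ^ N * cmod (a k)"
  shows "rapidly_decreasing b"
  unfolding rapidly_decreasing_def
proof
  fix m
  obtain D where D: "\<And>k. japanese_bracket k ^ (m + N) * cmod (a k) \<le> D"
    using assms(1) unfolding rapidly_decreasing_def by blast
  have "japanese_bracket k ^ m * cmod (b k) \<le> \<bar>C\<bar> * D" for k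
  proof -
    have "cmod (b k) \<le> \<bar>C\<bar> * japanese_bracket k ^ N * cmod (a k)"
      by (rule order_trans[OF assms(2)]) (intro mult_right_mono; simp)
    then have "japanese_bracket k ^ m * cmod (b k) \<le> japanese_bracket k ^ m * (\<bar>C\<bar> * japanese_bracket k ^ N * cmod (a k))"
      by (rule mult_left_mono) simp
    also have "\<dots> = \<bar>C\<bar> * (japanese_bracket k ^ (m + N) * cmod (a k))"
      by (simp add: power_add)
    also have "\<dots> \<le> \<bar>C\<bar> * D" by (intro mult_left_mono D) simp
    finally show ?thesis .
  qed
  then show "\<exists>C. \<forall>k. japanese_bracket k ^ m * cmod (b k) \<le> C" by blast
qed

lemma rapidly_decreasing_summable:
  fixes a :: "int ^ 'n::finite \<Rightarrow> complex"
  assumes "rapidly_decreasing a"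
  shows "(\<lambda>k. japanese_bracket k ^ m * cmod (a k)) summable_on UNIV"
proof -
  obtain D where D: "\<And>k. japanese_bracket k ^ (m + 2 * CARD('n)) * cmod (a k) \<le> D"
    using assms unfolding rapidly_decreasing_def by blast
  show ?thesis
  proof (rule summable_on_comparison_test)
    show "(\<lambda>k :: int ^ 'n. D * (1 / japanese_bracket k ^ (2 * CARD('n)))) summable_on UNIV"
      by (rule summable_on_cmult_right summable_japanese_bracket)+
    show "japanese_bracket k ^ m * cmod (a k) \<le> D * (1 / japanese_bracket k ^ (2 * CARD('n)))" for k
      using D[of k] by (simp add: pos_le_divide_eq power_add mult_ac)
  qed simp
qed

lemma summable_on_UNIV_norm_le:
  fixes f :: "'a \<Rightarrow> complex"
  assumes "g summable_on UNIV" "\<And>k. cmod (f k) \<le> g k"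
  shows "f summable_on UNIV" "cmod (infsum f UNIV) \<le> infsum g UNIV"
proof -
  have *: "(\<lambda>k. norm (f k)) summable_on UNIV"
    by (rule summable_on_comparison_test[OF assms(1)]) (use assms(2) in auto)
  show "f summable_on UNIV" by (rule abs_summable_summable[OF *])
  have "cmod (infsum f UNIV) \<le> (\<Sum>\<^sub>\<infinity>k. norm (f k))" by (rule norm_infsum_bound[OF *])
  also have "\<dots> \<le> infsum g UNIV" by (rule infsum_mono[OF * assms(1) assms(2)])
  finally show "cmod (infsum f UNIV) \<le> infsum g UNIV" .
qed

lemma fourier_series_has_sum:
  assumes "rapidly_decreasing a"
  shows "((\<lambda>k. a k * character k x) has_sum fourier_series a x) UNIV"
  unfolding fourier_series_def
  using summable_on_UNIV_norm_le(1)[OF rapidly_decreasing_summable[OF assms, of 0]]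
  by (simp add: norm_mult)

lemma fourier_series_bound:
  assumes "rapidly_decreasing a"
  shows "cmod (fourier_series a x) \<le> (\<Sum>\<^sub>\<infinity>k. cmod (a k))"
  unfolding fourier_series_def
  using summable_on_UNIV_norm_le(2)[OF rapidly_decreasing_summable[OF assms, of 0], of "\<lambda>k. a k * character k x"]
  by (simp add: norm_mult)

text \<open>Second-order remainder of e^(it) at t = 2 pi k.h, where |t| \<le> 2 pi <k> |h|. The
  growth in <k> will be absorbed by rapidly decreasing coefficients.\<close>

lemma character_taylor:
  "cmod (character k (x + h) - character k x - 2 * pi * \<i> * of_real (of_int_vec k \<bullet> h) * character k x)
    \<le> 2 * pi\<^sup>2 * (japanese_bracket k)\<^sup>2 * (norm h)\<^sup>2"
proof -
  define t where "t = 2 * pi * (of_int_vec k \<bullet> h)"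
  have "\<bar>of_int_vec k \<bullet> h\<bar> \<le> japanese_bracket k * norm h"
    by (rule order_trans[OF Cauchy_Schwarz_ineq2]) (rule mult_right_mono[OF norm_le_japanese_bracket norm_ge_zero])
  then have "\<bar>t\<bar> \<le> 2 * pi * (japanese_bracket k * norm h)"
    by (simp add: t_def abs_mult)
  then have "\<bar>t\<bar>\<^sup>2 \<le> (2 * pi * (japanese_bracket k * norm h))\<^sup>2"
    by (intro power_mono) auto
  then have t: "t\<^sup>2 / 2 \<le> 2 * pi\<^sup>2 * (japanese_bracket k)\<^sup>2 * (norm h)\<^sup>2"
    by (simp add: power_mult_distrib)
  have "character k (x + h) - character k x - 2 * pi * \<i> * of_real (of_int_vec k \<bullet> h) * character k x
      = character k x * (exp (\<i> * t) - (1 + \<i> * t))"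
    unfolding character_add by (simp add: character_def t_def cis_conv_exp algebra_simps)
  also have "cmod \<dots> \<le> t\<^sup>2 / 2"
    using iexp_approx1[of t 1] by (simp add: norm_mult power2_eq_square)
  finally show ?thesis using t by linarith
qed

text \<open>Taylor estimates are summed term by term: one power of <k>, summable against
  \<open>a\<close>, makes the linear part \<open>T\<close> bounded, and two powers make the
  remainder at most a constant times |h|^2.\<close>

lemma fourier_series_has_derivative:
  fixes a :: "int ^ 'n::finite \<Rightarrow> complex"
  assumes a: "rapidly_decreasing a"
  shows "(fourier_series a has_derivative
    (\<lambda>h. \<Sum>\<^sub>\<infinity>k. a k * (2 * pi * \<i> * of_real (of_int_vec k \<bullet> h) * character k x))) (at x)"
proof -
  define T where "T = (\<lambda>(h :: real ^ 'n) k. a k * (2 * pi * \<i> * of_real (of_int_vec k \<bullet> h) * character k x))"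
  define B where "B = (\<Sum>\<^sub>\<infinity>k. 2 * pi * (japanese_bracket k ^ 1 * cmod (a k)))"
  define S where "S = (\<Sum>\<^sub>\<infinity>k. 2 * pi\<^sup>2 * (japanese_bracket k ^ 2 * cmod (a k)))"
  have sum1: "(\<lambda>k. norm h * (2 * pi * (japanese_bracket k ^ 1 * cmod (a k)))) summable_on UNIV" for h :: "real ^ 'n"
    by (intro summable_on_cmult_right rapidly_decreasing_summable a)
  have T_le: "cmod (T h k) \<le> norm h * (2 * pi * (japanese_bracket k ^ 1 * cmod (a k)))" for h k
  proof -
    have "\<bar>of_int_vec k \<bullet> h\<bar> \<le> japanese_bracket k * norm h"
      by (rule order_trans[OF Cauchy_Schwarz_ineq2]) (rule mult_right_mono[OF norm_le_japanese_bracket norm_ge_zero])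
    then have "cmod (a k) * (2 * pi * \<bar>of_int_vec k \<bullet> h\<bar>) \<le> cmod (a k) * (2 * pi * (japanese_bracket k * norm h))"
      by (intro mult_left_mono) auto
    then show ?thesis by (simp add: T_def norm_mult mult_ac)
  qed
  have sumT: "T h summable_on UNIV" for h
    by (rule summable_on_UNIV_norm_le(1)[OF sum1 T_le])
  have lin: "bounded_linear (\<lambda>h. infsum (T h) UNIV)"
  proof (rule bounded_linear_intro[where K = B])
    show "infsum (T (h + h')) UNIV = infsum (T h) UNIV + infsum (T h') UNIV" for h h'
    proof -
      have "T (h + h') = (\<lambda>k. T h k + T h' k)"
        by (simp add: T_def fun_eq_iff inner_add_right algebra_simps)
      then show ?thesis by (simp add: infsum_add sumT)
    qed
    show "infsum (T (r *\<^sub>R h)) UNIV = r *\<^sub>R infsum (T h) UNIV" for r h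
    proof -
      have "T (r *\<^sub>R h) = (\<lambda>k. r *\<^sub>R T h k)"
        by (simp add: T_def fun_eq_iff scaleR_conv_of_real[where 'a = complex])
      then show ?thesis by (simp add: infsum_scaleR_right)
    qed
    show "norm (infsum (T h) UNIV) \<le> norm h * B" for h
      using summable_on_UNIV_norm_le(2)[OF sum1 T_le, of h] by (simp add: B_def infsum_cmult_right')
  qed
  have rem: "norm (fourier_series a (x + h) - fourier_series a x - infsum (T h) UNIV) \<le> (norm h)\<^sup>2 * S" for h
  proof -
    have "((\<lambda>k. a k * character k (x + h) - a k * character k x - T h k) has_sum
        (fourier_series a (x + h) - fourier_series a x - infsum (T h) UNIV)) UNIV"
      by (intro has_sum_diff fourier_series_has_sum a has_sum_infsum sumT)
    moreover have "cmod (a k * character k (x + h) - a k * character k x - T h k)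
        \<le> (norm h)\<^sup>2 * (2 * pi\<^sup>2 * (japanese_bracket k ^ 2 * cmod (a k)))" for k
    proof -
      have "a k * character k (x + h) - a k * character k x - T h k
          = a k * (character k (x + h) - character k x - 2 * pi * \<i> * of_real (of_int_vec k \<bullet> h) * character k x)"
        by (simp add: T_def algebra_simps)
      then show ?thesis
        using mult_left_mono[OF character_taylor[of k x h] norm_ge_zero[of "a k"]]
        by (simp add: norm_mult mult_ac)
    qed
    moreover have "(\<lambda>k. (norm h)\<^sup>2 * (2 * pi\<^sup>2 * (japanese_bracket k ^ 2 * cmod (a k)))) summable_on UNIV"
      by (intro summable_on_cmult_right rapidly_decreasing_summable a)
    ultimately have "cmod (fourier_series a (x + h) - fourier_series a x - infsum (T h) UNIV)
        \<le> (\<Sum>\<^sub>\<infinity>k. (norm h)\<^sup>2 * (2 * pi\<^sup>2 * (japanese_bracket k ^ 2 * cmod (a k))))"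
      using summable_on_UNIV_norm_le(2) by (metis (no_types, lifting) infsumI)
    then show ?thesis by (simp add: S_def infsum_cmult_right')
  qed
  have "((\<lambda>h. norm (fourier_series a (x + h) - fourier_series a x - infsum (T h) UNIV) / norm h) \<longlongrightarrow> 0) (at 0)"
  proof (rule Lim_null_comparison)
    show "\<forall>\<^sub>F h in at 0. norm (norm (fourier_series a (x + h) - fourier_series a x - infsum (T h) UNIV) / norm h) \<le> norm h * S"
    proof (intro eventuallyI)
      fix h :: "real ^ 'n"
      show "norm (norm (fourier_series a (x + h) - fourier_series a x - infsum (T h) UNIV) / norm h) \<le> norm h * S"
        using rem[of h] by (cases "h = 0") (simp_all add: divide_le_eq power2_eq_square mult_ac)
    qed
    have "((\<lambda>h :: real ^ 'n. norm h * S) \<longlongrightarrow> norm (0 :: real ^ 'n) * S) (at 0)"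
      by (intro tendsto_intros)
    then show "((\<lambda>h :: real ^ 'n. norm h * S) \<longlongrightarrow> 0) (at 0)" by simp
  qed
  with lin have "(fourier_series a has_derivative (\<lambda>h. infsum (T h) UNIV)) (at x)"
    unfolding has_derivative_at by blast
  then show ?thesis unfolding T_def .
qed

subsection \<open>Distributions and their Fourier coefficients\<close>

lemma partial_deriv_fourier_series:
  assumes "rapidly_decreasing a"
  shows "partial_deriv i (fourier_series a) = fourier_series (\<lambda>k. 2 * pi * \<i> * of_int (k $ i) * a k)"
  unfolding fun_eq_iff partial_deriv_eq[OF fourier_series_has_derivative[OF assms]] fourier_series_def
  by (simp add: inner_axis mult_ac)

lemma norm_derivative_symbol:
  "cmod (prod_list (map (\<lambda>i. 2 * pi * \<i> * of_int (k $ i)) \<alpha>)) \<le> (2 * pi) ^ length \<alpha> * japanese_bracket k ^ length \<alpha>"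
proof (induction \<alpha>)
  case (Cons i \<alpha>)
  have "cmod (prod_list (map (\<lambda>i. 2 * pi * \<i> * of_int (k $ i)) (i # \<alpha>)))
      = (2 * pi * \<bar>real_of_int (k $ i)\<bar>) * cmod (prod_list (map (\<lambda>i. 2 * pi * \<i> * of_int (k $ i)) \<alpha>))"
    by (simp add: norm_mult)
  also have "\<dots> \<le> (2 * pi * japanese_bracket k) * ((2 * pi) ^ length \<alpha> * japanese_bracket k ^ length \<alpha>)"
    by (intro mult_mono Cons.IH mult_left_mono component_le_japanese_bracket) auto
  finally show ?case by (simp add: mult_ac)
qed simp

text \<open>Rapid decrease of the multiplied coefficients is established for all \<alpha>
  beforehand, because each induction step differentiates a series that already carries the symbol of
  the earlier derivatives.\<close>

lemma iter_partial_fourier_series: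
  assumes "rapidly_decreasing a"
  shows "iter_partial \<alpha> (fourier_series a)
    = fourier_series (\<lambda>k. prod_list (map (\<lambda>i. 2 * pi * \<i> * of_int (k $ i)) \<alpha>) * a k)"
    and "rapidly_decreasing (\<lambda>k. prod_list (map (\<lambda>i. 2 * pi * \<i> * of_int (k $ i)) \<alpha>) * a k)"
proof -
  show *: "rapidly_decreasing (\<lambda>k. prod_list (map (\<lambda>i. 2 * pi * \<i> * of_int (k $ i)) \<alpha>) * a k)" for \<alpha>
  proof (rule rapidly_decreasing_mono[OF assms])
    show "cmod (prod_list (map (\<lambda>i. 2 * pi * \<i> * of_int (k $ i)) \<alpha>) * a k)
        \<le> (2 * pi) ^ length \<alpha> * japanese_bracket k ^ length \<alpha> * cmod (a k)" for k
      unfolding norm_mult[of _ "a k"] by (rule mult_right_mono[OF norm_derivative_symbol norm_ge_zero])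
  qed
  show "iter_partial \<alpha> (fourier_series a)
      = fourier_series (\<lambda>k. prod_list (map (\<lambda>i. 2 * pi * \<i> * of_int (k $ i)) \<alpha>) * a k)"
  proof (induction \<alpha>)
    case (Cons i \<alpha>)
    show ?case
      unfolding iter_partial_Cons Cons.IH partial_deriv_fourier_series[OF *] by (simp add: mult.assoc)
  qed simp
qed

lemma fourier_series_test_functions:
  fixes a :: "int ^ 'n::finite \<Rightarrow> complex"
  assumes "rapidly_decreasing a"
  shows "fourier_series a \<in> test_functions"
proof -
  have "iter_partial \<alpha> (fourier_series a) differentiable (at x)" for \<alpha> x
    unfolding iter_partial_fourier_series(1)[OF assms] differentiable_def
    using fourier_series_has_derivative[OF iter_partial_fourier_series(2)[OF assms]] by blast
  moreover have "fourier_series a (x + of_int_vec k) = fourier_series a x" for x k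
    by (simp add: fourier_series_def character_add)
  ultimately show ?thesis
    by (auto simp: test_functions_def differentiable_on_def intro: differentiable_at_withinI)
qed

text \<open>Derivatives of order at most \<open>N\<close> cost at most \<open>N\<close> powers of
  the bracket, which is at least 1. Seminorms of tails of a series are thus controlled by tails of a
  numerical series.\<close>

lemma test_seminorm_fourier_series:
  fixes a :: "int ^ 'n::finite \<Rightarrow> complex"
  assumes "rapidly_decreasing a"
  shows "test_seminorm N (fourier_series a)
    \<le> (\<Sum>\<alpha> :: 'n list | length \<alpha> \<le> N. (2 * pi) ^ length \<alpha>) * (\<Sum>\<^sub>\<infinity>k. japanese_bracket k ^ N * cmod (a k))"
  unfolding test_seminorm_def sum_distrib_right
proof (rule sum_mono)
  fix \<alpha> :: "'n list" assume \<alpha>: "\<alpha> \<in> {\<alpha>. length \<alpha> \<le> N}"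
  let ?b = "\<lambda>k. prod_list (map (\<lambda>i. 2 * pi * \<i> * of_int (k $ i)) \<alpha>) * a k"
  have b: "rapidly_decreasing ?b" by (rule iter_partial_fourier_series(2)[OF assms])
  show "(SUP x. cmod (iter_partial \<alpha> (fourier_series a) x)) \<le> (2 * pi) ^ length \<alpha> * (\<Sum>\<^sub>\<infinity>k. japanese_bracket k ^ N * cmod (a k))"
    unfolding iter_partial_fourier_series(1)[OF assms]
  proof (rule cSUP_least)
    fix x
    have "cmod (fourier_series ?b x) \<le> (\<Sum>\<^sub>\<infinity>k. cmod (?b k))"
      by (rule fourier_series_bound[OF b])
    also have "\<dots> \<le> (\<Sum>\<^sub>\<infinity>k. (2 * pi) ^ length \<alpha> * (japanese_bracket k ^ N * cmod (a k)))"
    proof (rule infsum_mono)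
      show "(\<lambda>k. cmod (?b k)) summable_on UNIV"
        using rapidly_decreasing_summable[OF b, of 0] by simp
      show "(\<lambda>k. (2 * pi) ^ length \<alpha> * (japanese_bracket k ^ N * cmod (a k))) summable_on UNIV"
        by (intro summable_on_cmult_right rapidly_decreasing_summable assms)
      fix k
      have "cmod (?b k) \<le> (2 * pi) ^ length \<alpha> * japanese_bracket k ^ length \<alpha> * cmod (a k)"
        unfolding norm_mult[of _ "a k"] by (rule mult_right_mono[OF norm_derivative_symbol norm_ge_zero])
      also have "\<dots> \<le> (2 * pi) ^ length \<alpha> * japanese_bracket k ^ N * cmod (a k)"
        using \<alpha> by (intro mult_right_mono mult_left_mono power_increasing japanese_bracket_ge_1) auto
      finally show "cmod (?b k) \<le> (2 * pi) ^ length \<alpha> * (japanese_bracket k ^ N * cmod (a k))"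
        by (simp add: mult.assoc)
    qed
    also have "\<dots> = (2 * pi) ^ length \<alpha> * (\<Sum>\<^sub>\<infinity>k. japanese_bracket k ^ N * cmod (a k))"
      by (rule infsum_cmult_right')
    finally show "cmod (fourier_series ?b x) \<le> (2 * pi) ^ length \<alpha> * (\<Sum>\<^sub>\<infinity>k. japanese_bracket k ^ N * cmod (a k))" .
  qed simp
qed

lemma rapidly_decreasing_finite_support:
  assumes "finite {k. a k \<noteq> 0}"
  shows "rapidly_decreasing a"
  unfolding rapidly_decreasing_def
proof
  fix m
  have "japanese_bracket k ^ m * cmod (a k) \<le> (\<Sum>k | a k \<noteq> 0. japanese_bracket k ^ m * cmod (a k))" for k
  proof (cases "a k = 0")
    case False
    then show ?thesis by (intro member_le_sum assms) auto
  qed (simp add: sum_nonneg)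
  then show "\<exists>C. \<forall>k. japanese_bracket k ^ m * cmod (a k) \<le> C" by blast
qed

lemma fourier_series_restrict:
  assumes "finite F"
  shows "fourier_series (\<lambda>k. if k \<in> F then a k else 0) = (\<lambda>x. \<Sum>k\<in>F. a k * character k x)"
proof
  fix x
  have "((\<lambda>k. (if k \<in> F then a k else 0) * character k x) has_sum (\<Sum>k\<in>F. a k * character k x)) UNIV"
    by (rule has_sum_finite_neutralI[OF assms]) auto
  then show "fourier_series (\<lambda>k. if k \<in> F then a k else 0) x = (\<Sum>k\<in>F. a k * character k x)"
    unfolding fourier_series_def by (rule infsumI)
qed

lemma finite_sum_test_functions:
  assumes "finite F"
  shows "(\<lambda>x. \<Sum>k\<in>F. a k * character k x) \<in> test_functions"
  unfolding fourier_series_restrict[OF assms, symmetric]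
  by (intro fourier_series_test_functions rapidly_decreasing_finite_support finite_subset[OF _ assms]) auto

lemma character_test_functions [simp]: "character k \<in> test_functions"
  using finite_sum_test_functions[of "{k}" "\<lambda>_. 1"] by simp

lemma test_seminorm_character:
  fixes k :: "int ^ 'n::finite"
  shows "test_seminorm N (character k) \<le> (\<Sum>\<alpha> :: 'n list | length \<alpha> \<le> N. (2 * pi) ^ length \<alpha>) * japanese_bracket k ^ N"
proof -
  let ?a = "\<lambda>j. if j \<in> {k} then 1 else 0 :: complex"
  have "rapidly_decreasing ?a" by (rule rapidly_decreasing_finite_support) simp
  from test_seminorm_fourier_series[OF this, of N]
  have "test_seminorm N (character k)
    \<le> (\<Sum>\<alpha> :: 'n list | length \<alpha> \<le> N. (2 * pi) ^ length \<alpha>) * (\<Sum>\<^sub>\<infinity>j. japanese_bracket j ^ N * cmod (?a j))"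
    by (subst (asm) fourier_series_restrict) simp_all
  also have "(\<Sum>\<^sub>\<infinity>j. japanese_bracket j ^ N * cmod (?a j)) = japanese_bracket k ^ N"
    by (rule infsumI, rule has_sum_finite_neutralI[of "{k}"]) auto
  finally show ?thesis .
qed

section \<open>Distributions evaluated on Fourier series\<close>

lemma distributionsD:
  assumes "f \<in> distributions"
  shows "f \<in> extensional test_functions"
    "\<phi> \<in> test_functions \<Longrightarrow> \<psi> \<in> test_functions \<Longrightarrow> f (\<lambda>x. \<phi> x + \<psi> x) = f \<phi> + f \<psi>"
    "\<phi> \<in> test_functions \<Longrightarrow> f (\<lambda>x. c * \<phi> x) = c * f \<phi>"
  using assms by (simp_all add: distributions_def)

lemma test_functions_cmult: "\<phi> \<in> test_functions \<Longrightarrow> (\<lambda>x. c * \<phi> x) \<in> test_functions"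
  using test_functions_lincomb[of \<phi> \<phi> c 0] by simp

lemma distribution_lincomb:
  assumes "f \<in> distributions" "\<phi> \<in> test_functions" "\<psi> \<in> test_functions"
  shows "f (\<lambda>x. a * \<phi> x + b * \<psi> x) = a * f \<phi> + b * f \<psi>"
  unfolding distributionsD(2)[OF assms(1) test_functions_cmult[OF assms(2)] test_functions_cmult[OF assms(3)]]
  by (simp only: distributionsD(3)[OF assms(1)] assms(2,3))

lemma distribution_bounded:
  assumes "f \<in> distributions"
  obtains C N where "C \<ge> 0" "\<And>\<phi>. \<phi> \<in> test_functions \<Longrightarrow> cmod (f \<phi>) \<le> C * test_seminorm N \<phi>"
proof -
  obtain C N where CN: "\<And>\<phi>. \<phi> \<in> test_functions \<Longrightarrow> cmod (f \<phi>) \<le> C * test_seminorm N \<phi>"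
    using assms unfolding distributions_def test_seminorm_def by blast
  have "cmod (f \<phi>) \<le> \<bar>C\<bar> * test_seminorm N \<phi>" if "\<phi> \<in> test_functions" for \<phi>
    by (rule order_trans[OF CN[OF that]]) (simp add: mult_right_mono test_seminorm_nonneg[OF that])
  then show ?thesis using that[of "\<bar>C\<bar>" N] by simp
qed

lemma distribution_finite_sum:
  assumes "f \<in> distributions" "finite F"
  shows "f (\<lambda>x. \<Sum>k\<in>F. a k * character k x) = (\<Sum>k\<in>F. a k * f (character k))"
  using assms(2)
proof induction
  case empty
  show ?case using distributionsD(3)[OF assms(1) character_test_functions, of 0 0] by simp
next
  case (insert k F)
  then show ?case
    using distribution_lincomb[OF assms(1) character_test_functions[of k] finite_sum_test_functions[OF insert.hyps(1), of a], of "a k" 1]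
    by simp
qed

text \<open>Linearity handles the finite part. Continuity bounds the value on the remaining series
  by one of its seminorms, hence by a tail of the sum of <k>^N |a k|.\<close>

lemma distribution_fourier_series:
  fixes a :: "int ^ 'n::finite \<Rightarrow> complex"
  assumes "f \<in> distributions" "rapidly_decreasing a"
  shows "((\<lambda>k. a k * f (character k)) has_sum f (fourier_series a)) UNIV"
proof -
  obtain C N where CN: "C \<ge> 0" "\<And>\<phi>. \<phi> \<in> test_functions \<Longrightarrow> cmod (f \<phi>) \<le> C * test_seminorm N \<phi>"
    using distribution_bounded[OF assms(1)] by blast
  define L where "L = (\<Sum>\<alpha> :: 'n list | length \<alpha> \<le> N. (2 * pi) ^ length \<alpha>)"
  define g where "g = (\<lambda>k. japanese_bracket k ^ N * cmod (a k))"
  have g: "g summable_on UNIV" unfolding g_def by (rule rapidly_decreasing_summable[OF assms(2)])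
  then have G: "(g has_sum infsum g UNIV) UNIV" by simp
  show ?thesis
  proof (rule has_sum_from_tail_bound[OF G, where C = "C * L"])
    fix F :: "(int ^ 'n) set" assume F: "finite F"
    define b where "b = (\<lambda>k. if k \<in> F then 0 else a k)"
    have b: "rapidly_decreasing b"
      by (rule rapidly_decreasing_mono[OF assms(2), of _ 1 0]) (simp add: b_def)
    have "fourier_series b = (\<lambda>x. 1 * fourier_series a x + (- 1) * (\<Sum>k\<in>F. a k * character k x))"
    proof
      fix x
      have "((\<lambda>k. a k * character k x - (if k \<in> F then a k else 0) * character k x) has_sum
          fourier_series a x - (\<Sum>k\<in>F. a k * character k x)) UNIV"
        by (intro has_sum_diff fourier_series_has_sum assms has_sum_finite_neutralI[OF F]) auto
      moreover have "(\<lambda>k. a k * character k x - (if k \<in> F then a k else 0) * character k x) = (\<lambda>k. b k * character k x)"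
        by (auto simp: b_def)
      ultimately show "fourier_series b x = 1 * fourier_series a x + (- 1) * (\<Sum>k\<in>F. a k * character k x)"
        using infsumI unfolding fourier_series_def[of b] by fastforce
    qed
    then have "f (fourier_series a) - (\<Sum>k\<in>F. a k * f (character k)) = f (fourier_series b)"
      using distribution_lincomb[OF assms(1) fourier_series_test_functions[OF assms(2)] finite_sum_test_functions[OF F, of a], of 1 "- 1"]
      by (simp add: distribution_finite_sum assms(1) F)
    also have "cmod \<dots> \<le> C * test_seminorm N (fourier_series b)"
      by (rule CN(2)[OF fourier_series_test_functions[OF b]])
    also have "\<dots> \<le> C * (L * (\<Sum>\<^sub>\<infinity>k. japanese_bracket k ^ N * cmod (b k)))"
      unfolding L_def by (intro mult_left_mono CN test_seminorm_fourier_series b)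
    also have "(\<Sum>\<^sub>\<infinity>k. japanese_bracket k ^ N * cmod (b k)) = infsum g UNIV - sum g F"
    proof (rule infsumI)
      have "((\<lambda>k. g k - (if k \<in> F then g k else 0)) has_sum infsum g UNIV - sum g F) UNIV"
        by (intro has_sum_diff G has_sum_finite_neutralI[OF F]) auto
      moreover have "(\<lambda>k. g k - (if k \<in> F then g k else 0)) = (\<lambda>k. japanese_bracket k ^ N * cmod (b k))"
        by (auto simp: b_def g_def)
      ultimately show "((\<lambda>k. japanese_bracket k ^ N * cmod (b k)) has_sum infsum g UNIV - sum g F) UNIV" by simp
    qed
    finally show "cmod (f (fourier_series a) - (\<Sum>k\<in>F. a k * f (character k))) \<le> C * L * (infsum g UNIV - sum g F)"
      by (simp add: mult.assoc)
  qed
qed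

lemma distribution_slowly_growing:
  assumes "f \<in> distributions"
  shows "slowly_growing (\<lambda>k. f (character k))"
proof -
  obtain C N where CN: "C \<ge> 0" "\<And>\<phi>. \<phi> \<in> test_functions \<Longrightarrow> cmod (f \<phi>) \<le> C * test_seminorm N \<phi>"
    using distribution_bounded[OF assms] by blast
  have "cmod (f (character k)) \<le> (C * (\<Sum>\<alpha> :: 'a list | length \<alpha> \<le> N. (2 * pi) ^ length \<alpha>)) * japanese_bracket k ^ N" for k
  proof -
    have "cmod (f (character k)) \<le> C * test_seminorm N (character k)" by (rule CN(2)) simp
    also have "\<dots> \<le> C * ((\<Sum>\<alpha> :: 'a list | length \<alpha> \<le> N. (2 * pi) ^ length \<alpha>) * japanese_bracket k ^ N)"
      by (intro mult_left_mono CN test_seminorm_character)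
    finally show ?thesis by (simp add: mult.assoc)
  qed
  then show ?thesis unfolding slowly_growing_def by blast
qed

lemma slowly_growing_uminus: "slowly_growing a \<Longrightarrow> slowly_growing (\<lambda>k. a (- k))"
  unfolding slowly_growing_def by (metis japanese_bracket_uminus)

lemma fourier_coeff_slowly_growing: "f \<in> distributions \<Longrightarrow> slowly_growing (fourier_coeff f)"
  using slowly_growing_uminus[OF distribution_slowly_growing] by (simp add: fourier_coeff_eq[abs_def])

text \<open>The sign is reversed because the k-th coefficient pairs \<open>f\<close> with the
  character of frequency -k. Since the right side knows \<open>f\<close> only through its
  coefficients, these determine \<open>f\<close>.\<close>

lemma distribution_expansion:
  assumes "f \<in> distributions" "\<phi> \<in> test_functions"
  shows "((\<lambda>k. test_coeff \<phi> k * fourier_coeff f (- k)) has_sum f \<phi>) UNIV"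
  using distribution_fourier_series[OF assms(1) rapidly_decreasing_test_coeff[OF assms(2)]]
  by (simp add: fourier_series_test_coeff assms(2) fourier_coeff_eq)

lemma distribution_eqI:
  assumes "f \<in> distributions" "g \<in> distributions" "\<And>k. fourier_coeff f k = fourier_coeff g k"
  shows "f = g"
proof (rule extensionalityI[OF distributionsD(1)[OF assms(1)] distributionsD(1)[OF assms(2)]])
  fix \<phi> :: "real ^ 'a \<Rightarrow> complex" assume "\<phi> \<in> test_functions"
  with distribution_expansion[OF assms(1) this] distribution_expansion[OF assms(2) this]
  show "f \<phi> = g \<phi>" by (simp add: assms(3) has_sum_unique)
qed

section \<open>Distributions with prescribed coefficients of polynomial growth\<close>

lemma test_coeff_lincomb:
  assumes "\<phi> \<in> test_functions" "\<psi> \<in> test_functions"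
  shows "test_coeff (\<lambda>x. a * \<phi> x + b * \<psi> x) k = a * test_coeff \<phi> k + b * test_coeff \<psi> k"
proof (rule LIMSEQ_unique)
  show "(\<lambda>m. grid_coeff (2 ^ m) (\<lambda>x. a * \<phi> x + b * \<psi> x) k) \<longlonglongrightarrow> test_coeff (\<lambda>x. a * \<phi> x + b * \<psi> x) k"
    by (intro grid_coeff_tendsto test_functions_lincomb assms)
  have "grid_coeff (2 ^ m) (\<lambda>x. a * \<phi> x + b * \<psi> x) k = a * grid_coeff (2 ^ m) \<phi> k + b * grid_coeff (2 ^ m) \<psi> k" for m
    by (simp add: grid_coeff_def grid_mean_def algebra_simps sum.distrib sum_distrib_left add_divide_distrib)
  then show "(\<lambda>m. grid_coeff (2 ^ m) (\<lambda>x. a * \<phi> x + b * \<psi> x) k) \<longlonglongrightarrow> a * test_coeff \<phi> k + b * test_coeff \<psi> k"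
    by (simp only:) (intro tendsto_intros grid_coeff_tendsto assms)
qed

text \<open>A shift by one grid step in direction \<open>i\<close> preserves the mean but multiplies
  it by e^(2 pi i k_i/M), which \<open>norm_cis_minus_1_ge\<close> keeps away from 1.\<close>

lemma grid_mean_character_eq_0:
  assumes "M > 0" "\<bar>real_of_int (k $ i)\<bar> \<le> real M / 2" "k $ i \<noteq> 0"
  shows "grid_mean M (character k) = 0"
proof -
  have "(of_int_vec (axis i 1) :: real ^ 'a) = axis i 1"
    by (simp add: vec_eq_iff axis_def)
  then have ch: "character k ((1 / real M) *\<^sub>R of_int_vec (axis i 1)) = cis (2 * pi * (real_of_int (k $ i) / real M))"
    by (simp add: character_def inner_axis)
  have "grid_mean M (\<lambda>x. character k ((1 / real M) *\<^sub>R of_int_vec (axis i 1)) * character k x) = grid_mean M (character k)"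
    using grid_mean_translate[OF lattice_periodic_character assms(1), of k "axis i 1"]
    unfolding character_add by (simp only: mult.commute)
  then have "cis (2 * pi * (real_of_int (k $ i) / real M)) * grid_mean M (character k) = grid_mean M (character k)"
    unfolding grid_mean_cmult ch .
  then have "grid_mean M (character k) * (cis (2 * pi * (real_of_int (k $ i) / real M)) - 1) = 0"
    by (simp add: right_diff_distrib mult.commute)
  moreover have "0 < 4 * \<bar>real_of_int (k $ i) / real M\<bar>"
    using assms by simp
  then have "cis (2 * pi * (real_of_int (k $ i) / real M)) - 1 \<noteq> 0"
    using norm_cis_minus_1_ge[of "real_of_int (k $ i) / real M"] assms(1,2)
    by (auto simp: field_simps)
  ultimately show ?thesis by simp
qed

text \<open>Coefficients being limits over grids, orthogonality here means that the mean of the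
  character of frequency j - k vanishes on all sufficiently fine dyadic grids.\<close>

lemma test_coeff_character: "test_coeff (character j) k = (if j = k then 1 else 0)"
proof (cases "j = k")
  case True
  have "grid_coeff (2 ^ m) (character k) k = 1" for m
    unfolding grid_coeff_def by (simp add: grid_mean_def card_grid)
  then show ?thesis using True by (simp add: test_coeff_def)
next
  case False
  then obtain i where i: "(j - k) $ i \<noteq> 0" by (auto simp: vec_eq_iff)
  have "\<forall>\<^sub>F m in sequentially. {j - k} \<subseteq> {k. \<forall>i. k $ i \<in> {- int (2 ^ m)..<int (2 ^ m)}}"
    by (rule eventually_lattice_box) simp
  then have "\<forall>\<^sub>F m in sequentially. grid_coeff (2 ^ Suc m) (character j) k = 0"
  proof eventually_elim
    case (elim m)
    have "grid_mean (2 ^ Suc m) (character (j - k)) = 0"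
      using lattice_box_bound[of "j - k" "2 ^ m"] elim by (intro grid_mean_character_eq_0[OF _ _ i]) auto
    moreover have "(\<lambda>x. character j x * character (- k) x) = character (j - k)"
      by (simp add: fun_eq_iff flip: character_freq_add)
    ultimately show ?case by (simp add: grid_coeff_def)
  qed
  then have "(\<lambda>m. grid_coeff (2 ^ Suc m) (character j) k) \<longlonglongrightarrow> 0"
    by (rule tendsto_eventually)
  moreover have "(\<lambda>m. grid_coeff (2 ^ Suc m) (character j) k) \<longlonglongrightarrow> test_coeff (character j) k"
    by (intro LIMSEQ_Suc grid_coeff_tendsto character_test_functions)
  ultimately show ?thesis using False LIMSEQ_unique by auto
qed

lemma slowly_growing_pairing_bound:
  fixes b :: "int ^ 'n::finite \<Rightarrow> complex"
  assumes "slowly_growing b"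
  obtains C N where "\<And>\<phi>. \<phi> \<in> test_functions \<Longrightarrow> (\<lambda>k. test_coeff \<phi> k * b (- k)) summable_on UNIV"
    "\<And>\<phi>. \<phi> \<in> test_functions \<Longrightarrow> cmod (\<Sum>\<^sub>\<infinity>k. test_coeff \<phi> k * b (- k)) \<le> C * test_seminorm N \<phi>"
proof -
  obtain B M where B: "\<And>k. cmod (b k) \<le> B * japanese_bracket k ^ M"
    using assms unfolding slowly_growing_def by blast
  have "0 \<le> B * japanese_bracket (0 :: int ^ 'n) ^ M" by (rule order_trans[OF norm_ge_zero B])
  then have B0: "B \<ge> 0" by (simp add: zero_le_mult_iff) (simp add: japanese_bracket_def)
  \<comment> \<open>\<open>M\<close> powers of the bracket absorb the growth of \<open>b\<close>; 2n
    more make the series summable.\<close>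
  define N where "N = M + 2 * CARD('n)"
  define D where "D = B * real (CARD('n) + 1) ^ (N + 1)"
  have sum: "(\<lambda>k :: int ^ 'n. (D * test_seminorm N \<phi>) * (1 / japanese_bracket k ^ (2 * CARD('n)))) summable_on UNIV"
    for \<phi> :: "real ^ 'n \<Rightarrow> complex"
    by (rule summable_on_cmult_right summable_japanese_bracket)+
  have le: "cmod (test_coeff \<phi> k * b (- k)) \<le> (D * test_seminorm N \<phi>) * (1 / japanese_bracket k ^ (2 * CARD('n)))"
    if "\<phi> \<in> test_functions" for \<phi> k
  proof -
    have "cmod (test_coeff \<phi> k * b (- k)) * japanese_bracket k ^ (2 * CARD('n))
        \<le> cmod (test_coeff \<phi> k) * (B * japanese_bracket k ^ M) * japanese_bracket k ^ (2 * CARD('n))"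
      unfolding norm_mult using B[of "- k"] by (intro mult_right_mono mult_left_mono) auto
    also have "\<dots> = B * (japanese_bracket k ^ N * cmod (test_coeff \<phi> k))"
      by (simp add: N_def power_add)
    also have "\<dots> \<le> B * (real (CARD('n) + 1) ^ (N + 1) * test_seminorm N \<phi>)"
      by (intro mult_left_mono test_coeff_decay that B0)
    finally show ?thesis by (simp add: D_def pos_le_divide_eq mult.assoc)
  qed
  show ?thesis
  proof (rule that)
    fix \<phi> :: "real ^ 'n \<Rightarrow> complex" assume \<phi>: "\<phi> \<in> test_functions"
    show "(\<lambda>k. test_coeff \<phi> k * b (- k)) summable_on UNIV"
      by (rule summable_on_UNIV_norm_le(1)[OF sum le[OF \<phi>]])
    have "cmod (\<Sum>\<^sub>\<infinity>k. test_coeff \<phi> k * b (- k)) \<le> (\<Sum>\<^sub>\<infinity>k :: int ^ 'n. (D * test_seminorm N \<phi>) * (1 / japanese_bracket k ^ (2 * CARD('n))))"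
      by (rule summable_on_UNIV_norm_le(2)[OF sum le[OF \<phi>]])
    also have "\<dots> = (D * (\<Sum>\<^sub>\<infinity>k :: int ^ 'n. 1 / japanese_bracket k ^ (2 * CARD('n)))) * test_seminorm N \<phi>"
      by (subst infsum_cmult_right') simp
    finally show "cmod (\<Sum>\<^sub>\<infinity>k. test_coeff \<phi> k * b (- k)) \<le> (D * (\<Sum>\<^sub>\<infinity>k :: int ^ 'n. 1 / japanese_bracket k ^ (2 * CARD('n)))) * test_seminorm N \<phi>" .
  qed
qed

text \<open>The functional is defined by the expansion that any distribution with these coefficients
  must satisfy. The pairing bound is its continuity, and orthogonality of characters recovers
  \<open>b\<close>.\<close>

lemma ex_has_fourier_coeffs:
  fixes b :: "int ^ 'n::finite \<Rightarrow> complex"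
  assumes "slowly_growing b"
  shows "\<exists>f. has_fourier_coeffs f b"
proof -
  obtain C N where sum: "\<And>\<phi>. \<phi> \<in> test_functions \<Longrightarrow> (\<lambda>k. test_coeff \<phi> k * b (- k)) summable_on UNIV"
    and bound: "\<And>\<phi>. \<phi> \<in> test_functions \<Longrightarrow> cmod (\<Sum>\<^sub>\<infinity>k. test_coeff \<phi> k * b (- k)) \<le> C * test_seminorm N \<phi>"
    using slowly_growing_pairing_bound[OF assms] by blast
  define f where "f = (\<lambda>\<phi>\<in>test_functions. \<Sum>\<^sub>\<infinity>k. test_coeff \<phi> k * b (- k))"
  have lin: "f (\<lambda>x. u * \<phi> x + v * \<psi> x) = u * f \<phi> + v * f \<psi>"
    if \<phi>: "\<phi> \<in> test_functions" and \<psi>: "\<psi> \<in> test_functions" for \<phi> \<psi> u v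
  proof -
    have "((\<lambda>k. u * (test_coeff \<phi> k * b (- k)) + v * (test_coeff \<psi> k * b (- k))) has_sum u * f \<phi> + v * f \<psi>) UNIV"
      using sum[OF \<phi>] sum[OF \<psi>] \<phi> \<psi> by (intro has_sum_add has_sum_cmult_right) (simp_all add: f_def)
    then show ?thesis
      using \<phi> \<psi> by (simp add: f_def test_functions_lincomb test_coeff_lincomb algebra_simps infsumI)
  qed
  have "f \<in> distributions"
    unfolding distributions_def mem_Collect_eq
  proof (intro conjI allI ballI)
    show "f \<in> extensional test_functions" by (simp add: f_def)
    show "f (\<lambda>x. \<phi> x + \<psi> x) = f \<phi> + f \<psi>" if "\<phi> \<in> test_functions" "\<psi> \<in> test_functions" for \<phi> \<psi>
      using lin[OF that, of 1 1] by simp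
    show "f (\<lambda>x. c * \<phi> x) = c * f \<phi>" if "\<phi> \<in> test_functions" for c \<phi>
      using lin[OF that that, of c 0] by simp
    show "\<exists>C N. \<forall>\<phi>\<in>test_functions. cmod (f \<phi>) \<le> C * (\<Sum>\<alpha> | length \<alpha> \<le> N. SUP x. cmod (iter_partial \<alpha> \<phi> x))"
      using bound by (auto simp: f_def simp flip: test_seminorm_def)
  qed
  moreover have "fourier_coeff f k = b k" for k
  proof -
    have "((\<lambda>j. test_coeff (character (- k)) j * b (- j)) has_sum b k) UNIV"
      by (rule has_sum_finite_neutralI[of "{- k}"]) (auto simp: test_coeff_character)
    then show ?thesis by (simp add: fourier_coeff_eq f_def infsumI)
  qed
  ultimately show ?thesis by (auto simp: has_fourier_coeffs_def)
qed

lemma has_fourier_coeffs_unique: "has_fourier_coeffs f a \<Longrightarrow> has_fourier_coeffs g a \<Longrightarrow> f = g"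
  by (auto simp: has_fourier_coeffs_def intro: distribution_eqI)

lemma distr_of_coeffs_eq: "has_fourier_coeffs f a \<Longrightarrow> distr_of_coeffs a = f"
  unfolding distr_of_coeffs_def by (rule the_equality) (auto intro: has_fourier_coeffs_unique)

lemma has_fourier_coeffs_distr_of_coeffs: "slowly_growing a \<Longrightarrow> has_fourier_coeffs (distr_of_coeffs a) a"
  using ex_has_fourier_coeffs distr_of_coeffs_eq by metis

lemma ex_has_fourier_coeffs_iff: "(\<exists>f. has_fourier_coeffs f a) \<longleftrightarrow> slowly_growing a"
proof
  assume "\<exists>f. has_fourier_coeffs f a"
  then obtain f where "f \<in> distributions" "fourier_coeff f = a"
    by (auto simp: has_fourier_coeffs_def)
  then show "slowly_growing a" using fourier_coeff_slowly_growing by blast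
qed (rule ex_has_fourier_coeffs)

subsection \<open>The Radon transform in Fourier space\<close>

lemma integral_cis_unit_interval:
  fixes m :: int
  shows "(LBINT t. indicator {0..1} t *\<^sub>R cis (2 * pi * (of_int m * t))) = (if m = 0 then 1 else 0)"
proof (cases "m = 0")
  case False
  define c where "c = 2 * pi * \<i> * of_int m"
  have c: "c \<noteq> 0" using False by (simp add: c_def)
  have cis: "cis (2 * pi * (of_int m * t)) = exp (c * of_real t)" for t
    by (simp add: cis_conv_exp c_def mult_ac)
  have "(LBINT t. indicator {0..1} t *\<^sub>R exp (c * of_real t)) = exp (c * of_real 1) / c - exp (c * of_real 0) / c"
  proof (rule integral_FTC_atLeastAtMost)
    fix t :: real
    have "((\<lambda>z. exp (c * z) / c) has_field_derivative exp (c * of_real t)) (at (of_real t))"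
      using c by (auto intro!: derivative_eq_intros)
    then have "((\<lambda>t. exp (c * of_real t) / c) has_vector_derivative exp (c * of_real t)) (at t)"
      by (rule has_vector_derivative_real_field)
    then show "((\<lambda>t. exp (c * of_real t) / c) has_vector_derivative exp (c * of_real t)) (at t within {0..1})"
      by (rule has_vector_derivative_at_within)
  qed (auto intro!: continuous_intros)
  also have "exp (c * of_real 1) = 1"
    using cis[of 1] cis_multiple_2pi[OF Ints_of_int[of m]] by simp
  finally show ?thesis using False by (simp add: cis)
qed simp

section \<open>Averages over the parameter cube\<close>

abbreviation unit_cube :: "nat \<Rightarrow> (nat \<Rightarrow> real) set" where
  "unit_cube n \<equiv> {..<n} \<rightarrow>\<^sub>E {0..1}"

abbreviation lborel_power :: "nat \<Rightarrow> (nat \<Rightarrow> real) measure" where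
  "lborel_power n \<equiv> Pi\<^sub>M {..<n} (\<lambda>_. lborel)"

interpretation lborel_product: product_sigma_finite "\<lambda>_ :: nat. lborel :: real measure" ..

lemma unit_cube_sets [measurable]: "unit_cube n \<in> sets (lborel_power n)"
  by (intro sets_PiM_I_finite) auto

lemma emeasure_unit_cube: "emeasure (lborel_power n) (unit_cube n) = 1"
  by (subst lborel_product.emeasure_PiM) simp_all

lemma unit_cube_integrable:
  fixes f :: "(nat \<Rightarrow> real) \<Rightarrow> complex"
  assumes "f \<in> borel_measurable (lborel_power n)" "\<And>t. cmod (f t) \<le> B"
  shows "integrable (lborel_power n) (\<lambda>t. indicator (unit_cube n) t *\<^sub>R f t)"
    and "cmod (\<integral>t. indicator (unit_cube n) t *\<^sub>R f t \<partial>lborel_power n) \<le> B"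
proof -
  show int: "integrable (lborel_power n) (\<lambda>t. indicator (unit_cube n) t *\<^sub>R f t)"
    by (rule integrableI_bounded_set_indicator[where B = B]) (use assms in \<open>auto simp: emeasure_unit_cube\<close>)
  have int': "integrable (lborel_power n) (\<lambda>t. indicator (unit_cube n) t *\<^sub>R B)"
    by (rule integrableI_bounded_set_indicator[where B = "\<bar>B\<bar>"]) (auto simp: emeasure_unit_cube)
  have "cmod (\<integral>t. indicator (unit_cube n) t *\<^sub>R f t \<partial>lborel_power n)
      \<le> (\<integral>t. cmod (indicator (unit_cube n) t *\<^sub>R f t) \<partial>lborel_power n)"
    by (rule integral_norm_bound)
  also have "\<dots> \<le> (\<integral>t. indicator (unit_cube n) t *\<^sub>R B \<partial>lborel_power n)"
    by (rule integral_mono[OF integrable_norm[OF int] int']) (auto simp: indicator_def assms(2))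
  also have "\<dots> = B"
    using emeasure_unit_cube[of n] by (simp add: measure_def)
  finally show "cmod (\<integral>t. indicator (unit_cube n) t *\<^sub>R f t \<partial>lborel_power n) \<le> B" .
qed

lemma radon_frame_measurable:
  fixes \<phi> :: "real ^ 'n::finite \<Rightarrow> complex"
  assumes "continuous_on UNIV \<phi>"
  shows "(\<lambda>t. \<phi> (x + (\<Sum>j<length vs. t j *\<^sub>R of_int_vec (vs ! j)))) \<in> borel_measurable (lborel_power (length vs))"
proof -
  have [measurable]: "\<phi> \<in> borel_measurable borel"
    using assms by (rule borel_measurable_continuous_onI)
  show ?thesis by measurable
qed

lemma radon_frame_eq:
  "radon_frame \<phi> vs x = (\<integral>t. indicator (unit_cube (length vs)) t *\<^sub>R
      \<phi> (x + (\<Sum>j<length vs. t j *\<^sub>R of_int_vec (vs ! j))) \<partial>lborel_power (length vs))"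
  by (simp add: radon_frame_def set_lebesgue_integral_def)

lemma radon_frame_bound:
  assumes "continuous_on UNIV \<phi>" "\<And>x. cmod (\<phi> x) \<le> B"
  shows "cmod (radon_frame \<phi> vs x) \<le> B"
  unfolding radon_frame_eq by (rule unit_cube_integrable(2)[OF radon_frame_measurable]) (rule assms)+

lemma radon_frame_diff:
  assumes "continuous_on UNIV \<phi>" "\<And>x. cmod (\<phi> x) \<le> B" "continuous_on UNIV \<psi>" "\<And>x. cmod (\<psi> x) \<le> D"
  shows "radon_frame (\<lambda>x. \<phi> x - \<psi> x) vs x = radon_frame \<phi> vs x - radon_frame \<psi> vs x"
  unfolding radon_frame_eq scaleR_diff_right
  by (rule Bochner_Integration.integral_diff)
    (rule unit_cube_integrable(1)[OF radon_frame_measurable] assms)+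

lemma radon_frame_sum:
  assumes "finite F"
  shows "radon_frame (\<lambda>x. \<Sum>k\<in>F. a k * character k x) vs x = (\<Sum>k\<in>F. a k * radon_frame (character k) vs x)"
proof -
  have int: "integrable (lborel_power (length vs)) (\<lambda>t. indicator (unit_cube (length vs)) t *\<^sub>R
      (a k * character k (x + (\<Sum>j<length vs. t j *\<^sub>R of_int_vec (vs ! j)))))" for k
    by (rule unit_cube_integrable(1)[where B = "cmod (a k)"], rule radon_frame_measurable[of "\<lambda>x. a k * character k x"])
      (auto intro!: continuous_intros simp: norm_mult)
  have "radon_frame (\<lambda>x. \<Sum>k\<in>F. a k * character k x) vs x
      = (\<Sum>k\<in>F. \<integral>t. indicator (unit_cube (length vs)) t *\<^sub>R
          (a k * character k (x + (\<Sum>j<length vs. t j *\<^sub>R of_int_vec (vs ! j)))) \<partial>lborel_power (length vs))"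
    unfolding radon_frame_eq scaleR_sum_right by (rule Bochner_Integration.integral_sum) (rule int)
  then show ?thesis
    unfolding radon_frame_eq by (simp only: mult_scaleR_right[symmetric] integral_mult_right_zero)
qed

text \<open>Both the character and the indicator of the cube factor over the frame, so the integral
  is a product of integrals of e^(2 pi i (k.v_j) t) over [0,1], each 0 or 1 because k.v_j is an
  integer.\<close>

lemma radon_frame_character:
  fixes k :: "int ^ 'n::finite"
  shows "radon_frame (character k) vs x
    = (if \<forall>v\<in>set vs. (\<Sum>i\<in>UNIV. k $ i * v $ i) = 0 then character k x else 0)"
proof -
  define m where "m = (\<lambda>j. \<Sum>i\<in>UNIV. k $ i * (vs ! j) $ i)"
  let ?n = "length vs"
  have ch: "character k (x + (\<Sum>j<?n. t j *\<^sub>R of_int_vec (vs ! j)))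
      = character k x * (\<Prod>j<?n. cis (2 * pi * (of_int (m j) * t j)))" for t
  proof -
    have "character k (\<Sum>j\<in>J. t j *\<^sub>R of_int_vec (vs ! j)) = (\<Prod>j\<in>J. cis (2 * pi * (of_int (m j) * t j)))"
      if "finite J" for J
      using that
    proof induction
      case (insert j J)
      have "character k (t j *\<^sub>R of_int_vec (vs ! j)) = cis (2 * pi * (of_int (m j) * t j))"
        by (simp add: character_def inner_of_int_vec m_def sum_distrib_right sum_distrib_left mult_ac)
      with insert show ?case by (simp add: character_add)
    qed simp
    then show ?thesis by (simp add: character_add)
  qed
  have ind: "indicator (unit_cube ?n) t *\<^sub>R character k (x + (\<Sum>j<?n. t j *\<^sub>R of_int_vec (vs ! j)))
      = character k x * (\<Prod>j<?n. indicator {0..1} (t j) *\<^sub>R cis (2 * pi * (of_int (m j) * t j)))"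
    if "t \<in> space (lborel_power ?n)" for t
  proof (cases "t \<in> unit_cube ?n")
    case True
    then have "indicator {0..1} (t j) = (1 :: real)" if "j < ?n" for j
      using that by (auto simp: PiE_iff)
    then show ?thesis using True by (simp add: ch)
  next
    case False
    \<comment> \<open>Points of the product space are extensional, so lying outside the cube can
      only be due to a coordinate outside [0,1]; that coordinate annihilates the product.\<close>
    then obtain j where "j < ?n" "t j \<notin> {0..1}"
      using \<open>t \<in> space (lborel_power ?n)\<close> by (auto simp: PiE_iff space_PiM)
    then have "(\<Prod>j<?n. indicator {0..1} (t j) *\<^sub>R cis (2 * pi * (of_int (m j) * t j))) = 0"
      by (intro prod_zero bexI[of _ j]) auto
    then show ?thesis using False by simp
  qed
  have "radon_frame (character k) vs x
      = (\<integral>t. character k x * (\<Prod>j<?n. indicator {0..1} (t j) *\<^sub>R cis (2 * pi * (of_int (m j) * t j))) \<partial>lborel_power ?n)"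
    unfolding radon_frame_eq by (rule Bochner_Integration.integral_cong[OF refl ind])
  also have "\<dots> = character k x * (\<integral>t. (\<Prod>j<?n. indicator {0..1} (t j) *\<^sub>R cis (2 * pi * (of_int (m j) * t j))) \<partial>lborel_power ?n)"
    by simp
  also have "(\<integral>t. (\<Prod>j<?n. indicator {0..1} (t j) *\<^sub>R cis (2 * pi * (of_int (m j) * t j))) \<partial>lborel_power ?n)
      = (\<Prod>j<?n. LBINT t. indicator {0..1} t *\<^sub>R cis (2 * pi * (of_int (m j) * t)))"
  proof (rule lborel_product.product_integral_prod)
    show "integrable lborel (\<lambda>t. indicator {0..1} t *\<^sub>R cis (2 * pi * (of_int (m j) * t)))" for j
      using borel_integrable_atLeastAtMost'[of 0 1 "\<lambda>t. cis (2 * pi * (of_int (m j) * t))"]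
      unfolding set_integrable_def cis_conv_exp by (simp add: continuous_intros)
  qed simp
  also have "\<dots> = (\<Prod>j<?n. if m j = 0 then 1 else 0)"
    by (simp only: integral_cis_unit_interval)
  also have "\<dots> = (if \<forall>j<?n. m j = 0 then 1 else 0)"
    by auto
  also have "(\<forall>j<?n. m j = 0) \<longleftrightarrow> (\<forall>v\<in>set vs. (\<Sum>i\<in>UNIV. k $ i * v $ i) = 0)"
    by (simp add: m_def all_set_conv_all_nth)
  finally show ?thesis by simp
qed

text \<open>Averaging does not increase a uniform bound, so it commutes with the uniformly
  convergent series, and on each character it is a cut-off. The frame survives only in the
  orthogonality condition.\<close>

lemma radon_frame_fourier_series:
  fixes a :: "int ^ 'n::finite \<Rightarrow> complex"
  assumes a: "rapidly_decreasing a"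
  shows "radon_frame (fourier_series a) vs
    = fourier_series (\<lambda>k. if \<forall>v\<in>set vs. (\<Sum>i\<in>UNIV. k $ i * v $ i) = 0 then a k else 0)"
proof
  fix x
  define g where "g = (\<lambda>k. cmod (a k))"
  have "g summable_on UNIV"
    unfolding g_def using rapidly_decreasing_summable[OF a, of 0] by simp
  then have G: "(g has_sum infsum g UNIV) UNIV" by simp
  have cont: "continuous_on UNIV (fourier_series b)" if "rapidly_decreasing b" for b :: "int ^ 'n \<Rightarrow> complex"
    by (intro test_functionsD fourier_series_test_functions that)
  have "((\<lambda>k. a k * radon_frame (character k) vs x) has_sum radon_frame (fourier_series a) vs x) UNIV"
  proof (rule has_sum_from_tail_bound[OF G, where C = 1])
    fix F :: "(int ^ 'n) set" assume F: "finite F"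
    have "cmod (radon_frame (\<lambda>x. fourier_series a x - (\<Sum>k\<in>F. a k * character k x)) vs x) \<le> infsum g UNIV - sum g F"
    proof (rule radon_frame_bound)
      show "continuous_on UNIV (\<lambda>x. fourier_series a x - (\<Sum>k\<in>F. a k * character k x))"
        by (intro continuous_intros cont a)
      fix x
      have "((\<lambda>k. a k * character k x - (if k \<in> F then a k * character k x else 0)) has_sum
          fourier_series a x - (\<Sum>k\<in>F. a k * character k x)) UNIV"
        by (intro has_sum_diff fourier_series_has_sum a has_sum_finite_neutralI[OF F]) auto
      moreover have g: "((\<lambda>k. g k - (if k \<in> F then g k else 0)) has_sum infsum g UNIV - sum g F) UNIV"
        by (intro has_sum_diff G has_sum_finite_neutralI[OF F]) auto
      moreover have "cmod (a k * character k x - (if k \<in> F then a k * character k x else 0)) \<le> g k - (if k \<in> F then g k else 0)" for k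
        by (simp add: g_def norm_mult)
      ultimately show "cmod (fourier_series a x - (\<Sum>k\<in>F. a k * character k x)) \<le> infsum g UNIV - sum g F"
        using summable_on_UNIV_norm_le(2)[of "\<lambda>k. g k - (if k \<in> F then g k else 0)"]
          has_sum_imp_summable infsumI by (metis (no_types, lifting))
    qed
    moreover have "radon_frame (\<lambda>x. fourier_series a x - (\<Sum>k\<in>F. a k * character k x)) vs x
        = radon_frame (fourier_series a) vs x - (\<Sum>k\<in>F. a k * radon_frame (character k) vs x)"
      unfolding radon_frame_sum[OF F, symmetric]
    proof (rule radon_frame_diff)
      show "cmod (fourier_series a x) \<le> (\<Sum>\<^sub>\<infinity>k. cmod (a k))" for x by (rule fourier_series_bound[OF a])
      show "cmod (\<Sum>k\<in>F. a k * character k x) \<le> (\<Sum>k\<in>F. cmod (a k))" for x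
        by (rule sum_norm_le) (simp add: norm_mult)
    qed (intro continuous_intros cont a)+
    ultimately show "cmod (radon_frame (fourier_series a) vs x - (\<Sum>k\<in>F. a k * radon_frame (character k) vs x))
        \<le> 1 * (infsum g UNIV - sum g F)" by simp
  qed
  then have eq: "radon_frame (fourier_series a) vs x = (\<Sum>\<^sub>\<infinity>k. a k * radon_frame (character k) vs x)"
    by (rule infsumI[symmetric])
  show "radon_frame (fourier_series a) vs x
      = fourier_series (\<lambda>k. if \<forall>v\<in>set vs. (\<Sum>i\<in>UNIV. k $ i * v $ i) = 0 then a k else 0) x"
    unfolding eq unfolding fourier_series_def radon_frame_character by (rule infsum_cong) simp
qed

section \<open>Integer bases and orthogonal subspaces\<close>

lemma perp_subspace: "vec.subspace {v :: rat ^ 'n::finite. (\<Sum>i\<in>UNIV. of_int (k $ i) * v $ i) = 0}"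
  by (rule vec.subspaceI)
    (simp_all add: distrib_left sum.distrib mult.left_commute flip: sum_distrib_left)

text \<open>Orthogonality to \<open>k\<close> is a linear condition and passes from a basis to its
  span. This makes the arbitrary choice of basis in \<open>radon_test\<close> harmless: the cut-off
  depends on the subspace alone.\<close>

lemma perp_integer_basis:
  assumes "integer_basis vs A"
  shows "perp k A \<longleftrightarrow> (\<forall>v\<in>set vs. (\<Sum>i\<in>UNIV. k $ i * v $ i) = 0)"
proof -
  let ?P = "{v :: rat ^ 'a. (\<Sum>i\<in>UNIV. of_int (k $ i) * v $ i) = 0}"
  let ?V = "(of_int_vec :: int ^ 'a \<Rightarrow> rat ^ 'a) ` set vs"
  have A: "A = vec.span ?V" using assms by (simp add: integer_basis_def)
  have "perp k A \<longleftrightarrow> A \<subseteq> ?P" by (auto simp: perp_def)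
  also have "\<dots> \<longleftrightarrow> ?V \<subseteq> ?P"
    unfolding A using vec.span_minimal[OF _ perp_subspace[of k]] vec.span_superset[of ?V] by blast
  also have "\<dots> \<longleftrightarrow> (\<forall>v\<in>set vs. rat_of_int (\<Sum>i\<in>UNIV. k $ i * v $ i) = 0)"
    by auto
  finally show ?thesis by (simp only: of_int_eq_0_iff)
qed

lemma common_denominator:
  fixes v :: "rat ^ 'n::finite"
  obtains N :: int and u :: "int ^ 'n" where "N \<noteq> 0" "rat_of_int N *s v = of_int_vec u"
proof -
  define N where "N = (\<Prod>i\<in>UNIV. snd (quotient_of (v $ i)))"
  have pos: "snd (quotient_of r) > 0" for r by (simp add: quotient_of_denom_pos')
  have "\<exists>z. rat_of_int N * v $ i = rat_of_int z" for i
  proof -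
    define p q where "p = fst (quotient_of (v $ i))" and "q = snd (quotient_of (v $ i))"
    have v: "v $ i = rat_of_int p / rat_of_int q"
      using quotient_of_div[of "v $ i" p q] by (simp add: p_def q_def)
    have q: "q \<noteq> 0" using pos[of "v $ i"] by (simp add: q_def)
    have "N = q * (\<Prod>j\<in>UNIV - {i}. snd (quotient_of (v $ j)))"
      unfolding N_def q_def by (rule prod.remove) auto
    then have "rat_of_int N * v $ i = rat_of_int (p * (\<Prod>j\<in>UNIV - {i}. snd (quotient_of (v $ j))))"
      using q by (simp add: v)
    then show ?thesis by blast
  qed
  then obtain z where "\<And>i. rat_of_int N * v $ i = rat_of_int (z i)" by metis
  then have "rat_of_int N *s v = of_int_vec (\<chi> i. z i)" by (simp add: vec_eq_iff)
  moreover have "N \<noteq> 0" unfolding N_def using pos by (simp add: less_imp_neq[symmetric])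
  ultimately show ?thesis by (rule that[rotated])
qed

text \<open>A maximal independent set of integer points of \<open>A\<close> already spans
  \<open>A\<close>, since clearing denominators moves each vector of \<open>A\<close> to an integer
  point on the same line. It justifies the choice in \<open>radon_test\<close>.\<close>

lemma ex_integer_basis:
  fixes A :: "(rat ^ 'n::finite) set"
  assumes "vec.subspace A"
  shows "\<exists>vs. integer_basis vs A"
proof -
  let ?S = "A \<inter> range (of_int_vec :: int ^ 'n \<Rightarrow> rat ^ 'n)"
  obtain B where B: "B \<subseteq> ?S" "vec.independent B" "?S \<subseteq> vec.span B"
    by (rule vec.maximal_independent_subset)
  have "v \<in> vec.span B" if "v \<in> A" for v
  proof -
    obtain N :: int and u :: "int ^ 'n" where N: "N \<noteq> 0" "rat_of_int N *s v = of_int_vec u"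
      by (rule common_denominator)
    have "rat_of_int N *s v \<in> ?S"
      using vec.subspace_scale[OF assms that, of "rat_of_int N"] by (simp add: N(2))
    with B(3) have "rat_of_int N *s v \<in> vec.span B" by (rule subsetD)
    then have "inverse (rat_of_int N) *s (rat_of_int N *s v) \<in> vec.span B"
      by (rule vec.span_scale)
    then show ?thesis using N(1) by (simp add: vector_smult_assoc)
  qed
  then have span: "vec.span B = A"
    using vec.span_minimal[OF _ assms, of B] B(1) by blast
  obtain K where K: "B = (of_int_vec :: int ^ 'n \<Rightarrow> rat ^ 'n) ` K"
    using B(1) by (meson le_inf_iff subset_imageE)
  have inj: "inj (of_int_vec :: int ^ 'n \<Rightarrow> rat ^ 'n)"
    by (rule injI) (simp add: vec_eq_iff)
  have "finite B" by (rule vec.finiteI_independent[OF B(2)])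
  then have "finite K" unfolding K by (rule finite_imageD) (rule inj_on_subset[OF inj], simp)
  then obtain vs where "set vs = K" "distinct vs" using finite_distinct_list by blast
  then have "integer_basis vs A" using B(2) span by (simp add: integer_basis_def K)
  then show ?thesis ..
qed

lemma GrD: "A \<in> Gr d \<Longrightarrow> vec.subspace A" "A \<in> Gr d \<Longrightarrow> vec.dim A = d"
  by (simp_all add: Gr_def)

text \<open>The kernel of v -> k.v has codimension at most 1: a basis of it and one more vector span
  everything. So the basis has at least n - 1 \<ge> d elements, and any d of them span a
  member.\<close>

lemma Omega_nonempty:
  fixes k :: "int ^ 'n::finite"
  assumes "d \<le> CARD('n) - 1"
  shows "Omega d k \<noteq> {}"
proof -
  let ?f = "\<lambda>v :: rat ^ 'n. \<Sum>i\<in>UNIV. of_int (k $ i) * v $ i"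
  let ?P = "{v. ?f v = 0}"
  obtain B where B: "B \<subseteq> ?P" "vec.independent B" "?P \<subseteq> vec.span B" "card B = vec.dim ?P"
    by (rule vec.basis_exists)
  have fin: "finite B" by (rule vec.finiteI_independent[OF B(2)])
  obtain u where u: "UNIV \<subseteq> vec.span (insert u B)"
  proof (cases "\<exists>u. ?f u \<noteq> 0")
    case True
    then obtain u where u: "?f u \<noteq> 0" by blast
    have "v \<in> vec.span (insert u B)" for v
    proof -
      have "?f (v - c *s u) = ?f v - c * ?f u" for c
        by (simp add: right_diff_distrib sum_subtractf mult.left_commute sum_distrib_left[symmetric])
      from this[of "?f v / ?f u"] have "?f (v - (?f v / ?f u) *s u) = ?f v - (?f v / ?f u) * ?f u" .
      also have "\<dots> = 0" using u by simp
      finally have "v - (?f v / ?f u) *s u \<in> ?P" by (rule CollectI)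
      with B(3) have "v - (?f v / ?f u) *s u \<in> vec.span B" by (rule subsetD)
      then have "v - (?f v / ?f u) *s u \<in> vec.span (insert u B)"
        using vec.span_mono[of B "insert u B"] by blast
      moreover have "(?f v / ?f u) *s u \<in> vec.span (insert u B)"
        by (intro vec.span_scale vec.span_base) simp
      ultimately have "(v - (?f v / ?f u) *s u) + (?f v / ?f u) *s u \<in> vec.span (insert u B)"
        by (rule vec.span_add)
      then show ?thesis by simp
    qed
    then show ?thesis using that by blast
  next
    case False
    \<comment> \<open>If the functional vanishes identically, the kernel is the whole space and 0
      serves as a dummy extra vector.\<close>
    then have "UNIV \<subseteq> vec.span B" using B(3) by auto
    also have "\<dots> \<subseteq> vec.span (insert 0 B)" by (rule vec.span_mono) auto
    finally show ?thesis by (rule that)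
  qed
  have "vec.dim (UNIV :: (rat ^ 'n) set) \<le> card (insert u B)"
    by (rule vec.dim_le_card[OF u]) (simp add: fin)
  also have "\<dots> \<le> Suc (card B)" by (rule card_insert_le_m1) simp_all
  finally have "d \<le> card B" using assms by (simp add: card_cart_basis)
  then obtain D where D: "D \<subseteq> B" "card D = d" by (meson obtain_subset_with_card_n)
  have ind: "vec.independent D" by (rule vec.independent_mono[OF B(2) D(1)])
  have "vec.span D \<subseteq> ?P"
    by (rule vec.span_minimal[OF _ perp_subspace]) (use D(1) B(1) in blast)
  then have "perp k (vec.span D)" by (auto simp: perp_def)
  moreover have "vec.span D \<in> Gr d"
    using D(2) vec.dim_span_eq_card_independent[OF ind] by (simp add: Gr_def)
  ultimately show ?thesis by (auto simp: Omega_def)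
qed

section \<open>Fourier coefficients of the Radon transform\<close>

lemma radon_test_eq:
  assumes "\<phi> \<in> test_functions" "A \<in> Gr d"
  shows "radon_test \<phi> A = fourier_series (\<lambda>k. if perp k A then test_coeff \<phi> k else 0)"
proof -
  have basis: "integer_basis (SOME vs. integer_basis vs A) A"
    by (rule someI_ex[OF ex_integer_basis[OF GrD(1)[OF assms(2)]]])
  have "radon_test \<phi> A = radon_frame (fourier_series (test_coeff \<phi>)) (SOME vs. integer_basis vs A)"
    by (simp add: radon_test_def fourier_series_test_coeff assms(1))
  then show ?thesis
    by (simp add: radon_frame_fourier_series[OF rapidly_decreasing_test_coeff[OF assms(1)]] perp_integer_basis[OF basis])
qed

lemma slowly_growing_mono:
  assumes "slowly_growing a" "\<And>k. cmod (b k) \<le> C * cmod (a k)" "C \<ge> 0"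
  shows "slowly_growing b"
proof -
  obtain D N where D: "\<And>k. cmod (a k) \<le> D * japanese_bracket k ^ N"
    using assms(1) unfolding slowly_growing_def by blast
  have "cmod (b k) \<le> (C * D) * japanese_bracket k ^ N" for k
    using order_trans[OF assms(2) mult_left_mono[OF D assms(3)]] by (simp add: mult.assoc)
  then show ?thesis unfolding slowly_growing_def by blast
qed

lemma perp_uminus [simp]: "perp (- k) A \<longleftrightarrow> perp k A"
  by (simp add: perp_def sum_negf)

text \<open>Instead of estimating seminorms of \<open>radon_test\<close>, one takes the distribution
  \<open>h\<close> with the expected coefficients and checks that \<open>radon d f A\<close> agrees
  with it on every test function. Continuity is inherited from \<open>h\<close>.\<close>

lemma has_fourier_coeffs_radon:
  fixes f :: "'n::finite distr"
  assumes f: "f \<in> distributions" and A: "A \<in> Gr d"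
  shows "has_fourier_coeffs (radon d f A) (\<lambda>k. if perp k A then fourier_coeff f k else 0)"
proof -
  let ?b = "\<lambda>k. if perp k A then fourier_coeff f k else 0"
  have "slowly_growing ?b"
    by (rule slowly_growing_mono[OF fourier_coeff_slowly_growing[OF f], of _ 1]) auto
  then obtain h where h: "has_fourier_coeffs h ?b" using ex_has_fourier_coeffs by blast
  then have hD: "h \<in> distributions" by (simp add: has_fourier_coeffs_def)
  have "radon d f A = h"
  proof (rule extensionalityI[OF _ distributionsD(1)[OF hD]])
    show "radon d f A \<in> extensional test_functions" using A by (simp add: radon_def)
    fix \<phi> :: "real ^ 'n \<Rightarrow> complex" assume \<phi>: "\<phi> \<in> test_functions"
    have "rapidly_decreasing (\<lambda>k. if perp k A then test_coeff \<phi> k else 0)"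
      by (rule rapidly_decreasing_mono[OF rapidly_decreasing_test_coeff[OF \<phi>], of _ 1 0]) simp
    from distribution_fourier_series[OF f this]
    have "((\<lambda>k. (if perp k A then test_coeff \<phi> k else 0) * f (character k)) has_sum f (radon_test \<phi> A)) UNIV"
      by (simp add: radon_test_eq[OF \<phi> A])
    also have "(\<lambda>k. (if perp k A then test_coeff \<phi> k else 0) * f (character k)) = (\<lambda>k. test_coeff \<phi> k * fourier_coeff h (- k))"
    proof
      fix k
      have "fourier_coeff h (- k) = ?b (- k)" using h by (simp add: has_fourier_coeffs_def)
      then show "(if perp k A then test_coeff \<phi> k else 0) * f (character k) = test_coeff \<phi> k * fourier_coeff h (- k)"
        by (simp add: fourier_coeff_eq)
    qed
    finally have "f (radon_test \<phi> A) = h \<phi>"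
      using distribution_expansion[OF hD \<phi>] has_sum_unique by blast
    then show "radon d f A \<phi> = h \<phi>" using A \<phi> by (simp add: radon_def)
  qed
  with h show ?thesis by simp
qed

subsection \<open>The adjoint\<close>

lemma abs_mult_le_sum_squares: "\<bar>a * b\<bar> \<le> a\<^sup>2 + b\<^sup>2" for a b :: real
  using sum_squares_bound[of "\<bar>a\<bar>" "\<bar>b\<bar>"] mult_nonneg_nonneg[of "\<bar>a\<bar>" "\<bar>b\<bar>"]
  unfolding abs_mult power2_abs by linarith

lemma Cauchy_Schwarz_infsum:
  fixes a b :: "'a \<Rightarrow> real"
  assumes "(\<lambda>x. (a x)\<^sup>2) summable_on A" "(\<lambda>x. (b x)\<^sup>2) summable_on A"
  shows "(\<lambda>x. \<bar>a x * b x\<bar>) summable_on A"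
    and "(\<Sum>\<^sub>\<infinity>x\<in>A. \<bar>a x * b x\<bar>)\<^sup>2 \<le> (\<Sum>\<^sub>\<infinity>x\<in>A. (a x)\<^sup>2) * (\<Sum>\<^sub>\<infinity>x\<in>A. (b x)\<^sup>2)"
proof -
  show sum: "(\<lambda>x. \<bar>a x * b x\<bar>) summable_on A"
  proof (rule summable_on_comparison_test)
    show "(\<lambda>x. (a x)\<^sup>2 + (b x)\<^sup>2) summable_on A" by (intro summable_on_add assms)
    show "\<bar>a x * b x\<bar> \<le> (a x)\<^sup>2 + (b x)\<^sup>2" for x
      by (rule abs_mult_le_sum_squares)
  qed simp
  let ?R = "(\<Sum>\<^sub>\<infinity>x\<in>A. (a x)\<^sup>2) * (\<Sum>\<^sub>\<infinity>x\<in>A. (b x)\<^sup>2)"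
  have "(\<Sum>\<^sub>\<infinity>x\<in>A. \<bar>a x * b x\<bar>) \<le> sqrt ?R"
  proof (rule infsum_le_finite_sums[OF sum])
    fix F assume F: "finite F" "F \<subseteq> A"
    have "(\<Sum>x\<in>F. \<bar>a x * b x\<bar>)\<^sup>2 \<le> (\<Sum>x\<in>F. (a x)\<^sup>2) * (\<Sum>x\<in>F. (b x)\<^sup>2)"
      using Cauchy_Schwarz_ineq_sum[of "\<lambda>x. \<bar>a x\<bar>" "\<lambda>x. \<bar>b x\<bar>" F] by (simp add: abs_mult)
    also have "\<dots> \<le> ?R"
      by (intro mult_mono finite_sum_le_infsum assms F sum_nonneg infsum_nonneg) auto
    finally show "(\<Sum>x\<in>F. \<bar>a x * b x\<bar>) \<le> sqrt ?R" by (rule real_le_rsqrt)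
  qed
  moreover have "0 \<le> (\<Sum>\<^sub>\<infinity>x\<in>A. \<bar>a x * b x\<bar>)" by (rule infsum_nonneg) simp
  moreover have "0 \<le> ?R" by (intro mult_nonneg_nonneg infsum_nonneg) auto
  ultimately show "(\<Sum>\<^sub>\<infinity>x\<in>A. \<bar>a x * b x\<bar>)\<^sup>2 \<le> ?R"
    using power_mono[of "\<Sum>\<^sub>\<infinity>x\<in>A. \<bar>a x * b x\<bar>" "sqrt ?R" 2] by simp
qed

lemma summable_on_product_nonneg:
  fixes F :: "'a \<Rightarrow> 'b \<Rightarrow> real"
  assumes "\<And>x y. 0 \<le> F x y" "\<And>x. x \<in> A \<Longrightarrow> F x summable_on B" "(\<lambda>x. infsum (F x) B) summable_on A"
  shows "(\<lambda>(x, y). F x y) summable_on A \<times> B"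
  by (rule summable_on_SigmaI[where g = "\<lambda>x. infsum (F x) B"]) (use assms in auto)

lemma summable_on_swap_nonneg:
  fixes F :: "'a \<Rightarrow> 'b \<Rightarrow> real"
  assumes "(\<lambda>(x, y). F x y) summable_on A \<times> B"
  shows "\<And>y. y \<in> B \<Longrightarrow> (\<lambda>x. F x y) summable_on A" "(\<lambda>y. \<Sum>\<^sub>\<infinity>x\<in>A. F x y) summable_on B"
proof -
  have *: "(\<lambda>(y, x). F x y) summable_on B \<times> A"
    using assms unfolding summable_on_swap[of _ A B] by simp
  show 1: "(\<lambda>x. F x y) summable_on A" if "y \<in> B" for y
    using summable_on_SigmaD1[OF * that] .
  show "(\<lambda>y. \<Sum>\<^sub>\<infinity>x\<in>A. F x y) summable_on B"
    using summable_on_Sigma[OF uniformly_continuous_add * 1] .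
qed

section \<open>Sobolev spaces and multipliers in terms of coefficients\<close>

abbreviation sobolev_weight :: "real \<Rightarrow> int ^ 'n::finite \<Rightarrow> real" where
  "sobolev_weight s k \<equiv> japanese_bracket k powr (2 * s)"

lemma sobolev_weight_pos: "0 < sobolev_weight s k"
  by (simp add: japanese_bracket_pos[THEN less_imp_neq, symmetric])

text \<open>Each term of a convergent nonnegative series is at most its sum. Since N \<ge> |s|, the
  factor <k>^(2N) compensates the Sobolev weight whatever the sign of \<open>s\<close>.\<close>

lemma slowly_growing_sobolev:
  fixes a :: "int ^ 'n::finite \<Rightarrow> complex"
  assumes "(\<lambda>k. sobolev_weight s k * (cmod (a k))\<^sup>2) summable_on UNIV"
  shows "slowly_growing a"
proof -
  define S where "S = (\<Sum>\<^sub>\<infinity>k. sobolev_weight s k * (cmod (a k))\<^sup>2)"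
  define N where "N = nat \<lceil>\<bar>s\<bar>\<rceil>"
  have S0: "S \<ge> 0" unfolding S_def by (rule infsum_nonneg) simp
  have "cmod (a k) \<le> sqrt S * japanese_bracket k ^ N" for k
  proof -
    have le: "sobolev_weight s k * (cmod (a k))\<^sup>2 \<le> S"
      using finite_sum_le_infsum[OF assms, of "{k}"] by (simp add: S_def)
    have "1 \<le> japanese_bracket k powr (2 * s + 2 * real N)"
      by (rule ge_one_powr_ge_zero[OF japanese_bracket_ge_1]) (simp add: N_def, linarith)
    also have "\<dots> = sobolev_weight s k * (japanese_bracket k ^ N)\<^sup>2"
      using powr_realpow[OF japanese_bracket_pos, of k "N * 2"]
      by (simp add: powr_add power_mult mult.commute)
    finally have "(cmod (a k))\<^sup>2 \<le> (cmod (a k))\<^sup>2 * (sobolev_weight s k * (japanese_bracket k ^ N)\<^sup>2)"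
      using mult_left_mono[of 1 _ "(cmod (a k))\<^sup>2"] by simp
    also have "\<dots> = (sobolev_weight s k * (cmod (a k))\<^sup>2) * (japanese_bracket k ^ N)\<^sup>2"
      by (simp only: mult_ac)
    also have "\<dots> \<le> S * (japanese_bracket k ^ N)\<^sup>2"
      by (rule mult_right_mono[OF le]) simp
    also have "\<dots> = (sqrt S * japanese_bracket k ^ N)\<^sup>2"
      using S0 by (simp add: power_mult_distrib)
    finally show ?thesis by (rule power2_le_imp_le) (simp add: S0)
  qed
  then show ?thesis unfolding slowly_growing_def by blast
qed

lemma sobolevI:
  assumes "has_fourier_coeffs f a" "(\<lambda>k. sobolev_weight s k * (cmod (a k))\<^sup>2) summable_on UNIV"
  shows "f \<in> sobolev s"
  using assms by (simp add: sobolev_def has_fourier_coeffs_def)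

lemma sobolevD:
  assumes "f \<in> sobolev s"
  shows "f \<in> distributions" "(\<lambda>k. sobolev_weight s k * (cmod (fourier_coeff f k))\<^sup>2) summable_on UNIV"
  using assms by (simp_all add: sobolev_def)

lemma sobolev_norm_sq: "(sobolev_norm s f)\<^sup>2 = (\<Sum>\<^sub>\<infinity>k. sobolev_weight s k * (cmod (fourier_coeff f k))\<^sup>2)"
  unfolding sobolev_norm_def by (rule real_sqrt_pow2) (rule infsum_nonneg, simp)

lemma sobolev_norm_nonneg [simp]: "0 \<le> sobolev_norm s f"
  unfolding sobolev_norm_def by (rule real_sqrt_ge_zero) (rule infsum_nonneg, simp)

lemma has_fourier_coeffs_multiplier:
  assumes "f \<in> multiplier_domain \<omega>"
  shows "has_fourier_coeffs (multiplier \<omega> f) (\<lambda>k. of_real (\<omega> k) * fourier_coeff f k)"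
  using assms distr_of_coeffs_eq by (fastforce simp: multiplier_domain_def multiplier_def)

lemma fourier_coeff_multiplier:
  "f \<in> multiplier_domain \<omega> \<Longrightarrow> fourier_coeff (multiplier \<omega> f) k = of_real (\<omega> k) * fourier_coeff f k"
  using has_fourier_coeffs_multiplier[of f \<omega>] by (simp add: has_fourier_coeffs_def)

lemma multiplier_domain_iff:
  "f \<in> multiplier_domain \<omega> \<longleftrightarrow> f \<in> distributions \<and> slowly_growing (\<lambda>k. of_real (\<omega> k) * fourier_coeff f k)"
  by (simp add: multiplier_domain_def ex_has_fourier_coeffs_iff)

lemma distr_of_fourier_coeff: "f \<in> distributions \<Longrightarrow> distr_of_coeffs (fourier_coeff f) = f"
  by (rule distr_of_coeffs_eq) (simp add: has_fourier_coeffs_def)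

lemma radon_distributions: "f \<in> distributions \<Longrightarrow> radon d f \<in> Gr d \<rightarrow>\<^sub>E distributions"
proof (rule PiE_I)
  show "f \<in> distributions \<Longrightarrow> A \<in> Gr d \<Longrightarrow> radon d f A \<in> distributions" for A
    using has_fourier_coeffs_radon by (auto simp: has_fourier_coeffs_def)
qed (simp add: radon_def)

lemma fourier_coeff_radon:
  "f \<in> distributions \<Longrightarrow> A \<in> Gr d \<Longrightarrow> fourier_coeff (radon d f A) k = (if perp k A then fourier_coeff f k else 0)"
  using has_fourier_coeffs_radon[of f A d] by (simp add: has_fourier_coeffs_def)

section \<open>Consequences of the bound on the weight\<close>

locale bounded_weight =
  fixes d :: nat and w :: "int ^ 'n::finite \<Rightarrow> (rat ^ 'n) set \<Rightarrow> real" and C :: real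
  assumes codim: "d \<le> CARD('n) - 1"
    and weight: "weight d w"
    and C_pos: "C > 0"
    and weight_summable: "\<And>k. (\<lambda>A. (w k A)\<^sup>2) summable_on Omega d k"
    and weight_bound: "\<And>k. (\<Sum>\<^sub>\<infinity>A\<in>Omega d k. (w k A)\<^sup>2) \<le> C\<^sup>2"
begin

lemma weight_pos: "A \<in> Gr d \<Longrightarrow> w k A > 0"
  using weight by (simp add: weight_def)

lemma weight_sq_le: "A \<in> Omega d k \<Longrightarrow> (w k A)\<^sup>2 \<le> normal_symbol d w k"
  unfolding normal_symbol_def
  using finite_sum_le_infsum[OF weight_summable, of "{A}" k] by simp

text \<open>A single square is at most the sum. The bound is confined to Omega_k; elsewhere the
  weight may be arbitrarily large.\<close>

lemma weight_le:
  assumes "A \<in> Omega d k"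
  shows "\<bar>w k A\<bar> \<le> C"
proof (rule power2_le_imp_le)
  show "\<bar>w k A\<bar>\<^sup>2 \<le> C\<^sup>2"
    using weight_sq_le[OF assms] weight_bound[of k] by (simp add: normal_symbol_def)
qed (use C_pos in simp)

lemma normal_symbol_le: "normal_symbol d w k \<le> C\<^sup>2"
  by (simp add: normal_symbol_def weight_bound)

lemma normal_symbol_pos: "0 < normal_symbol d w k"
proof -
  obtain A where A: "A \<in> Omega d k" using Omega_nonempty[OF codim] by blast
  then have "0 < (w k A)\<^sup>2" using weight_pos[of A k] by (simp add: Omega_def)
  with weight_sq_le[OF A] show ?thesis by linarith
qed

lemma slowly_growing_normal_symbol:
  assumes "slowly_growing a"
  shows "slowly_growing (\<lambda>k. of_real (normal_symbol d w k) * a k)"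
proof (rule slowly_growing_mono[OF assms])
  show "cmod (of_real (normal_symbol d w k) * a k) \<le> C\<^sup>2 * cmod (a k)" for k
    using normal_symbol_le[of k] normal_symbol_pos[of k] by (simp add: norm_mult mult_right_mono)
qed simp

text \<open>Where the weight is uncontrolled, that is for k not orthogonal to \<open>A\<close>, the
  coefficient of R f is 0; at all other k the weight is at most \<open>C\<close>.\<close>

lemma radon_multiplier_domain:
  assumes "f \<in> distributions" "A \<in> Gr d"
  shows "radon d f A \<in> multiplier_domain (\<lambda>k. w k A)"
  unfolding multiplier_domain_iff
proof
  show "radon d f A \<in> distributions" using radon_distributions[OF assms(1)] assms(2) by auto
  show "slowly_growing (\<lambda>k. of_real (w k A) * fourier_coeff (radon d f A) k)"
  proof (rule slowly_growing_mono[OF fourier_coeff_slowly_growing[OF assms(1)]])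
    show "cmod (of_real (w k A) * fourier_coeff (radon d f A) k) \<le> C * cmod (fourier_coeff f k)" for k
      using weight_le[of A k] assms C_pos
      by (auto simp: fourier_coeff_radon norm_mult Omega_def intro!: mult_right_mono)
  qed (use C_pos in simp)
qed

lemma fourier_coeff_multiplier_radon:
  assumes "f \<in> distributions" "A \<in> Gr d"
  shows "fourier_coeff (multiplier (\<lambda>k. w k A) (radon d f A)) k
    = (if perp k A then of_real (w k A) * fourier_coeff f k else 0)"
  by (simp add: fourier_coeff_multiplier[OF radon_multiplier_domain[OF assms]] fourier_coeff_radon assms)

text \<open>Extension by zero replaces an index set depending on \<open>k\<close> by a fixed one, so
  that sums over orthogonal pairs become sums over a product and Tonelli applies.\<close>

lemma has_sum_Gr_perp:
  assumes "(g has_sum S) (Omega d k)"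
  shows "((\<lambda>A. if perp k A then g A else 0) has_sum S) (Gr d)"
  using assms by (rule has_sum_cong_neutral[THEN iffD1, rotated -1]) (auto simp: Omega_def)

text \<open>Summing over \<open>A\<close> first produces W_k \<le> C^2 times the Sobolev term of
  \<open>f\<close>, so the double sum converges. Summing over k first gives the squared data norm of
  R f.\<close>

lemma radon_energy:
  assumes f: "f \<in> sobolev s"
  defines "F \<equiv> \<lambda>k A. sobolev_weight s k * (cmod (if perp k A then of_real (w k A) * fourier_coeff f k else 0))\<^sup>2"
  shows "(\<lambda>(k, A). F k A) summable_on UNIV \<times> Gr d"
    and "infsum (F k) (Gr d) = sobolev_weight s k * (cmod (fourier_coeff f k))\<^sup>2 * normal_symbol d w k"
proof -
  have F: "(F k has_sum sobolev_weight s k * (cmod (fourier_coeff f k))\<^sup>2 * normal_symbol d w k) (Gr d)" for k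
  proof -
    have "((\<lambda>A. sobolev_weight s k * (cmod (fourier_coeff f k))\<^sup>2 * (w k A)\<^sup>2) has_sum
        sobolev_weight s k * (cmod (fourier_coeff f k))\<^sup>2 * normal_symbol d w k) (Omega d k)"
      unfolding normal_symbol_def by (intro has_sum_cmult_right has_sum_infsum weight_summable)
    from has_sum_Gr_perp[OF this] show ?thesis
      by (rule has_sum_cong[THEN iffD1, rotated]) (simp add: F_def norm_mult power_mult_distrib)
  qed
  show eq: "infsum (F k) (Gr d) = sobolev_weight s k * (cmod (fourier_coeff f k))\<^sup>2 * normal_symbol d w k" for k
    by (rule infsumI[OF F])
  show "(\<lambda>(k, A). F k A) summable_on UNIV \<times> Gr d"
  proof (rule summable_on_product_nonneg)
    show "0 \<le> F k A" for k A by (simp add: F_def)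
    show "F k summable_on Gr d" for k by (rule has_sum_imp_summable[OF F])
    show "(\<lambda>k. infsum (F k) (Gr d)) summable_on UNIV"
    proof (rule summable_on_comparison_test)
      show "(\<lambda>k. sobolev_weight s k * (cmod (fourier_coeff f k))\<^sup>2 * C\<^sup>2) summable_on UNIV"
        by (intro summable_on_cmult_left sobolevD(2)[OF f])
      show "infsum (F k) (Gr d) \<le> sobolev_weight s k * (cmod (fourier_coeff f k))\<^sup>2 * C\<^sup>2" for k
        unfolding eq by (intro mult_left_mono normal_symbol_le) simp
      show "0 \<le> infsum (F k) (Gr d)" for k by (rule infsum_nonneg) (simp add: F_def)
    qed
  qed
qed

lemma radon_data_space:
  assumes f: "f \<in> sobolev s"
  shows "radon d f \<in> data_space d s w" "data_norm d s w (radon d f) \<le> C * sobolev_norm s f"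
proof -
  let ?F = "\<lambda>k A. sobolev_weight s k * (cmod (if perp k A then of_real (w k A) * fourier_coeff f k else 0))\<^sup>2"
  note fD = sobolevD(1)[OF f]
  note sum = radon_energy(1)[OF f]
  have norm: "(sobolev_norm s (multiplier (\<lambda>k. w k A) (radon d f A)))\<^sup>2 = (\<Sum>\<^sub>\<infinity>k. ?F k A)" if "A \<in> Gr d" for A
    by (simp only: sobolev_norm_sq fourier_coeff_multiplier_radon[OF fD that])
  have "multiplier (\<lambda>k. w k A) (radon d f A) \<in> sobolev s" if A: "A \<in> Gr d" for A
    using summable_on_swap_nonneg(1)[OF sum A] has_fourier_coeffs_multiplier[OF radon_multiplier_domain[OF fD A]]
    by (simp add: sobolev_def fourier_coeff_multiplier_radon[OF fD A] has_fourier_coeffs_def)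
  moreover have "(\<lambda>A. (sobolev_norm s (multiplier (\<lambda>k. w k A) (radon d f A)))\<^sup>2) summable_on Gr d"
    using summable_on_swap_nonneg(2)[OF sum]
    by (rule summable_on_cong[THEN iffD1, rotated]) (simp only: norm)
  ultimately show "radon d f \<in> data_space d s w"
    using radon_distributions[OF fD] radon_multiplier_domain[OF fD] by (simp add: data_space_def)
  have "(\<Sum>\<^sub>\<infinity>A\<in>Gr d. (sobolev_norm s (multiplier (\<lambda>k. w k A) (radon d f A)))\<^sup>2) = (\<Sum>\<^sub>\<infinity>A\<in>Gr d. \<Sum>\<^sub>\<infinity>k. ?F k A)"
    by (rule infsum_cong) (rule norm)
  also have "\<dots> = (\<Sum>\<^sub>\<infinity>k. \<Sum>\<^sub>\<infinity>A\<in>Gr d. ?F k A)"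
    by (rule infsum_swap_banach[OF sum, symmetric])
  also have "\<dots> \<le> (\<Sum>\<^sub>\<infinity>k. C\<^sup>2 * (sobolev_weight s k * (cmod (fourier_coeff f k))\<^sup>2))"
  proof (rule infsum_mono)
    show "(\<lambda>k. \<Sum>\<^sub>\<infinity>A\<in>Gr d. ?F k A) summable_on UNIV"
      using summable_on_swap_nonneg(2)[of "\<lambda>A k. ?F k A" "Gr d" UNIV] sum
      unfolding summable_on_swap[of _ UNIV "Gr d"] by simp
    show "(\<lambda>k. C\<^sup>2 * (sobolev_weight s k * (cmod (fourier_coeff f k))\<^sup>2)) summable_on UNIV"
      by (intro summable_on_cmult_right sobolevD(2)[OF f])
    show "(\<Sum>\<^sub>\<infinity>A\<in>Gr d. ?F k A) \<le> C\<^sup>2 * (sobolev_weight s k * (cmod (fourier_coeff f k))\<^sup>2)" for k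
      unfolding radon_energy(2)[OF f] mult.commute[of "C\<^sup>2"] by (intro mult_left_mono normal_symbol_le) simp
  qed
  also have "\<dots> = (C * sobolev_norm s f)\<^sup>2"
    by (simp only: infsum_cmult_right' sobolev_norm_sq power_mult_distrib)
  finally show "data_norm d s w (radon d f) \<le> C * sobolev_norm s f"
    unfolding data_norm_def using C_pos by (intro real_le_lsqrt) simp_all
qed

section \<open>Convergence, boundedness and the adjoint identity\<close>

lemma data_energy:
  assumes g: "g \<in> data_space d s w"
  shows "(\<lambda>(A, k). sobolev_weight s k * (cmod (of_real (w k A) * fourier_coeff (g A) k))\<^sup>2) summable_on Gr d \<times> UNIV"
proof (rule summable_on_product_nonneg)
  have dom: "g A \<in> multiplier_domain (\<lambda>k. w k A)" if "A \<in> Gr d" for A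
    using g that by (simp add: data_space_def)
  show "(\<lambda>k. sobolev_weight s k * (cmod (of_real (w k A) * fourier_coeff (g A) k))\<^sup>2) summable_on UNIV"
    if A: "A \<in> Gr d" for A
    using g A sobolevD(2)[of "multiplier (\<lambda>k. w k A) (g A)" s]
    by (simp add: data_space_def fourier_coeff_multiplier[OF dom[OF A]])
  have "(\<lambda>A. (sobolev_norm s (multiplier (\<lambda>k. w k A) (g A)))\<^sup>2) summable_on Gr d"
    using g by (simp add: data_space_def)
  then show "(\<lambda>A. \<Sum>\<^sub>\<infinity>k. sobolev_weight s k * (cmod (of_real (w k A) * fourier_coeff (g A) k))\<^sup>2) summable_on Gr d"
    by (rule summable_on_cong[THEN iffD1, rotated]) (simp add: sobolev_norm_sq fourier_coeff_multiplier[OF dom])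
qed simp

text \<open>Writing w^2 g as w times w g, Cauchy-Schwarz over Omega_k bounds the squared coefficient
  by W_k \<le> C^2 times the energy of \<open>g\<close> at frequency \<open>k\<close>.\<close>

lemma adjoint_coeff_bound:
  assumes g: "g \<in> data_space d s w"
  shows "(\<lambda>A. of_real ((w k A)\<^sup>2) * fourier_coeff (g A) k) summable_on Omega d k"
    and "sobolev_weight s k * (cmod (adjoint_coeff d w g k))\<^sup>2
      \<le> C\<^sup>2 * (\<Sum>\<^sub>\<infinity>A\<in>Gr d. sobolev_weight s k * (cmod (of_real (w k A) * fourier_coeff (g A) k))\<^sup>2)"
proof -
  let ?u = "\<lambda>A. cmod (of_real (w k A) * fourier_coeff (g A) k)"
  have Omega: "Omega d k \<subseteq> Gr d" by (auto simp: Omega_def)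
  have "(\<lambda>A. sobolev_weight s k * (?u A)\<^sup>2) summable_on Gr d"
    using summable_on_swap_nonneg(1)[OF data_energy[OF g], of k] by simp
  \<comment> \<open>The Sobolev factor is positive and independent of \<open>A\<close>, so it can be
    cancelled.\<close>
  then have u: "(\<lambda>A. (?u A)\<^sup>2) summable_on Gr d"
    using sobolev_weight_pos[of k s] by (subst (asm) summable_on_cmult_right') auto
  then have uO: "(\<lambda>A. (?u A)\<^sup>2) summable_on Omega d k"
    by (rule summable_on_subset_banach[OF _ Omega])
  have eq: "norm (of_real ((w k A)\<^sup>2) * fourier_coeff (g A) k) = \<bar>w k A * ?u A\<bar>" for A
    by (simp add: norm_mult abs_mult power2_eq_square)
  note CS = Cauchy_Schwarz_infsum[OF weight_summable uO]
  have abs: "(\<lambda>A. norm (of_real ((w k A)\<^sup>2) * fourier_coeff (g A) k)) summable_on Omega d k"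
    unfolding eq by (rule CS(1))
  then show "(\<lambda>A. of_real ((w k A)\<^sup>2) * fourier_coeff (g A) k) summable_on Omega d k"
    by (rule abs_summable_summable)
  have "cmod (adjoint_coeff d w g k) \<le> (\<Sum>\<^sub>\<infinity>A\<in>Omega d k. \<bar>w k A * ?u A\<bar>)"
    unfolding adjoint_coeff_def using norm_infsum_bound[OF abs] by (simp only: eq)
  then have "(cmod (adjoint_coeff d w g k))\<^sup>2 \<le> (\<Sum>\<^sub>\<infinity>A\<in>Omega d k. \<bar>w k A * ?u A\<bar>)\<^sup>2"
    by (intro power_mono) auto
  also have "\<dots> \<le> (\<Sum>\<^sub>\<infinity>A\<in>Omega d k. (w k A)\<^sup>2) * (\<Sum>\<^sub>\<infinity>A\<in>Omega d k. (?u A)\<^sup>2)" by (rule CS(2))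
  also have "\<dots> \<le> C\<^sup>2 * (\<Sum>\<^sub>\<infinity>A\<in>Gr d. (?u A)\<^sup>2)"
    by (intro mult_mono weight_bound infsum_mono2 u uO Omega infsum_nonneg) auto
  finally have "sobolev_weight s k * (cmod (adjoint_coeff d w g k))\<^sup>2
      \<le> sobolev_weight s k * (C\<^sup>2 * (\<Sum>\<^sub>\<infinity>A\<in>Gr d. (?u A)\<^sup>2))"
    by (rule mult_left_mono) simp
  then show "sobolev_weight s k * (cmod (adjoint_coeff d w g k))\<^sup>2
      \<le> C\<^sup>2 * (\<Sum>\<^sub>\<infinity>A\<in>Gr d. sobolev_weight s k * (?u A)\<^sup>2)"
    by (simp only: infsum_cmult_right' mult.left_commute)
qed

lemma adjoint_coeff_sobolev:
  assumes g: "g \<in> data_space d s w"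
  shows "(\<lambda>k. sobolev_weight s k * (cmod (adjoint_coeff d w g k))\<^sup>2) summable_on UNIV"
proof (rule summable_on_comparison_test)
  show "(\<lambda>k. C\<^sup>2 * (\<Sum>\<^sub>\<infinity>A\<in>Gr d. sobolev_weight s k * (cmod (of_real (w k A) * fourier_coeff (g A) k))\<^sup>2)) summable_on UNIV"
    by (intro summable_on_cmult_right summable_on_swap_nonneg(2)[OF data_energy[OF g]])
qed (use adjoint_coeff_bound(2)[OF g] in auto)

lemma has_fourier_coeffs_radon_star:
  assumes "g \<in> data_space d s w"
  shows "has_fourier_coeffs (radon_star d w g) (adjoint_coeff d w g)"
  unfolding radon_star_def
  by (intro has_fourier_coeffs_distr_of_coeffs slowly_growing_sobolev[OF adjoint_coeff_sobolev[OF assms]])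

lemma radon_star_sobolev: "g \<in> data_space d s w \<Longrightarrow> radon_star d w g \<in> sobolev s"
  by (rule sobolevI[OF has_fourier_coeffs_radon_star adjoint_coeff_sobolev])

text \<open>Both sides are iterated sums of one family \<open>H\<close>, whose two factors w, one
  from each multiplier, make up the w^2 of the formula. Absolute summability of \<open>H\<close>
  follows from |ab| \<le> a^2 + b^2 and the energy bounds for R f and \<open>g\<close>, which
  permits the interchange.\<close>

lemma radon_adjoint_identity:
  assumes f: "f \<in> sobolev s" and g: "g \<in> data_space d s w"
  shows "data_inner d s w (radon d f) g = sobolev_inner s f (radon_star d w g)"
proof -
  note fD = sobolevD(1)[OF f]
  let ?p = "\<lambda>k A. if perp k A then of_real (w k A) * fourier_coeff f k else 0"
  let ?u = "\<lambda>k A. of_real (w k A) * fourier_coeff (g A) k"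
  define H where "H = (\<lambda>A k. of_real (sobolev_weight s k) * ?p k A * cnj (?u k A))"
  have inner: "sobolev_inner s (multiplier (\<lambda>k. w k A) (radon d f A)) (multiplier (\<lambda>k. w k A) (g A)) = (\<Sum>\<^sub>\<infinity>k. H A k)"
    if A: "A \<in> Gr d" for A
  proof -
    have "g A \<in> multiplier_domain (\<lambda>k. w k A)" using g A by (simp add: data_space_def)
    then show ?thesis
      by (simp only: sobolev_inner_def H_def fourier_coeff_multiplier fourier_coeff_multiplier_radon[OF fD A])
  qed
  have "(\<lambda>(A, k). sobolev_weight s k * (cmod (?p k A))\<^sup>2 + sobolev_weight s k * (cmod (?u k A))\<^sup>2) summable_on Gr d \<times> UNIV"
    using summable_on_add[OF radon_energy(1)[OF f, unfolded summable_on_swap[of _ UNIV "Gr d"]] data_energy[OF g]]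
    by (simp only: case_prod_unfold fst_conv snd_conv)
  then have "(\<lambda>(A, k). H A k) summable_on Gr d \<times> UNIV"
  proof (rule abs_summable_summable[OF summable_on_comparison_test])
    fix x :: "(rat ^ 'n) set \<times> (int ^ 'n)"
    obtain A k where x: "x = (A, k)" by (cases x)
    have "cmod (?p k A) * cmod (?u k A) \<le> (cmod (?p k A))\<^sup>2 + (cmod (?u k A))\<^sup>2"
      by (rule order_trans[OF abs_ge_self abs_mult_le_sum_squares])
    then have "sobolev_weight s k * (cmod (?p k A) * cmod (?u k A)) \<le> sobolev_weight s k * ((cmod (?p k A))\<^sup>2 + (cmod (?u k A))\<^sup>2)"
      by (rule mult_left_mono) simp
    moreover have "norm (H A k) = sobolev_weight s k * (cmod (?p k A) * cmod (?u k A))"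
      by (simp add: H_def norm_mult del: of_real_mult)
    ultimately show "norm (case x of (A, k) \<Rightarrow> H A k)
        \<le> (case x of (A, k) \<Rightarrow> sobolev_weight s k * (cmod (?p k A))\<^sup>2 + sobolev_weight s k * (cmod (?u k A))\<^sup>2)"
      by (simp only: x prod.case distrib_left)
  qed simp
  then have "(\<Sum>\<^sub>\<infinity>A\<in>Gr d. \<Sum>\<^sub>\<infinity>k. H A k) = (\<Sum>\<^sub>\<infinity>k. \<Sum>\<^sub>\<infinity>A\<in>Gr d. H A k)"
    by (rule infsum_swap_banach)
  moreover have "(\<Sum>\<^sub>\<infinity>A\<in>Gr d. H A k)
      = of_real (sobolev_weight s k) * fourier_coeff f k * cnj (adjoint_coeff d w g k)" for k
  proof (rule infsumI)
    have "((\<lambda>A. of_real ((w k A)\<^sup>2) * fourier_coeff (g A) k) has_sum adjoint_coeff d w g k) (Omega d k)"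
      unfolding adjoint_coeff_def by (rule has_sum_infsum[OF adjoint_coeff_bound(1)[OF g]])
    then have "((\<lambda>A. of_real (sobolev_weight s k) * fourier_coeff f k * cnj (of_real ((w k A)\<^sup>2) * fourier_coeff (g A) k))
        has_sum of_real (sobolev_weight s k) * fourier_coeff f k * cnj (adjoint_coeff d w g k)) (Omega d k)"
      by (intro has_sum_cmult_right has_sum_cnj_iff[THEN iffD2])
    from has_sum_Gr_perp[OF this]
    show "((\<lambda>A. H A k) has_sum of_real (sobolev_weight s k) * fourier_coeff f k * cnj (adjoint_coeff d w g k)) (Gr d)"
      by (rule has_sum_cong[THEN iffD1, rotated]) (simp add: H_def power2_eq_square mult_ac)
  qed
  moreover have "data_inner d s w (radon d f) g = (\<Sum>\<^sub>\<infinity>A\<in>Gr d. \<Sum>\<^sub>\<infinity>k. H A k)"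
    unfolding data_inner_def by (rule infsum_cong) (rule inner)
  ultimately show ?thesis
    using has_fourier_coeffs_radon_star[OF g] by (simp add: sobolev_inner_def has_fourier_coeffs_def)
qed

section \<open>Uniqueness of the adjoint\<close>

text \<open>Testing against the distribution whose only nonzero coefficient sits at k isolates the
  k-th coefficient; having one frequency, it lies in every Sobolev space.\<close>

lemma sobolev_inner_separating:
  assumes "h \<in> sobolev s" "h' \<in> sobolev s" "\<And>f. f \<in> sobolev s \<Longrightarrow> sobolev_inner s f h = sobolev_inner s f h'"
  shows "h = h'"
proof (rule distribution_eqI[OF sobolevD(1)[OF assms(1)] sobolevD(1)[OF assms(2)]])
  fix k :: "int ^ 'a"
  define a where "a = (\<lambda>j. if j = k then 1 else 0 :: complex)"
  have sum: "(\<lambda>j. sobolev_weight s j * (cmod (a j))\<^sup>2) summable_on UNIV"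
    by (rule finite_nonzero_values_imp_summable_on) (simp add: a_def)
  then obtain e where e: "has_fourier_coeffs e a" using ex_has_fourier_coeffs[OF slowly_growing_sobolev] by blast
  have "sobolev_inner s e h = of_real (sobolev_weight s k) * cnj (fourier_coeff h k)" for h
    unfolding sobolev_inner_def
    by (rule infsumI, rule has_sum_finite_neutralI[of "{k}"]) (use e in \<open>auto simp: has_fourier_coeffs_def a_def\<close>)
  with assms(3)[OF sobolevI[OF e sum]] sobolev_weight_pos[of k s]
  show "fourier_coeff h k = fourier_coeff h' k" by simp
qed

text \<open>The equivalence gives existence and uniqueness at once and so evaluates the definite
  description in \<open>radon_adjoint\<close>. Uniqueness is equality of functions because adjoints
  are extensional on the data space.\<close>

lemma is_radon_adjoint_iff:
  "is_radon_adjoint d s w S \<longleftrightarrow> S = (\<lambda>g\<in>data_space d s w. radon_star d w g)"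
proof
  assume S: "S = (\<lambda>g\<in>data_space d s w. radon_star d w g)"
  show "is_radon_adjoint d s w S"
    unfolding is_radon_adjoint_def is_hilbert_adjoint_def S
    by (auto simp: radon_star_sobolev radon_adjoint_identity)
next
  assume "is_radon_adjoint d s w S"
  then have S: "S \<in> data_space d s w \<rightarrow>\<^sub>E sobolev s"
    and adj: "\<And>f g. f \<in> sobolev s \<Longrightarrow> g \<in> data_space d s w \<Longrightarrow> data_inner d s w (radon d f) g = sobolev_inner s f (S g)"
    by (auto simp: is_radon_adjoint_def is_hilbert_adjoint_def)
  show "S = (\<lambda>g\<in>data_space d s w. radon_star d w g)"
  proof (rule extensionalityI[of _ "data_space d s w"])
    show "S \<in> extensional (data_space d s w)" using S by (simp add: PiE_iff)
    fix g assume g: "g \<in> data_space d s w"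
    have "S g = radon_star d w g"
    proof (rule sobolev_inner_separating)
      show "S g \<in> sobolev s" using S g by auto
      show "radon_star d w g \<in> sobolev s" by (rule radon_star_sobolev[OF g])
      show "sobolev_inner s f (S g) = sobolev_inner s f (radon_star d w g)" if "f \<in> sobolev s" for f
        using adj[OF that g] radon_adjoint_identity[OF that g] by simp
    qed
    then show "S g = (\<lambda>g\<in>data_space d s w. radon_star d w g) g" using g by simp
  qed simp
qed

lemma radon_adjoint_eq: "g \<in> data_space d s w \<Longrightarrow> radon_adjoint d s w g = radon_star d w g"
  unfolding radon_adjoint_def is_radon_adjoint_iff by simp

section \<open>The normal operator and the inversion formula\<close>

text \<open>On Omega_k the coefficient of R f does not depend on \<open>A\<close> and comes out of
  the sum. This works for every distribution, whether or not R f lies in the data space for a given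
  \<open>s\<close>.\<close>

lemma adjoint_coeff_radon:
  assumes "f \<in> distributions"
  shows "((\<lambda>A. of_real ((w k A)\<^sup>2) * fourier_coeff (radon d f A) k) has_sum
      of_real (normal_symbol d w k) * fourier_coeff f k) (Omega d k)"
    and "adjoint_coeff d w (radon d f) k = of_real (normal_symbol d w k) * fourier_coeff f k"
proof -
  have "((\<lambda>A. of_real ((w k A)\<^sup>2) * fourier_coeff f k) has_sum of_real (normal_symbol d w k) * fourier_coeff f k) (Omega d k)"
    unfolding normal_symbol_def by (intro has_sum_cmult_left has_sum_of_real has_sum_infsum weight_summable)
  then show *: "((\<lambda>A. of_real ((w k A)\<^sup>2) * fourier_coeff (radon d f A) k) has_sum
      of_real (normal_symbol d w k) * fourier_coeff f k) (Omega d k)"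
    by (rule has_sum_cong[THEN iffD1, rotated]) (simp add: Omega_def fourier_coeff_radon assms)
  then show "adjoint_coeff d w (radon d f) k = of_real (normal_symbol d w k) * fourier_coeff f k"
    unfolding adjoint_coeff_def by (rule infsumI)
qed

lemma normal_symbol_domain: "f \<in> distributions \<Longrightarrow> f \<in> multiplier_domain (normal_symbol d w)"
  by (simp add: multiplier_domain_iff slowly_growing_normal_symbol fourier_coeff_slowly_growing)

lemma radon_star_radon:
  assumes "f \<in> distributions"
  shows "radon_star d w (radon d f) = multiplier (normal_symbol d w) f"
  unfolding radon_star_def multiplier_def using adjoint_coeff_radon(2)[OF assms] by presburger

lemma has_fourier_coeffs_radon_star_radon:
  assumes "f \<in> distributions"
  shows "has_fourier_coeffs (radon_star d w (radon d f)) (adjoint_coeff d w (radon d f))"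
  using has_fourier_coeffs_multiplier[OF normal_symbol_domain[OF assms]]
  by (simp add: radon_star_radon assms has_fourier_coeffs_def adjoint_coeff_radon(2))

lemma inverse_symbol_radon_star:
  assumes "f \<in> distributions"
  shows "of_real (inverse (normal_symbol d w k)) * fourier_coeff (radon_star d w (radon d f)) k = fourier_coeff f k"
  using has_fourier_coeffs_radon_star_radon[OF assms] normal_symbol_pos[of k]
  by (simp add: has_fourier_coeffs_def adjoint_coeff_radon(2)[OF assms] of_real_inverse)

text \<open>After cancellation of W_k the coefficients are those of \<open>f\<close>, which grow
  slowly. An estimate of 1/W_k alone would not do, as W_k > 0 gives no lower bound uniform in
  k.\<close>

lemma inverse_symbol_domain:
  assumes "f \<in> distributions"
  shows "radon_star d w (radon d f) \<in> multiplier_domain (\<lambda>k. inverse (normal_symbol d w k))"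
  unfolding multiplier_domain_iff inverse_symbol_radon_star[OF assms]
  using has_fourier_coeffs_radon_star_radon[OF assms] fourier_coeff_slowly_growing[OF assms]
  by (simp add: has_fourier_coeffs_def)

lemma radon_inversion:
  assumes "f \<in> distributions"
  shows "multiplier (\<lambda>k. inverse (normal_symbol d w k)) (radon_star d w (radon d f)) = f"
  unfolding multiplier_def inverse_symbol_radon_star[OF assms]
  by (rule distr_of_fourier_coeff[OF assms])

end

text \<open>Convergence is stated through \<open>has_sum\<close> and \<open>summable_on\<close>
  because a divergent \<open>infsum\<close> defaults to 0. Likewise \<open>multiplier\<close> and
  \<open>radon_star\<close> are definite descriptions, and the domain and coefficient statements
  guarantee that they denote actual distributions.\<close>

theorem theorem1p1:
  fixes d :: nat and s C_w :: real
    and w :: "int ^ 'n::finite \<Rightarrow> (rat ^ 'n) set \<Rightarrow> real"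
  assumes "CARD('n) \<ge> 2" and "1 \<le> d" and "d \<le> CARD('n) - 1"
    and "weight d w"
    and "C_w > 0"
    and "\<And>k. (\<lambda>A. (w k A)\<^sup>2) summable_on Omega d k"
    and "\<And>k. (\<Sum>\<^sub>\<infinity>A\<in>Omega d k. (w k A)\<^sup>2) \<le> C_w\<^sup>2"
  shows
    "((\<forall>f\<in>sobolev s. radon d f \<in> data_space d s w) \<and>
      (\<exists>C. \<forall>f\<in>sobolev s. data_norm d s w (radon d f) \<le> C * sobolev_norm s f) \<and>
      (\<exists>!S. is_radon_adjoint d s w S)) \<and>
     (\<forall>g\<in>data_space d s w. \<forall>k.
       ((\<lambda>A. of_real ((w k A)\<^sup>2) * fourier_coeff (g A) k)
          has_sum fourier_coeff (radon_adjoint d s w g) k) (Omega d k)) \<and>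
     (\<forall>f\<in>sobolev s. f \<in> multiplier_domain (normal_symbol d w) \<and>
       radon_adjoint d s w (radon d f) \<in> sobolev s \<and>
       radon_adjoint d s w (radon d f) = multiplier (normal_symbol d w) f) \<and>
     (\<forall>g\<in>radon d ` distributions.
       (\<forall>k. (\<lambda>A. of_real ((w k A)\<^sup>2) * fourier_coeff (g A) k :: complex) summable_on Omega d k) \<and>
       has_fourier_coeffs (radon_star d w g) (adjoint_coeff d w g) \<and>
       radon_star d w g \<in> multiplier_domain (\<lambda>k. inverse (normal_symbol d w k))) \<and>
     (\<forall>f\<in>distributions. radon d f \<in> Gr d \<rightarrow>\<^sub>E distributions \<and>
       multiplier (\<lambda>k. inverse (normal_symbol d w k)) (radon_star d w (radon d f)) = f) \<and>
     (\<forall>g\<in>radon d ` distributions.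
       multiplier (\<lambda>k. inverse (normal_symbol d w k)) (radon_star d w g) \<in> distributions \<and>
       radon d (multiplier (\<lambda>k. inverse (normal_symbol d w k)) (radon_star d w g)) = g)"
proof -
  interpret bounded_weight d w C_w
    by unfold_locales (use assms in auto)
  have adj: "((\<lambda>A. of_real ((w k A)\<^sup>2) * fourier_coeff (g A) k)
      has_sum fourier_coeff (radon_adjoint d s w g) k) (Omega d k)" if g: "g \<in> data_space d s w" for g k
  proof -
    have "fourier_coeff (radon_adjoint d s w g) k = adjoint_coeff d w g k"
      using has_fourier_coeffs_radon_star[OF g] by (simp add: radon_adjoint_eq[OF g] has_fourier_coeffs_def)
    then show ?thesis
      unfolding adjoint_coeff_def using has_sum_infsum[OF adjoint_coeff_bound(1)[OF g]] by simp
  qed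
  show ?thesis
  proof (intro conjI ballI allI)
    show "\<exists>C. \<forall>f\<in>sobolev s. data_norm d s w (radon d f) \<le> C * sobolev_norm s f"
      using radon_data_space(2) by blast
    show "\<exists>!S. is_radon_adjoint d s w S"
      unfolding is_radon_adjoint_iff by simp
  next
    fix f :: "'n distr" assume f: "f \<in> sobolev s"
    show R: "radon d f \<in> data_space d s w" by (rule radon_data_space(1)[OF f])
    show "f \<in> multiplier_domain (normal_symbol d w)" by (rule normal_symbol_domain[OF sobolevD(1)[OF f]])
    show "radon_adjoint d s w (radon d f) \<in> sobolev s"
      by (simp add: radon_adjoint_eq[OF R] radon_star_sobolev[OF R])
    show "radon_adjoint d s w (radon d f) = multiplier (normal_symbol d w) f"
      by (simp add: radon_adjoint_eq[OF R] radon_star_radon[OF sobolevD(1)[OF f]])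
  next
    fix g :: "(rat ^ 'n) set \<Rightarrow> 'n distr" and k assume "g \<in> radon d ` distributions"
    then show "(\<lambda>A. of_real ((w k A)\<^sup>2) * fourier_coeff (g A) k :: complex) summable_on Omega d k"
      using has_sum_imp_summable[OF adjoint_coeff_radon(1)] by auto
  next
    show "((\<lambda>A. of_real ((w k A)\<^sup>2) * fourier_coeff (g A) k)
        has_sum fourier_coeff (radon_adjoint d s w g) k) (Omega d k)" if "g \<in> data_space d s w" for g k
      using that by (rule adj)
  \<comment> \<open>Among the remaining goals is the right-inverse property on the range: for g = R
    f the left inverse returns f, and R maps it back to g.\<close>
  qed (auto simp: radon_inversion has_fourier_coeffs_radon_star_radon inverse_symbol_domain
      dest: radon_distributions[THEN subsetD[OF equalityD1[OF refl]]])
qed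

end
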